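(* Fix $1<p<\infty$. There is a constant $C=C_p\in\mathbb{N}$, depending only on $p$, such that for every $f\in L^p(\mathbb{T})$ with $\|f\|_p\le 1$ and every $n\in\mathbb{N}$, writing $\mu=\mu^{(p)}_f$, $\sigma=\sigma^{(p)}_f$, $\varphi=\varphi^{(p)}_f$: (a) $\varphi(n)\le \mu(n+C)+n+C$; (b) $\mu(n)\le 2\varphi(n+C)+n+C$; (c) $\sigma(n)\le \mu(n+C)$; (d) $\mu(n)\le \sigma(n+C)+pn+C$.
   Context: $\mathbb{T}=[0,1)\bmod 1$ is the unit interval with wraparound, with Lebesgue measure; $L^p(\mathbb{T})$ is the space of (classes of) measurable $p$-integrable complex functions on $\mathbb{T}$ with $\|f\|_p=(\int_0^1|f(t)|^p\,dt)^{1/p}$. For $\delta\in\mathbb{R}$, $(\tau_\delta f)(t):=f(t+\delta\bmod 1)$. $L^p$-modulus: $\mu^{(p)}_f(n)$ is the least $m\in\mathbb{N}$ such that $\|f-\tau_\delta f\|_p\le 2^{-n}$ for all $|\delta|\le 2^{-m}$. Step rate: for $K\ge1$, $\mathcal{S}_K(\mathbb{T})$ is the space of complex functions constant on each interval $[k/K,(k+1)/K)$, $0\le k<K$; $\sigma^{(p)}_f(n)$ is the least $s\in\mathbb{N}$ such that some $g\in\mathcal{S}_{2^s}(\mathbb{T})$ satisfies $\|f-g\|_p\le 2^{-n}$. Fourier rate: $\hat f_k=\int_0^1 f(t)e^{-2\pi ikt}\,dt$ for $k\in\mathbb{Z}$, $\mathcal{F}_Kf(t)=\sum_{|k|\le K}\hat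 f_k e^{2\pi ikt}$; $\varphi^{(p)}_f(n)$ is the least $m\in\mathbb{N}$ such that $\|f-\mathcal{F}_{2^m}f\|_p\le 2^{-n}$. *)

theory Defs
  imports "HOL-Analysis.Analysis"
begin

text \<open>Functions on the torus T = [0,1) mod 1 are represented by functions
  real \<Rightarrow> complex; only their values on [0,1) matter.\<close>

definition torus_shift :: "real \<Rightarrow> (real \<Rightarrow> complex) \<Rightarrow> real \<Rightarrow> complex" where
  "torus_shift \<delta> f t = f (frac (t + \<delta>))"

definition in_Lp :: "real \<Rightarrow> (real \<Rightarrow> complex) \<Rightarrow> bool" where
  "in_Lp p f \<longleftrightarrow> set_borel_measurable lborel {0..<1} f \<and>
     set_integrable lborel {0..<1} (\<lambda>t. norm (f t) powr p)"

definition lp_norm :: "real \<Rightarrow> (real \<Rightarrow> complex) \<Rightarrow> real" where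
  "lp_norm p f = (set_lebesgue_integral lborel {0..<1} (\<lambda>t. norm (f t) powr p)) powr (1 / p)"

definition Lp_modulus :: "real \<Rightarrow> (real \<Rightarrow> complex) \<Rightarrow> nat \<Rightarrow> nat" where
  "Lp_modulus p f n = (LEAST m::nat. \<forall>\<delta>::real. \<bar>\<delta>\<bar> \<le> inverse (2 ^ m) \<longrightarrow>
       lp_norm p (\<lambda>t. f t - torus_shift \<delta> f t) \<le> inverse (2 ^ n))"

definition step_fun :: "nat \<Rightarrow> (real \<Rightarrow> complex) \<Rightarrow> bool" where
  "step_fun K g \<longleftrightarrow> (\<forall>k<K. \<forall>s t. s \<in> {real k / real K ..< real (k+1) / real K} \<longrightarrow>
       t \<in> {real k / real K ..< real (k+1) / real K} \<longrightarrow> g s = g t)"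

definition Lp_step_rate :: "real \<Rightarrow> (real \<Rightarrow> complex) \<Rightarrow> nat \<Rightarrow> nat" where
  "Lp_step_rate p f n = (LEAST s::nat. \<exists>g. step_fun (2 ^ s) g \<and>
       lp_norm p (\<lambda>t. f t - g t) \<le> inverse (2 ^ n))"

definition fourier_coeff :: "(real \<Rightarrow> complex) \<Rightarrow> int \<Rightarrow> complex" where
  "fourier_coeff f k = set_lebesgue_integral lborel {0..<1}
       (\<lambda>t. f t * cis (- 2 * pi * real_of_int k * t))"

definition fourier_partial :: "(real \<Rightarrow> complex) \<Rightarrow> nat \<Rightarrow> real \<Rightarrow> complex" where
  "fourier_partial f K t = (\<Sum>k \<in> {- int K .. int K}. fourier_coeff f k * cis (2 * pi * real_of_int k * t))"

definition Lp_fourier_rate :: "real \<Rightarrow> (real \<Rightarrow> complex) \<Rightarrow> nat \<Rightarrow> nat" where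
  "Lp_fourier_rate p f n = (LEAST m::nat.
       lp_norm p (\<lambda>t. f t - fourier_partial f (2 ^ m) t) \<le> inverse (2 ^ n))"

end

theory Submission
  imports Defs "HOL-Complex_Analysis.Conformal_Mappings"
begin

text \<open>
  The heart of the matter is M. Riesz's theorem: the Fourier partial sums are bounded on
  \<open>L\<^sup>p\<close> uniformly in the degree. For \<open>1 < p \<le> 2\<close>, let \<open>u > 0\<close> be a Fejer mean of a nonnegative
  function and let \<open>F\<close> be the polynomial in \<open>z\<close> with \<open>Re F = u\<close> on the unit circle. Then \<open>Re F > 0\<close> on
  the disc, so \<open>F\<^sup>p\<close> is holomorphic there; the inequality \<open>|F|\<^sup>p \<le> A u\<^sup>p - B Re F\<^sup>p\<close> on the right
  half plane together with the mean value property bounds the norm of \<open>F\<close> by that of \<open>u\<close>. This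
  controls the projection to nonnegative frequencies, hence (after modulations) the partial sums;
  \<open>p > 2\<close> follows by duality.

  Given this, (a) reduces to approximating \<open>f\<close> by Fejer means. Their kernel has mass at most
  \<open>1/(N \<eta>)\<close> outside \<open>[-\<eta>, \<eta>]\<close>, which accounts for the summand \<open>n\<close>. For (b), the crude bound
  \<open>O(K\<^sup>2 |\<delta>|)\<close> for the oscillation of a partial sum of degree \<open>K\<close> suffices. For (c), average \<open>f\<close> over
  the intervals. For (d), a step function on \<open>K\<close> intervals differs from its translate by \<open>\<delta>\<close> only
  on a fraction \<open>K |\<delta>|\<close> of each interval, so that \<open>K |\<delta>| \<le> 2 powr (- p n)\<close> is required.

  Since constants may depend on \<open>p\<close>, everything is phrased in terms of \<open>\<integral> |f|\<^sup>p\<close> with the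
  quasi-triangle inequality \<open>|a + b|\<^sup>p \<le> 2\<^sup>p (|a|\<^sup>p + |b|\<^sup>p)\<close>; neither Minkowski's nor Hoelder's
  inequality is needed.
\<close>

section \<open>Integrals of \<open>p\<close>-th powers\<close>

text \<open>The rate in (a) concerns the sharp partial sums, whose kernels have unbounded mass.
  Averaging against a positive kernel, which suffices for Fejer means, cannot bound them; hence the
  detour through holomorphic functions. Triangular weights are used there because they keep a
  nonnegative function nonnegative, and \<open>Re F > 0\<close> makes the principal branch of the
  power holomorphic on the disc. A combination of two triangles is exactly 1 on the required
  frequencies, so the sharp cutoff can be recovered afterwards. All three rates are
  \<open>LEAST\<close> values and carry information only if a witness exists. Continuity of
  translations in \<open>L^p\<close> supplies one for the modulus; the estimates behind (a) and (c)
  then supply the other two. Each estimate loses a factor \<open>c\<close> on the p-th power.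
  Raising the accuracy from \<open>n\<close> to \<open>n + C\<close> gains
  \<open>2 powr (- p C)\<close>, which is at most \<open>2 powr (- C)\<close>, so
  \<open>c \<le> 2 ^ C\<close> suffices.\<close>

definition Lpow :: "real \<Rightarrow> (real \<Rightarrow> complex) \<Rightarrow> ennreal" where
  "Lpow p f = (\<integral>\<^sup>+t\<in>{0..<1}. ennreal (norm (f t) powr p) \<partial>lborel)"

lemma Lpow_mono:
  assumes "\<And>t. 0 \<le> t \<Longrightarrow> t < 1 \<Longrightarrow> norm (f t) \<le> norm (g t)" "0 \<le> p"
  shows "Lpow p f \<le> Lpow p g"
  unfolding Lpow_def
  by (rule nn_integral_mono) (auto simp: indicator_def intro!: ennreal_leI powr_mono2 assms)

lemma Lpow_cong:
  assumes "\<And>t. 0 \<le> t \<Longrightarrow> t < 1 \<Longrightarrow> norm (f t) = norm (g t)"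
  shows "Lpow p f = Lpow p g"
  unfolding Lpow_def
  by (rule nn_integral_cong) (auto simp: indicator_def assms)

lemma Lpow_const: "Lpow p (\<lambda>t. c) = ennreal (norm c powr p)"
  unfolding Lpow_def by (simp add: nn_integral_cmult_indicator)

lemma Lpow_cmult:
  assumes [measurable]: "f \<in> borel_measurable borel"
  shows "Lpow p (\<lambda>t. c * f t) = ennreal (norm c powr p) * Lpow p f"
  unfolding Lpow_def
  by (subst nn_integral_cmult[symmetric], measurable)
     (auto simp: norm_mult powr_mult ennreal_mult' mult.assoc intro!: nn_integral_cong)

lemma powr_add_le:
  fixes a b p :: real
  assumes "0 \<le> a" "0 \<le> b" "0 \<le> p"
  shows "(a + b) powr p \<le> 2 powr p * (a powr p + b powr p)"
proof -
  have "(a + b) powr p \<le> (2 * max a b) powr p"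
    using assms by (intro powr_mono2) auto
  also have "\<dots> = 2 powr p * max a b powr p"
    using assms by (simp add: powr_mult)
  also have "\<dots> \<le> 2 powr p * (a powr p + b powr p)"
    by (intro mult_left_mono) (auto simp: max_def)
  finally show ?thesis .
qed

lemma Lpow_add_le:
  assumes [measurable]: "f \<in> borel_measurable borel" "g \<in> borel_measurable borel"
    and p: "0 \<le> p" and le: "\<And>t. 0 \<le> t \<Longrightarrow> t < 1 \<Longrightarrow> norm (h t) \<le> norm (f t) + norm (g t)"
  shows "Lpow p h \<le> ennreal (2 powr p) * (Lpow p f + Lpow p g)"
proof -
  have "Lpow p h \<le> (\<integral>\<^sup>+t. ennreal (2 powr p) * (ennreal (norm (f t) powr p) * indicator {0..<1} t
      + ennreal (norm (g t) powr p) * indicator {0..<1} t) \<partial>lborel)"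
    unfolding Lpow_def
  proof (rule nn_integral_mono)
    fix t :: real
    have "norm (h t) powr p \<le> 2 powr p * (norm (f t) powr p + norm (g t) powr p)" if "0 \<le> t" "t < 1"
    proof -
      have "norm (h t) powr p \<le> (norm (f t) + norm (g t)) powr p"
        using le that p by (intro powr_mono2) auto
      also have "\<dots> \<le> 2 powr p * (norm (f t) powr p + norm (g t) powr p)"
        by (rule powr_add_le) (use p in auto)
      finally show ?thesis .
    qed
    then show "ennreal (norm (h t) powr p) * indicator {0..<1} t \<le>
      ennreal (2 powr p) * (ennreal (norm (f t) powr p) * indicator {0..<1} t
      + ennreal (norm (g t) powr p) * indicator {0..<1} t)"
      by (auto simp: indicator_def simp flip: ennreal_plus ennreal_mult intro!: ennreal_leI)
  qed
  also have "\<dots> = ennreal (2 powr p) * (Lpow p f + Lpow p g)"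
    unfolding Lpow_def by (subst nn_integral_cmult, measurable) (subst nn_integral_add, auto)
  finally show ?thesis .
qed

text \<open>A convex function lies above its tangent at \<open>d\<close>. The terms are arranged so
  that all are nonnegative and can be integrated in \<open>ennreal\<close>. Convexity is taken on
  the open half-line, hence the separate case \<open>t = 0\<close>.\<close>

lemma powr_tangent:
  fixes t d p :: real
  assumes "0 \<le> t" "0 < d" "1 \<le> p"
  shows "p * d powr (p - 1) * t \<le> t powr p + (p - 1) * d powr p"
proof (cases "t = 0")
  case False
  have "p * d powr (p - 1) * (t - d) \<le> t powr p - d powr p"
    using assms False
    by (intro convex_on_imp_above_tangent[where A = "{0<..}"] powr_convex)
       (auto intro!: derivative_eq_intros simp: interior_open)
  moreover have "p * d powr (p - 1) * d = p * d powr p"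
    using powr_add[of d "p - 1" 1] assms by simp
  ultimately show ?thesis by (simp add: right_diff_distrib left_diff_distrib)
qed (use assms in auto)

text \<open>Jensen's inequality for a density of total mass at most \<open>m\<close>, obtained by
  integrating one tangent inequality. If the integrand is not integrable, its Bochner integral is 0
  and the claim is trivial.\<close>

lemma weighted_powr_mean:
  fixes w :: "'a \<Rightarrow> real" and f :: "'a \<Rightarrow> complex"
  assumes [measurable]: "w \<in> borel_measurable M" "f \<in> borel_measurable M"
    and w: "\<And>x. 0 \<le> w x" and m: "0 < m" "(\<integral>\<^sup>+x. ennreal (w x) \<partial>M) \<le> ennreal m"
    and p: "1 \<le> p"
  shows "ennreal (norm (\<integral>x. of_real (w x) * f x \<partial>M) powr p)
     \<le> ennreal (m powr (p - 1)) * (\<integral>\<^sup>+x. ennreal (w x * norm (f x) powr p) \<partial>M)"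
proof -
  define c where "c = norm (\<integral>x. of_real (w x) * f x \<partial>M)"
  show ?thesis
  proof (cases "c = 0")
    case True
    then show ?thesis by (simp add: c_def)
  next
    case False
    then have c: "c > 0" by (simp add: c_def)
    \<comment> \<open>The tangent is taken at the mean value, where the integrated inequality is
      sharpest.\<close>
    define d where "d = c / m"
    have d: "d > 0" using c m by (simp add: d_def)
    have int: "integrable M (\<lambda>x. of_real (w x) * f x)"
      using False not_integrable_integral_eq unfolding c_def by fastforce
    have "ennreal c \<le> (\<integral>\<^sup>+x. ennreal (norm (of_real (w x) * f x)) \<partial>M)"
    proof -
      have "c \<le> (\<integral>x. norm (of_real (w x) * f x) \<partial>M)" unfolding c_def by (rule integral_norm_bound)
      then show ?thesis
        by (subst nn_integral_eq_integral) (use int in \<open>auto intro!: integrable_norm ennreal_leI\<close>)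
    qed
    then have c_le: "ennreal c \<le> (\<integral>\<^sup>+x. ennreal (w x * norm (f x)) \<partial>M)"
      using w by (simp add: norm_mult)
    \<comment> \<open>For this \<open>d\<close> the left side splits into the wanted term
      \<open>d powr p * m\<close> and exactly the mass term on the right, which is finite and
      cancels.\<close>
    have md: "p * d powr (p - 1) * c = p * (d powr p * m)"
      using c m d by (simp add: d_def powr_diff)
    have "ennreal (d powr p * m) + ennreal ((p - 1) * d powr p * m) = ennreal (p * d powr (p - 1) * c)"
      unfolding md using p m d by (subst ennreal_plus[symmetric]) (auto simp: algebra_simps)
    also have "\<dots> = ennreal (p * d powr (p - 1)) * ennreal c"
      using p c by (simp add: ennreal_mult)
    also have "\<dots> \<le> ennreal (p * d powr (p - 1)) * (\<integral>\<^sup>+x. ennreal (w x * norm (f x)) \<partial>M)"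
      by (intro mult_left_mono c_le) auto
    also have "\<dots> = (\<integral>\<^sup>+x. ennreal (p * d powr (p - 1)) * ennreal (w x * norm (f x)) \<partial>M)"
      by (rule nn_integral_cmult[symmetric]) measurable
    also have "\<dots> \<le> (\<integral>\<^sup>+x. ennreal (w x * norm (f x) powr p) + ennreal ((p - 1) * d powr p) * ennreal (w x) \<partial>M)"
    proof (rule nn_integral_mono)
      fix x
      have "p * d powr (p - 1) * norm (f x) \<le> norm (f x) powr p + (p - 1) * d powr p"
        by (rule powr_tangent) (use d p in auto)
      then have "w x * (p * d powr (p - 1) * norm (f x)) \<le> w x * (norm (f x) powr p + (p - 1) * d powr p)"
        by (intro mult_left_mono w)
      then show "ennreal (p * d powr (p - 1)) * ennreal (w x * norm (f x))
        \<le> ennreal (w x * norm (f x) powr p) + ennreal ((p - 1) * d powr p) * ennreal (w x)"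
        using w[of x] p d mult_nonneg_nonneg[of "p - 1" "d powr p"]
        by (simp add: ennreal_mult[symmetric] ennreal_plus[symmetric] del: ennreal_plus)
          (auto intro!: ennreal_leI simp: algebra_simps)
    qed
    also have "\<dots> = (\<integral>\<^sup>+x. ennreal (w x * norm (f x) powr p) \<partial>M)
        + ennreal ((p - 1) * d powr p) * (\<integral>\<^sup>+x. ennreal (w x) \<partial>M)"
      by (subst nn_integral_add, measurable) (subst nn_integral_cmult, auto)
    also have "\<dots> \<le> (\<integral>\<^sup>+x. ennreal (w x * norm (f x) powr p) \<partial>M)
        + ennreal ((p - 1) * d powr p) * ennreal m"
      by (intro add_left_mono mult_left_mono m) auto
    also have "\<dots> = (\<integral>\<^sup>+x. ennreal (w x * norm (f x) powr p) \<partial>M) + ennreal ((p - 1) * d powr p * m)"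
      using p m by (simp add: ennreal_mult)
    finally have *: "ennreal (d powr p * m) \<le> (\<integral>\<^sup>+x. ennreal (w x * norm (f x) powr p) \<partial>M)"
      by (simp add: add.commute[of _ "ennreal ((p - 1) * d powr p * m)"] ennreal_add_left_cancel_le)
    have "ennreal (c powr p) = ennreal (m powr (p - 1)) * ennreal (d powr p * m)"
    proof -
      have "c powr p = m powr (p - 1) * (d powr p * m)"
        using c m by (simp add: d_def powr_divide powr_diff)
      then show ?thesis using m by (subst ennreal_mult[symmetric]) auto
    qed
    also have "\<dots> \<le> ennreal (m powr (p - 1)) * (\<integral>\<^sup>+x. ennreal (w x * norm (f x) powr p) \<partial>M)"
      by (intro mult_left_mono *) auto
    finally show ?thesis by (simp add: c_def)
  qed
qed

lemma nn_integral_translate: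
  fixes h :: "real \<Rightarrow> ennreal"
  assumes [measurable]: "h \<in> borel_measurable borel"
  shows "(\<integral>\<^sup>+x. h (x + d) \<partial>lborel) = (\<integral>\<^sup>+x. h x \<partial>lborel)"
  by (subst (2) nn_integral_real_affine[where c = 1 and t = d]) (auto simp: add.commute)

text \<open>Translation carries the unit interval to \<open>[r, 1 + r)\<close> with
  \<open>r = frac d\<close>; the piece beyond 1 is moved back by one period. Periodicity is
  expressed throughout as invariance under \<open>frac\<close>.\<close>

lemma nn_integral_period_translate:
  fixes h :: "real \<Rightarrow> ennreal"
  assumes [measurable]: "h \<in> borel_measurable borel" and per: "\<And>x. h (frac x) = h x"
  shows "(\<integral>\<^sup>+x\<in>{0..<1}. h (x + d) \<partial>lborel) = (\<integral>\<^sup>+x\<in>{0..<1}. h x \<partial>lborel)"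
proof -
  define r where "r = frac d"
  have r: "0 \<le> r" "r < 1" by (auto simp: r_def frac_lt_1)
  have per1: "h (x + of_int k) = h x" for x k
    using per[of x] per[of "x + of_int k"] by (simp add: frac_def)
  have hd: "h (x + d) = h (x + r)" for x
    using per1[of "x + r" "\<lfloor>d\<rfloor>"] by (simp add: r_def frac_def)
  have "(\<integral>\<^sup>+x\<in>{0..<1}. h (x + d) \<partial>lborel) = (\<integral>\<^sup>+x. h (x + r) * indicator {r..<1+r} (x + r) \<partial>lborel)"
    unfolding hd by (rule nn_integral_cong) (auto simp: indicator_def)
  also have "\<dots> = (\<integral>\<^sup>+x. h x * indicator {r..<1+r} x \<partial>lborel)"
    by (rule nn_integral_translate) measurable
  also have "\<dots> = (\<integral>\<^sup>+x. h x * indicator {r..<1} x + h x * indicator {1..<1+r} x \<partial>lborel)"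
    using r by (intro nn_integral_cong) (auto simp: indicator_def)
  also have "\<dots> = (\<integral>\<^sup>+x. h x * indicator {r..<1} x \<partial>lborel) + (\<integral>\<^sup>+x. h x * indicator {1..<1+r} x \<partial>lborel)"
    by (rule nn_integral_add) auto
  also have "(\<integral>\<^sup>+x. h x * indicator {1..<1+r} x \<partial>lborel) = (\<integral>\<^sup>+x. h (x + 1) * indicator {1..<1+r} (x + 1) \<partial>lborel)"
    by (rule nn_integral_translate[symmetric]) measurable
  also have "\<dots> = (\<integral>\<^sup>+x. h x * indicator {0..<r} x \<partial>lborel)"
    using per1[of _ 1] by (intro nn_integral_cong) (auto simp: indicator_def)
  also have "(\<integral>\<^sup>+x. h x * indicator {r..<1} x \<partial>lborel) + (\<integral>\<^sup>+x. h x * indicator {0..<r} x \<partial>lborel)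
     = (\<integral>\<^sup>+x. h x * indicator {r..<1} x + h x * indicator {0..<r} x \<partial>lborel)"
    by (rule nn_integral_add[symmetric]) auto
  also have "\<dots> = (\<integral>\<^sup>+x\<in>{0..<1}. h x \<partial>lborel)"
    using r by (intro nn_integral_cong) (auto simp: indicator_def)
  finally show ?thesis .
qed

lemma Lpow_translate:
  assumes [measurable]: "f \<in> borel_measurable borel" and per: "\<And>x. f (frac x) = f x"
  shows "Lpow p (\<lambda>x. f (x + d)) = Lpow p f"
  unfolding Lpow_def using per by (intro nn_integral_period_translate) auto

section \<open>Characters and Fejer means\<close>

definition fexp :: "int \<Rightarrow> real \<Rightarrow> complex" where
  "fexp k t = cis (2 * pi * real_of_int k * t)"

lemma fexp_0 [simp]: "fexp 0 t = 1"
  by (simp add: fexp_def)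

lemma norm_fexp [simp]: "norm (fexp k t) = 1"
  by (simp add: fexp_def)

lemma fexp_add: "fexp (j + k) t = fexp j t * fexp k t"
  by (simp add: fexp_def cis_mult algebra_simps)

lemma fexp_minus: "fexp (- k) t = cnj (fexp k t)"
  by (simp add: fexp_def flip: cis_cnj)

lemma fexp_minus_right: "fexp k (- t) = cnj (fexp k t)"
  by (simp add: fexp_def flip: cis_cnj)

lemma fexp_add_right: "fexp k (s + t) = fexp k s * fexp k t"
  by (simp add: fexp_def cis_mult algebra_simps)

lemma fexp_frac [simp]: "fexp k (frac t) = fexp k t"
proof -
  have "fexp k t = fexp k (frac t + of_int \<lfloor>t\<rfloor>)" by (simp add: frac_def)
  also have "\<dots> = fexp k (frac t) * cis (2 * pi * of_int (k * \<lfloor>t\<rfloor>))"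
    unfolding fexp_add_right by (simp add: fexp_def mult.assoc)
  also have "cis (2 * pi * of_int (k * \<lfloor>t\<rfloor>)) = 1"
    by (rule cis_multiple_2pi) auto
  finally show ?thesis by simp
qed

lemma continuous_on_fexp [continuous_intros]: "continuous_on A (fexp k)"
  unfolding fexp_def by (intro continuous_intros)

lemma borel_measurable_fexp [measurable]: "fexp k \<in> borel_measurable borel"
  by (intro borel_measurable_continuous_onI continuous_intros)

lemma set_integral_Ico_eq_Icc:
  fixes f :: "real \<Rightarrow> 'a :: {banach, second_countable_topology}"
  assumes [measurable]: "f \<in> borel_measurable borel"
  shows "(LINT t:{a..<b}|lborel. f t) = (LINT t:{a..b}|lborel. f t)"
  unfolding set_lebesgue_integral_def
proof (rule integral_cong_AE)
  show "AE x in lborel. indicat_real {a..<b} x *\<^sub>R f x = indicat_real {a..b} x *\<^sub>R f x"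
    using AE_lborel_singleton[of b] by eventually_elim (auto simp: indicator_def)
qed auto

lemma set_integrable_mult_bounded:
  fixes f :: "real \<Rightarrow> complex"
  assumes f: "set_integrable lborel A f" and [measurable]: "g \<in> borel_measurable borel"
    and le: "\<And>t. norm (g t) \<le> B"
  shows "set_integrable lborel A (\<lambda>t. f t * g t)"
  unfolding set_integrable_def
proof (rule Bochner_Integration.integrable_bound)
  show "integrable lborel (\<lambda>t. B * norm (indicator A t *\<^sub>R f t))"
    using f unfolding set_integrable_def by (intro integrable_mult_right integrable_norm)
  have [measurable]: "(\<lambda>t. indicator A t *\<^sub>R f t) \<in> borel_measurable lborel"
    using f unfolding set_integrable_def by auto
  have "(\<lambda>t. (indicator A t *\<^sub>R f t) * g t) \<in> borel_measurable lborel" by measurable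
  then show "(\<lambda>t. indicat_real A t *\<^sub>R (f t * g t)) \<in> borel_measurable lborel" by simp
  show "AE t in lborel. norm (indicat_real A t *\<^sub>R (f t * g t)) \<le> norm (B * norm (indicat_real A t *\<^sub>R f t))"
  proof (rule AE_I2)
    fix t
    have "norm (f t) * norm (g t) \<le> norm (f t) * B" by (intro mult_left_mono le) auto
    moreover have "0 \<le> B" using le[of t] norm_ge_zero order_trans by blast
    ultimately show "norm (indicat_real A t *\<^sub>R (f t * g t)) \<le> norm (B * norm (indicat_real A t *\<^sub>R f t))"
      by (auto simp: indicator_def norm_mult mult.commute)
  qed
qed

lemma set_integrable_unit_const: "set_integrable lborel {0..<1::real} (\<lambda>t. c :: complex)"
  unfolding set_integrable_def by (intro integrable_scaleR_left integrable_real_indicator) auto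

lemma set_integrable_fexp: "set_integrable lborel {0..<1} (fexp k)"
  using set_integrable_mult_bounded[OF set_integrable_unit_const[of 1], of "fexp k" 1] by simp

lemma integral_fexp: "(LINT t:{0..<1}|lborel. fexp k t) = (if k = 0 then 1 else 0)"
proof (cases "k = 0")
  case True
  then show ?thesis by (simp add: set_lebesgue_integral_def)
next
  case False
  define c where "c = 2 * pi * real_of_int k"
  have c: "c \<noteq> 0" using False by (simp add: c_def)
  have "(LINT t:{0..1}|lborel. fexp k t) = cis (c * 1) / (\<i> * of_real c) - cis (c * 0) / (\<i> * of_real c)"
    unfolding set_lebesgue_integral_def
  proof (rule integral_FTC_Icc)
    fix x :: real
    have "((\<lambda>x. cis (c * x)) has_vector_derivative (c *\<^sub>R (\<i> * cis (c * x)))) (at x within {0..1})"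
      unfolding cis_conv_exp
      by (auto intro!: derivative_eq_intros has_vector_derivative_real_field simp: scaleR_conv_of_real)
    from has_vector_derivative_divide[OF this, of "\<i> * of_real c"]
    show "((\<lambda>x. cis (c * x) / (\<i> * of_real c)) has_vector_derivative fexp k x) (at x within {0..1})"
      using c by (simp add: fexp_def c_def scaleR_conv_of_real)
  qed (auto intro: continuous_intros)
  also have "cis (c * 1) = 1" using cis_multiple_2pi[of "of_int k"] by (simp add: c_def)
  finally show ?thesis using False by (simp add: set_integral_Ico_eq_Icc)
qed

lemma set_integral_sum:
  fixes f :: "'i \<Rightarrow> 'a \<Rightarrow> 'b :: {banach, second_countable_topology}"
  assumes "\<And>i. i \<in> S \<Longrightarrow> set_integrable M A (f i)"
  shows "(LINT x:A|M. (\<Sum>i\<in>S. f i x)) = (\<Sum>i\<in>S. LINT x:A|M. f i x)"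
  using assms unfolding set_lebesgue_integral_def set_integrable_def scaleR_sum_right
  by (rule Bochner_Integration.integral_sum)

lemma integral_trig_sum:
  assumes "finite S"
  shows "(LINT t:{0..<1}|lborel. (\<Sum>k\<in>S. c k * fexp k t)) = (if 0 \<in> S then c 0 else 0)"
proof -
  have "(LINT t:{0..<1}|lborel. (\<Sum>k\<in>S. c k * fexp k t)) = (\<Sum>k\<in>S. LINT t:{0..<1}|lborel. c k * fexp k t)"
    by (rule set_integral_sum) (auto simp: assms intro: set_integrable_mult_right set_integrable_fexp)
  also have "\<dots> = (\<Sum>k\<in>S. if k = 0 then c k else 0)"
    by (intro sum.cong) (auto simp: integral_fexp)
  also have "\<dots> = (if 0 \<in> S then c 0 else 0)" using assms by (simp add: sum.delta)
  finally show ?thesis .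
qed

lemma fourier_coeff_fexp: "fourier_coeff f k = (LINT t:{0..<1}|lborel. f t * fexp (- k) t)"
  unfolding fourier_coeff_def fexp_def by simp

lemma fourier_coeff_trig_sum:
  assumes "finite S"
  shows "fourier_coeff (\<lambda>t. \<Sum>k\<in>S. c k * fexp k t) j = (if j \<in> S then c j else 0)"
proof -
  have "fourier_coeff (\<lambda>t. \<Sum>k\<in>S. c k * fexp k t) j
      = (LINT t:{0..<1}|lborel. (\<Sum>k\<in>S. c k * fexp (k - j) t))"
    unfolding fourier_coeff_fexp
    by (simp add: sum_distrib_right fexp_add[of _ "- j", simplified] mult.assoc)
  also have "\<dots> = (LINT t:{0..<1}|lborel. (\<Sum>k\<in>(\<lambda>k. k - j) ` S. c (k + j) * fexp k t))"
    by (subst sum.reindex) (auto simp: inj_on_def)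
  also have "\<dots> = (if 0 \<in> (\<lambda>k. k - j) ` S then c (0 + j) else 0)"
    using assms by (intro integral_trig_sum) auto
  also have "0 \<in> (\<lambda>k. k - j) ` S \<longleftrightarrow> j \<in> S" by auto
  finally show ?thesis by simp
qed

text \<open>A Fourier multiplier truncated at degree \<open>N\<close>. Partial sums, Fejer means and
  one-sided projections are all instances, so linearity and the composition of symbols are settled
  once.\<close>

definition fourier_mult :: "(int \<Rightarrow> complex) \<Rightarrow> nat \<Rightarrow> (real \<Rightarrow> complex) \<Rightarrow> real \<Rightarrow> complex" where
  "fourier_mult c N f t = (\<Sum>k\<in>{- int N..int N}. c k * fourier_coeff f k * fexp k t)"

lemma fourier_partial_eq_mult: "fourier_partial f N = fourier_mult (\<lambda>_. 1) N f"
  unfolding fourier_partial_def fourier_mult_def fexp_def by simp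

lemma borel_measurable_fourier_mult [measurable]: "fourier_mult c N f \<in> borel_measurable borel"
  unfolding fourier_mult_def by measurable

lemma fourier_mult_frac [simp]: "fourier_mult c N f (frac t) = fourier_mult c N f t"
  unfolding fourier_mult_def by simp

lemma fourier_coeff_fourier_mult:
  "fourier_coeff (fourier_mult c N f) k = (if \<bar>k\<bar> \<le> int N then c k * fourier_coeff f k else 0)"
proof -
  have "fourier_coeff (fourier_mult c N f) k = (if k \<in> {- int N..int N} then c k * fourier_coeff f k else 0)"
    unfolding fourier_mult_def by (rule fourier_coeff_trig_sum) auto
  then show ?thesis by (auto simp: abs_le_iff)
qed

section \<open>The Fejer kernel: positivity, unit mass, contraction\<close>

definition fejer_kernel :: "nat \<Rightarrow> real \<Rightarrow> real" where
  "fejer_kernel N t = (norm (\<Sum>j\<le>N. fexp (int j) t))\<^sup>2 / real (N + 1)"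

definition fejer_weight :: "nat \<Rightarrow> int \<Rightarrow> complex" where
  "fejer_weight N k = of_real (1 - \<bar>real_of_int k\<bar> / real (N + 1))"

lemma sum_symmetric_Suc:
  fixes g :: "int \<Rightarrow> 'a::comm_monoid_add"
  shows "(\<Sum>k\<in>{- int (Suc M)..int (Suc M)}. g k)
    = (\<Sum>k\<in>{- int M..int M}. g k) + (g (int (Suc M)) + g (- int (Suc M)))"
proof -
  have *: "{- int (Suc M)..int (Suc M)} = insert (int (Suc M)) (insert (- int (Suc M)) {- int M..int M})"
    by auto
  show ?thesis unfolding * by (simp add: ac_simps)
qed

text \<open>The defining square gives positivity, this expansion gives the coefficients. Raising the
  degree adds one character \<open>E\<close> to \<open>D\<close>, and
  \<open>|D + E|^2 - |D|^2\<close> is the sum of all characters of frequency at most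
  \<open>N + 1\<close>; so every triangular coefficient grows by one.\<close>

lemma fejer_kernel_eq:
  "of_real (fejer_kernel N t) = (\<Sum>k\<in>{- int N..int N}. fejer_weight N k * fexp k t)"
proof -
  have dirichlet: "(\<Sum>k\<in>{- int M..int M}. fexp k t) = 1 + (\<Sum>j<M. fexp (int (Suc j)) t) + cnj (\<Sum>j<M. fexp (int (Suc j)) t)" for M
    by (induction M) (simp_all del: of_nat_Suc add: sum_symmetric_Suc fexp_minus)
  have "of_real ((norm (\<Sum>j\<le>N. fexp (int j) t))\<^sup>2)
     = (\<Sum>k\<in>{- int N..int N}. of_int (int N + 1 - \<bar>k\<bar>) * fexp k t)"
  proof (induction N)
    case (Suc N)
    define D where "D = (\<Sum>j\<le>N. fexp (int j) t)"
    define E where "E = fexp (int (Suc N)) t"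
    have ED: "E * cnj D = (\<Sum>j<Suc N. fexp (int (Suc j)) t)"
    proof -
      have "E * cnj D = (\<Sum>j<Suc N. fexp (int (Suc N - j)) t)"
        unfolding D_def E_def cnj_sum sum_distrib_left lessThan_Suc_atMost
        by (intro sum.cong) (auto simp: of_nat_diff fexp_add[of _ "- int _", simplified fexp_minus, simplified] simp del: of_nat_Suc)
      also have "\<dots> = (\<Sum>j<Suc N. fexp (int (Suc j)) t)"
        by (subst sum.nat_diff_reindex[symmetric], intro sum.cong) (auto simp del: of_nat_Suc simp: Suc_diff_Suc)
      finally show ?thesis .
    qed
    have EE: "E * cnj E = 1"
      unfolding E_def by (simp add: fexp_add[symmetric] flip: fexp_minus)
    have "of_real ((norm (\<Sum>j\<le>Suc N. fexp (int j) t))\<^sup>2) = (D + E) * cnj (D + E)"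
      unfolding D_def E_def by (subst complex_norm_square) simp
    also have "\<dots> = D * cnj D + (1 + E * cnj D + cnj (E * cnj D))"
      using EE by (simp add: algebra_simps)
    also have "D * cnj D = (\<Sum>k\<in>{- int N..int N}. of_int (int N + 1 - \<bar>k\<bar>) * fexp k t)"
      unfolding Suc.IH[symmetric] D_def by (rule complex_norm_square[symmetric])
    also have "\<dots> = (\<Sum>k\<in>{- int (Suc N)..int (Suc N)}. of_int (int N + 1 - \<bar>k\<bar>) * fexp k t)"
      unfolding sum_symmetric_Suc by simp
    also have "1 + E * cnj D + cnj (E * cnj D) = (\<Sum>k\<in>{- int (Suc N)..int (Suc N)}. fexp k t)"
      unfolding ED dirichlet by simp
    also have "(\<Sum>k\<in>{- int (Suc N)..int (Suc N)}. of_int (int N + 1 - \<bar>k\<bar>) * fexp k t) + \<dots>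
      = (\<Sum>k\<in>{- int (Suc N)..int (Suc N)}. of_int (int (Suc N) + 1 - \<bar>k\<bar>) * fexp k t)"
      by (simp add: algebra_simps flip: sum.distrib)
    finally show ?case .
  qed simp
  moreover have "of_int (int N + 1 - \<bar>k\<bar>) / of_real (real (N + 1)) = fejer_weight N k" for k
  proof -
    have "1 + (of_nat N :: complex) \<noteq> 0"
      by (metis of_nat_Suc of_nat_eq_0_iff nat.distinct(1))
    then show ?thesis unfolding fejer_weight_def by (simp add: field_simps flip: of_int_abs)
  qed
  ultimately show ?thesis
    unfolding fejer_kernel_def of_real_divide by (simp add: sum_divide_distrib flip: times_divide_eq_left)
qed

lemma fejer_kernel_nonneg [simp]: "0 \<le> fejer_kernel N t"
  unfolding fejer_kernel_def by simp

lemma fejer_kernel_minus [simp]: "fejer_kernel N (- t) = fejer_kernel N t"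
  unfolding fejer_kernel_def fexp_minus_right by (simp flip: cnj_sum)

lemma fejer_kernel_frac [simp]: "fejer_kernel N (frac t) = fejer_kernel N t"
  unfolding fejer_kernel_def by simp

lemma borel_measurable_fejer_kernel [measurable]: "fejer_kernel N \<in> borel_measurable borel"
  unfolding fejer_kernel_def by measurable

lemma fejer_kernel_le: "fejer_kernel N t \<le> real (N + 1)"
proof -
  have "norm (\<Sum>j\<le>N. fexp (int j) t) \<le> real (N + 1)"
    by (rule order_trans[OF norm_sum]) simp
  then have "(norm (\<Sum>j\<le>N. fexp (int j) t))\<^sup>2 \<le> (real (N + 1))\<^sup>2"
    by (intro power_mono) auto
  then show ?thesis unfolding fejer_kernel_def by (simp add: power2_eq_square field_simps)
qed

text \<open>The mass is the coefficient at frequency 0. Integrability follows from the value: a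
  non-integrable function would have Bochner integral 0.\<close>

lemma nn_integral_fejer_kernel: "(\<integral>\<^sup>+t\<in>{0..<1}. ennreal (fejer_kernel N t) \<partial>lborel) = 1"
proof -
  have "(LINT t:{0..<1}|lborel. complex_of_real (fejer_kernel N t)) = 1"
    unfolding fejer_kernel_eq by (subst integral_trig_sum) (auto simp: fejer_weight_def)
  then have "(LINT t:{0..<1}|lborel. fejer_kernel N t) = 1"
    unfolding set_integral_complex_of_real by simp
  then have "(\<integral>t. fejer_kernel N t * indicator {0..<1} t \<partial>lborel) = 1"
    by (simp add: set_lebesgue_integral_def mult.commute)
  then show ?thesis
    using nn_integral_eq_integral[of lborel "\<lambda>t. fejer_kernel N t * indicator {0..<1} t"]
      not_integrable_integral_eq[of lborel "\<lambda>t. fejer_kernel N t * indicator {0..<1} t"]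
    by (auto simp: ennreal_mult ennreal_indicator)
qed

lemma nn_integral_fejer_kernel_diff:
  "(\<integral>\<^sup>+y\<in>{0..<1}. ennreal (fejer_kernel N (x - y)) \<partial>lborel) = 1"
  "(\<integral>\<^sup>+x\<in>{0..<1}. ennreal (fejer_kernel N (x - y)) \<partial>lborel) = 1"
proof -
  have *: "(\<integral>\<^sup>+y\<in>{0..<1}. ennreal (fejer_kernel N (y + d)) \<partial>lborel) = 1" for d
    by (subst nn_integral_period_translate) (auto simp: nn_integral_fejer_kernel)
  show "(\<integral>\<^sup>+x\<in>{0..<1}. ennreal (fejer_kernel N (x - y)) \<partial>lborel) = 1"
    using *[of "- y"] by simp
  show "(\<integral>\<^sup>+y\<in>{0..<1}. ennreal (fejer_kernel N (x - y)) \<partial>lborel) = 1"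
    using *[of "- x"] fejer_kernel_minus[of N "x - _"] by simp
qed

abbreviation fejer_mean :: "nat \<Rightarrow> (real \<Rightarrow> complex) \<Rightarrow> real \<Rightarrow> complex" where
  "fejer_mean N \<equiv> fourier_mult (fejer_weight N) N"

text \<open>The domination \<open>|f| \<le> 1 + |f|^p\<close> on an interval of finite
  length.\<close>

lemma set_integrable_of_Lpow:
  assumes [measurable]: "f \<in> borel_measurable borel" and "1 \<le> p" "Lpow p f < \<infinity>"
  shows "set_integrable lborel {0..<1} f"
  unfolding set_integrable_def
proof (rule integrableI_bounded)
  have "(\<integral>\<^sup>+t. ennreal (norm (indicator {0..<1} t *\<^sub>R f t)) \<partial>lborel)
     \<le> (\<integral>\<^sup>+t. indicator {0..<1} t + ennreal (norm (f t) powr p) * indicator {0..<1} t \<partial>lborel)"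
  proof (rule nn_integral_mono)
    fix t :: real
    have "norm (f t) \<le> 1 + norm (f t) powr p"
    proof (cases "norm (f t) \<le> 1")
      case False
      then have "norm (f t) powr 1 \<le> norm (f t) powr p"
        using assms by (intro powr_mono) auto
      then show ?thesis using False by simp
    qed (auto intro: add_increasing2)
    then show "ennreal (norm (indicator {0..<1} t *\<^sub>R f t))
        \<le> indicator {0..<1} t + ennreal (norm (f t) powr p) * indicator {0..<1} t"
      using ennreal_leI[of "norm (f t)" "1 + norm (f t) powr p"] by (auto simp: indicator_def)
  qed
  also have "\<dots> = 1 + Lpow p f"
    unfolding Lpow_def by (subst nn_integral_add) auto
  also have "\<dots> < \<infinity>" using assms by simp
  finally show "(\<integral>\<^sup>+t. ennreal (norm (indicator {0..<1} t *\<^sub>R f t)) \<partial>lborel) < \<infinity>" .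
qed measurable

text \<open>The multiplier form serves the algebra of frequencies; this convolution form brings in
  the positivity of the kernel.\<close>

lemma fejer_mean_eq:
  assumes f: "set_integrable lborel {0..<1} f"
  shows "fejer_mean N f x = (LINT y:{0..<1}|lborel. of_real (fejer_kernel N (x - y)) * f y)"
proof -
  have "(LINT y:{0..<1}|lborel. of_real (fejer_kernel N (x - y)) * f y)
     = (LINT y:{0..<1}|lborel. (\<Sum>k\<in>{- int N..int N}. fejer_weight N k * fexp k x * (f y * fexp (- k) y)))"
    using fexp_add_right[of _ x "- _"]
    by (simp add: fejer_kernel_eq sum_distrib_right sum_distrib_left fexp_minus fexp_minus_right ac_simps)
  also have "\<dots> = (\<Sum>k\<in>{- int N..int N}. LINT y:{0..<1}|lborel. fejer_weight N k * fexp k x * (f y * fexp (- k) y))"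
    by (rule set_integral_sum)
       (auto intro!: set_integrable_mult_right set_integrable_mult_bounded[OF f, where B = 1])
  also have "\<dots> = fejer_mean N f x"
    unfolding fourier_mult_def fourier_coeff_fexp set_integral_mult_right by (simp add: ac_simps)
  finally show ?thesis ..
qed

text \<open>For fixed \<open>x\<close> the kernel is a probability density in \<open>y\<close>, so
  Jensen's inequality applies; after Tonelli its unit mass in \<open>x\<close> leaves the constant
  1.\<close>

lemma Lpow_fejer_mean:
  assumes [measurable]: "f \<in> borel_measurable borel" and p: "1 \<le> p" and fin: "Lpow p f < \<infinity>"
  shows "Lpow p (fejer_mean N f) \<le> Lpow p f"
proof -
  have f: "set_integrable lborel {0..<1} f"
    by (rule set_integrable_of_Lpow) (use assms in auto)
  have "Lpow p (fejer_mean N f) \<le> (\<integral>\<^sup>+x\<in>{0..<1}. (\<integral>\<^sup>+y\<in>{0..<1}. ennreal (fejer_kernel N (x - y) * norm (f y) powr p) \<partial>lborel) \<partial>lborel)"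
    unfolding Lpow_def
  proof (intro nn_integral_mono mult_right_mono)
    fix x :: real
    have "ennreal (norm (fejer_mean N f x) powr p)
      = ennreal (norm (\<integral>y. of_real (fejer_kernel N (x - y) * indicator {0..<1} y) * f y \<partial>lborel) powr p)"
      unfolding fejer_mean_eq[OF f] set_lebesgue_integral_def
      by (intro arg_cong[where f = ennreal] arg_cong2[where f = "(powr)"] arg_cong[where f = norm] Bochner_Integration.integral_cong)
         (auto simp: indicator_def)
    also have "\<dots> \<le> ennreal (1 powr (p - 1)) *
        (\<integral>\<^sup>+y. ennreal (fejer_kernel N (x - y) * indicator {0..<1} y * norm (f y) powr p) \<partial>lborel)"
      by (rule weighted_powr_mean)
         (use p nn_integral_fejer_kernel_diff(1)[of N x] in \<open>auto simp: ennreal_mult ennreal_indicator\<close>)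
    also have "\<dots> = (\<integral>\<^sup>+y\<in>{0..<1}. ennreal (fejer_kernel N (x - y) * norm (f y) powr p) \<partial>lborel)"
      by (auto simp: indicator_def intro!: nn_integral_cong)
    finally show "ennreal (norm (fejer_mean N f x) powr p) \<le> \<dots>" .
  qed auto
  also have "\<dots> = (\<integral>\<^sup>+x. (\<integral>\<^sup>+y. ennreal (fejer_kernel N (x - y) * norm (f y) powr p) * indicator {0..<1} y * indicator {0..<1} x \<partial>lborel) \<partial>lborel)"
    by (subst nn_integral_multc) auto
  also have "\<dots> = (\<integral>\<^sup>+y. (\<integral>\<^sup>+x. ennreal (fejer_kernel N (x - y) * norm (f y) powr p) * indicator {0..<1} y * indicator {0..<1} x \<partial>lborel) \<partial>lborel)"
    by (rule lborel_pair.Fubini') measurable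
  also have "\<dots> = (\<integral>\<^sup>+y. (ennreal (norm (f y) powr p) * indicator {0..<1} y) * (\<integral>\<^sup>+x\<in>{0..<1}. ennreal (fejer_kernel N (x - y)) \<partial>lborel) \<partial>lborel)"
    by (subst nn_integral_cmult[symmetric]) (auto simp: ennreal_mult ac_simps)
  also have "\<dots> = Lpow p f"
    unfolding nn_integral_fejer_kernel_diff Lpow_def by simp
  finally show ?thesis .
qed

section \<open>Positive functions and the half-plane inequality\<close>

text \<open>Near the imaginary axis \<open>Re (z powr p)\<close> is negative, because \<open>\<pi>/2 < p \<pi>/2 \<le> \<pi>\<close>; away from it
  \<open>Re z\<close> is comparable to the modulus of \<open>z\<close>.\<close>

lemma sector_powr_inequality:
  fixes p :: real
  assumes p: "1 < p" "p \<le> 2"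
  obtains A B where "0 < A" "1 \<le> B"
    "\<And>z. 0 < Re z \<Longrightarrow> norm z powr p \<le> A * (Re z) powr p - B * Re (z powr of_real p)"
proof -
  \<comment> \<open>The midpoint between \<open>pi / (2 * p)\<close>, where
    \<open>cos (p * x)\<close> turns negative, and \<open>pi / 2\<close>; thus
    \<open>cos (p * u)\<close> is strictly negative.\<close>
  define u where "u = pi / 4 * (1 + 1 / p)"
  have "0 < u" unfolding u_def using p by (intro mult_pos_pos add_pos_pos) auto
  then have u: "0 < u" "u < pi / 2" using p by (auto simp: u_def field_simps)
  have pu: "pi / 2 < p * u" "p * u \<le> pi" using p by (auto simp: u_def field_simps)
  define c where "c = - cos (p * u)"
  have c: "0 < c" "c \<le> 1"
    using cos_gt_zero_pi[of "pi - p * u"] cos_ge_minus_one[of "p * u"] pu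
    by (auto simp: c_def)
  \<comment> \<open>Beyond the angle \<open>u\<close>, \<open>B\<close> turns
    \<open>- cos (p * x) \<ge> c\<close> into a gain of 1. Within it, \<open>A\<close> pays for this
    1 and for the subtracted term, which is at most \<open>B\<close>.\<close>
  define B where "B = 1 / c"
  have B: "1 \<le> B" using c by (simp add: B_def)
  have cu: "0 < cos u" using u by (intro cos_gt_zero_pi) auto
  define A where "A = (1 + B) / cos u powr p"
  have A: "0 < A" using B cu by (simp add: A_def)
  have trig: "1 \<le> A * cos x powr p - B * cos (p * x)" if x: "\<bar>x\<bar> < pi / 2" for x
  proof (cases "\<bar>x\<bar> \<le> u")
    case True
    have "cos u \<le> cos \<bar>x\<bar>" using True u x by (intro cos_monotone_0_pi_le) auto
    then have "cos u powr p \<le> cos x powr p" using cu p by (intro powr_mono2) auto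
    then have "A * cos u powr p \<le> A * cos x powr p" using A by (intro mult_left_mono) auto
    then have "1 + B \<le> A * cos x powr p" using cu by (simp add: A_def)
    moreover have "B * cos (p * x) \<le> B * 1" using B by (intro mult_left_mono) auto
    ultimately show ?thesis by simp
  next
    case False
    have "cos (p * \<bar>x\<bar>) \<le> cos (p * u)"
    proof (rule cos_monotone_0_pi_le)
      show "0 \<le> p * u" "p * u \<le> p * \<bar>x\<bar>" using False u p by auto
      \<comment> \<open>Here \<open>p \<le> 2\<close> enters: the angle stays in the range on which
        the cosine decreases.\<close>
      have "p * \<bar>x\<bar> \<le> 2 * (pi / 2)" using p x by (intro mult_mono) auto
      then show "p * \<bar>x\<bar> \<le> pi" by simp
    qed
    then have "cos (p * x) \<le> - c"
      by (cases "0 \<le> x") (auto simp: c_def abs_if)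
    then have "B * cos (p * x) \<le> B * (- c)" using B by (intro mult_left_mono) auto
    then have "B * cos (p * x) \<le> - 1" using c by (simp add: B_def)
    moreover have "0 \<le> A * cos x powr p" using A by simp
    ultimately show ?thesis by linarith
  qed
  have "norm z powr p \<le> A * (Re z) powr p - B * Re (z powr of_real p)" if z: "0 < Re z" for z
  proof -
    have z0: "z \<noteq> 0" using z by auto
    define x where "x = Im (Ln z)"
    have x: "\<bar>x\<bar> < pi / 2" using z unfolding x_def by (rule Re_Ln_pos_lt_imp)
    have Rez: "Re z = norm z * cos x"
      using Re_exp[of "Ln z"] z0 by (simp add: x_def)
    have powr: "Re (z powr of_real p) = norm z powr p * cos (p * x)"
      using z0 by (simp add: powr_def[of z] Re_exp x_def powr_def[of "norm z"])
    have "cos x > 0" using x by (intro cos_gt_zero_pi) auto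
    then have "A * (Re z) powr p - B * Re (z powr of_real p)
        = norm z powr p * (A * cos x powr p - B * cos (p * x))"
      unfolding powr unfolding Rez by (simp add: powr_mult algebra_simps)
    moreover have "norm z powr p * 1 \<le> norm z powr p * (A * cos x powr p - B * cos (p * x))"
      by (intro mult_left_mono trig x) auto
    ultimately show ?thesis by simp
  qed
  with that A B show ?thesis by blast
qed

section \<open>The mean value property for holomorphic powers\<close>

lemma nn_integral_unit_continuous:
  fixes h :: "real \<Rightarrow> real"
  assumes cont: "continuous_on UNIV h" and nn: "\<And>t. 0 \<le> h t"
  shows "(\<integral>\<^sup>+t\<in>{0..<1}. ennreal (h t) \<partial>lborel) = ennreal (integral {0..1} h)"
proof -
  have "h integrable_on {0..1}"
    by (intro integrable_continuous_real continuous_on_subset[OF cont]) auto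
  then have "(h has_integral integral {0..1} h) {0..1}" by (rule integrable_integral)
  from nn_integral_has_integral_lebesgue[OF nn this]
  have "(\<integral>\<^sup>+x. ennreal (indicator {0..1} x * h x) \<partial>lborel) = ennreal (integral {0..1} h)" .
  moreover have "(\<integral>\<^sup>+t\<in>{0..<1}. ennreal (h t) \<partial>lborel) = (\<integral>\<^sup>+x. ennreal (indicator {0..1} x * h x) \<partial>lborel)"
  proof (rule nn_integral_cong_AE)
    show "AE x in lborel. ennreal (h x) * indicator {0..<1} x = ennreal (indicator {0..1} x * h x)"
      using AE_lborel_singleton[of "1::real"] by eventually_elim (auto simp: indicator_def)
  qed
  ultimately show ?thesis by simp
qed

lemma circle_mean_value:
  assumes "G holomorphic_on cball 0 1"
  shows "((\<lambda>t. G (fexp 1 t)) has_integral G 0) {0..1}"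
proof -
  have "((\<lambda>u. G u / (u - 0)) has_contour_integral (2 * of_real pi * \<i> * G 0)) (circlepath 0 1)"
    using assms holomorphic_on_subset[OF assms, of "ball 0 1"]
    by (intro Cauchy_integral_circlepath) (auto intro: holomorphic_on_imp_continuous_on)
  then have "((\<lambda>t. G (circlepath 0 1 t) / (circlepath 0 1 t) * vector_derivative (circlepath 0 1) (at t within {0..1}))
      has_integral (2 * of_real pi * \<i> * G 0)) {0..1}"
    by (simp add: has_contour_integral_def)
  then have "((\<lambda>t. (2 * of_real pi * \<i>) * G (fexp 1 t)) has_integral (2 * of_real pi * \<i> * G 0)) {0..1}"
  proof (rule has_integral_eq[rotated])
    fix t :: real assume "t \<in> {0..1}"
    then show "G (circlepath 0 1 t) / (circlepath 0 1 t) * vector_derivative (circlepath 0 1) (at t within {0..1})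
      = (2 * of_real pi * \<i>) * G (fexp 1 t)"
      by (subst vector_derivative_circlepath01) (auto simp: circlepath fexp_def cis_conv_exp ac_simps)
  qed
  from has_integral_mult_right[OF this, of "1 / (2 * of_real pi * \<i>)"]
  show ?thesis by simp
qed

text \<open>The half-plane inequality is integrated over the circle. By the mean value property the
  subtracted power contributes only its value at the centre, which is positive; it is kept on the
  left to control the constant term later.\<close>

lemma circle_powr_inequality:
  fixes F :: "complex \<Rightarrow> complex"
  assumes AB: "0 < A" "1 \<le> B"
    "\<And>z. 0 < Re z \<Longrightarrow> norm z powr p \<le> A * (Re z) powr p - B * Re (z powr of_real p)"
    and hol: "F holomorphic_on UNIV" and pos: "\<And>t. 0 < Re (F (fexp 1 t))"
    and im: "Im (F 0) = 0" and p: "0 < p"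
  shows "0 < Re (F 0)"
    "Lpow p (\<lambda>t. F (fexp 1 t)) + ennreal (B * Re (F 0) powr p)
      \<le> ennreal A * Lpow p (\<lambda>t. of_real (Re (F (fexp 1 t))))"
proof -
  have cF: "continuous_on S F" for S
    using hol holomorphic_on_imp_continuous_on continuous_on_subset by blast
  have circ: "\<exists>t. z = fexp 1 t" if "norm z = 1" for z
  proof
    show "z = fexp 1 (Arg z / (2 * pi))"
      using that rcis_cmod_Arg[of z] by (simp add: fexp_def rcis_def)
  qed
  \<comment> \<open>The maximum principle needs a uniform bound on the boundary, and compactness of
    the circle provides one. Positivity in the disc then keeps \<open>F\<close> off the branch
    cut.\<close>
  obtain \<epsilon> where \<epsilon>: "0 < \<epsilon>" "\<And>z. norm z = 1 \<Longrightarrow> \<epsilon> \<le> Re (F z)"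
  proof -
    have "compact (sphere (0::complex) 1)" by simp
    moreover have "sphere (0::complex) 1 \<noteq> {}" by simp
    moreover have "continuous_on (sphere 0 1) (\<lambda>z. Re (F z))" by (intro continuous_intros cF)
    ultimately obtain w where "w \<in> sphere 0 1" "\<And>z. z \<in> sphere 0 1 \<Longrightarrow> Re (F w) \<le> Re (F z)"
      by (meson continuous_attains_inf)
    with that[of "Re (F w)"] circ pos show ?thesis by (auto simp: dist_norm)
  qed
  have Re_pos: "0 < Re (F z)" if z: "norm z \<le> 1" for z
  proof -
    have "Re (- F z) \<le> - \<epsilon>"
    proof (rule maximum_real_frontier[where S = "cball 0 1" and f = "\<lambda>z. - F z"])
      show "(\<lambda>z. - F z) holomorphic_on interior (cball 0 1)"
        by (intro holomorphic_intros holomorphic_on_subset[OF hol]) auto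
      show "continuous_on (closure (cball 0 1)) (\<lambda>z. - F z)" by (intro continuous_intros cF)
      show "Re (- F w) \<le> - \<epsilon>" if "w \<in> frontier (cball 0 1)" for w
        using \<epsilon>(2)[of w] that by (auto simp: frontier_cball)
    qed (use z in auto)
    with \<epsilon>(1) show ?thesis by simp
  qed
  then show F0: "0 < Re (F 0)" by simp
  define G where "G z = F z powr of_real p" for z
  have hG: "G holomorphic_on cball 0 1"
    unfolding G_def
  proof (intro holomorphic_on_powr holomorphic_on_const holomorphic_on_subset[OF hol])
    fix z :: complex assume "z \<in> cball 0 1"
    then have "0 < Re (F z)" by (intro Re_pos) auto
    then show "F z \<notin> \<real>\<^sub>\<le>\<^sub>0" by (auto simp: complex_nonpos_Reals_iff)
  qed auto
  have cFe: "continuous_on S (\<lambda>t. F (fexp 1 t))" for S :: "real set"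
    by (rule continuous_on_compose2[OF cF[of UNIV]]) (auto intro: continuous_on_fexp)
  have Fe0: "F (fexp 1 t) \<noteq> 0" for t using pos[of t] by auto
  have cP: "continuous_on S (\<lambda>t. norm (F (fexp 1 t)) powr p)" for S :: "real set"
    by (intro continuous_intros cFe) (auto simp: Fe0)
  have cU: "continuous_on S (\<lambda>t. norm (complex_of_real (Re (F (fexp 1 t)))) powr p)" for S :: "real set"
    using pos by (intro continuous_intros cFe) (auto simp: less_imp_neq[THEN not_sym])
  have R: "((\<lambda>t. Re (G (fexp 1 t))) has_integral Re (G 0)) {0..1}"
    using has_integral_linear[OF circle_mean_value[OF hG] bounded_linear_Re] by (simp add: o_def)
  have G0: "Re (G 0) = Re (F 0) powr p"
  proof -
    \<comment> \<open>A real positive value at the centre makes the complex power there the real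
      one, so its sign is known.\<close>
    have "F 0 = of_real (Re (F 0))" using im by (simp add: complex_eq_iff)
    then have "G 0 = of_real (Re (F 0) powr p)"
      unfolding G_def using powr_of_real[of "Re (F 0)" p] F0 by simp
    then show ?thesis by simp
  qed
  define IP where "IP = integral {0..1} (\<lambda>t. norm (F (fexp 1 t)) powr p)"
  define IU where "IU = integral {0..1} (\<lambda>t. norm (complex_of_real (Re (F (fexp 1 t)))) powr p)"
  have hP: "((\<lambda>t. norm (F (fexp 1 t)) powr p) has_integral IP) {0..1}"
    unfolding IP_def by (intro integrable_integral integrable_continuous_real cP)
  have hU: "((\<lambda>t. norm (complex_of_real (Re (F (fexp 1 t)))) powr p) has_integral IU) {0..1}"
    unfolding IU_def by (intro integrable_integral integrable_continuous_real cU)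
  have "IP \<le> A * IU - B * Re (G 0)"
  proof (rule has_integral_le[OF hP has_integral_diff[OF has_integral_mult_right[OF hU] has_integral_mult_right[OF R]]])
    fix t :: real
    show "norm (F (fexp 1 t)) powr p \<le> A * norm (complex_of_real (Re (F (fexp 1 t)))) powr p - B * Re (G (fexp 1 t))"
      using AB(3)[OF pos[of t]] pos[of t] by (simp add: G_def)
  qed
  then have "IP + B * Re (F 0) powr p \<le> A * IU" using G0 by simp
  moreover have "0 \<le> IP" unfolding IP_def by (rule integral_nonneg) (auto intro!: integrable_continuous_real cP)
  moreover have "Lpow p (\<lambda>t. F (fexp 1 t)) = ennreal IP"
    unfolding Lpow_def IP_def by (rule nn_integral_unit_continuous[OF cP]) auto
  moreover have "Lpow p (\<lambda>t. of_real (Re (F (fexp 1 t)))) = ennreal IU"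
    unfolding Lpow_def IU_def by (rule nn_integral_unit_continuous[OF cU]) auto
  moreover have "0 \<le> IU" unfolding IU_def by (rule integral_nonneg[OF integrable_continuous_real[OF cU]]) auto
  ultimately show "Lpow p (\<lambda>t. F (fexp 1 t)) + ennreal (B * Re (F 0) powr p)
      \<le> ennreal A * Lpow p (\<lambda>t. of_real (Re (F (fexp 1 t))))"
    using AB F0 by (simp add: ennreal_mult[symmetric] ennreal_plus[symmetric] ennreal_leI del: ennreal_plus)
qed

section \<open>Algebra of coefficients, and the one-sided Fejer projection\<close>

lemma fourier_coeff_cnj: "fourier_coeff (\<lambda>t. cnj (f t)) k = cnj (fourier_coeff f (- k))"
proof -
  have "fourier_coeff (\<lambda>t. cnj (f t)) k = (\<integral>t. cnj (indicator {0..<1} t *\<^sub>R (f t * fexp k t)) \<partial>lborel)"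
    unfolding fourier_coeff_fexp set_lebesgue_integral_def
    by (simp add: fexp_minus)
  also have "\<dots> = cnj (\<integral>t. indicator {0..<1} t *\<^sub>R (f t * fexp k t) \<partial>lborel)"
    by (rule Bochner_Integration.integral_cnj)
  finally show ?thesis
    unfolding fourier_coeff_fexp set_lebesgue_integral_def by simp
qed

lemma fourier_coeff_modulate: "fourier_coeff (\<lambda>t. fexp j t * f t) k = fourier_coeff f (k - j)"
  unfolding fourier_coeff_fexp using fexp_add[of j "- k"] by (simp add: ac_simps)

lemma fourier_coeff_add:
  assumes "set_integrable lborel {0..<1} f" "set_integrable lborel {0..<1} g"
  shows "fourier_coeff (\<lambda>t. f t + g t) k = fourier_coeff f k + fourier_coeff g k"
  unfolding fourier_coeff_fexp distrib_right
  by (intro set_integral_add set_integrable_mult_bounded[OF assms(1), where B = 1]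
      set_integrable_mult_bounded[OF assms(2), where B = 1]) auto

lemma fourier_coeff_cmult: "fourier_coeff (\<lambda>t. a * f t) k = a * fourier_coeff f k"
  unfolding fourier_coeff_fexp by (simp add: mult.assoc)

lemma fourier_mult_add:
  assumes "set_integrable lborel {0..<1} f" "set_integrable lborel {0..<1} g"
  shows "fourier_mult c N (\<lambda>t. f t + g t) x = fourier_mult c N f x + fourier_mult c N g x"
  unfolding fourier_mult_def by (simp add: fourier_coeff_add[OF assms] algebra_simps sum.distrib)

lemma fourier_mult_cmult: "fourier_mult c N (\<lambda>t. a * f t) x = a * fourier_mult c N f x"
  unfolding fourier_mult_def by (simp add: fourier_coeff_cmult algebra_simps sum_distrib_left)

lemma sum_symmetric:
  fixes g :: "int \<Rightarrow> 'a::comm_monoid_add"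
  shows "(\<Sum>k\<in>{- int N..int N}. g k) = g 0 + (\<Sum>j<N. g (int (Suc j)) + g (- int (Suc j)))"
proof (induction N)
  case (Suc N)
  show ?case unfolding sum_symmetric_Suc Suc sum.lessThan_Suc by (simp only: add.assoc)
qed simp

text \<open>A smoothed Riesz projection: only nonnegative frequencies survive, so its values are
  those of a polynomial in \<open>fexp 1 t\<close>, the boundary values of a holomorphic
  function.\<close>

definition riesz_weight :: "nat \<Rightarrow> int \<Rightarrow> complex" where
  "riesz_weight N k = (if 0 \<le> k then fejer_weight N k else 0)"

lemma fexp_power: "fexp (int k) t = fexp 1 t ^ k"
  by (simp add: fexp_def Complex.DeMoivre algebra_simps)

text \<open>For real \<open>h\<close> the coefficients are conjugate-symmetric, so the Fejer mean is
  \<open>a 0 + 2 Re S\<close> while the projection is \<open>a 0 + S\<close>. The polynomial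
  \<open>F\<close> with boundary values \<open>a 0 + \<epsilon> + 2 S\<close> has the Fejer mean
  plus \<open>\<epsilon>\<close> as real part. The mean may vanish somewhere, so
  \<open>\<epsilon>\<close> enforces strict positivity and is removed at the end.\<close>

lemma Lpow_riesz_nonneg:
  fixes h :: "real \<Rightarrow> real"
  assumes AB: "0 < A" "1 \<le> B"
    "\<And>z. 0 < Re z \<Longrightarrow> norm z powr p \<le> A * (Re z) powr p - B * Re (z powr of_real p)"
    and [measurable]: "h \<in> borel_measurable borel" and h: "\<And>t. 0 \<le> h t" and p: "1 \<le> p"
    and fin: "Lpow p (\<lambda>t. of_real (h t)) < \<infinity>"
  shows "Lpow p (fourier_mult (riesz_weight N) N (\<lambda>t. of_real (h t)))
    \<le> ennreal (4 powr p * A) * Lpow p (\<lambda>t. of_real (h t))"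
proof (rule ennreal_le_epsilon)
  define f where "f t = complex_of_real (h t)" for t
  have f_eq: "f = (\<lambda>t. complex_of_real (h t))" by (simp add: f_def fun_eq_iff)
  have [measurable]: "f \<in> borel_measurable borel" unfolding f_def by measurable
  have f: "set_integrable lborel {0..<1} f"
    by (rule set_integrable_of_Lpow) (use p fin in \<open>auto simp: f_eq\<close>)
  fix e :: real assume e: "0 < e"
  \<comment> \<open>Chosen so that the final factor \<open>4 powr p * A\<close> turns
    \<open>\<epsilon> powr p\<close> into the error \<open>e\<close>.\<close>
  define \<epsilon> where "\<epsilon> = (e / (4 powr p * A)) powr (1 / p)"
  have \<epsilon>: "0 < \<epsilon>" "\<epsilon> powr p = e / (4 powr p * A)"
    using e AB p by (auto simp: \<epsilon>_def powr_powr)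
  define a where "a k = fejer_weight N k * fourier_coeff f k" for k
  define S where "S t = (\<Sum>j<N. a (int (Suc j)) * fexp (int (Suc j)) t)" for t
  have a_cnj: "a (- k) = cnj (a k)" for k
    using fourier_coeff_cnj[of f k] by (simp add: a_def f_eq fejer_weight_def)
  have Pm: "fourier_mult (riesz_weight N) N f t = a 0 + S t" for t
    unfolding fourier_mult_def sum_symmetric S_def by (simp add: riesz_weight_def a_def)
  have sm: "fejer_mean N f t = a 0 + (S t + cnj (S t))" for t
    unfolding fourier_mult_def sum_symmetric S_def cnj_sum
    unfolding a_def[symmetric] a_cnj fexp_minus by (simp add: sum.distrib)
  have a0: "Im (a 0) = 0" using a_cnj[of 0] by (simp add: complex_eq_iff)
  have mean_nn: "fejer_mean N f t = of_real (Re (fejer_mean N f t))" "0 \<le> Re (fejer_mean N f t)" for t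
  proof -
    have "fejer_mean N f t = of_real (LINT y:{0..<1}|lborel. fejer_kernel N (t - y) * h y)"
      unfolding fejer_mean_eq[OF f] set_integral_complex_of_real[symmetric] by (simp add: f_def)
    moreover have "0 \<le> (LINT y:{0..<1}|lborel. fejer_kernel N (t - y) * h y)"
      unfolding set_lebesgue_integral_def by (intro integral_nonneg_AE) (auto simp: h)
    ultimately show "fejer_mean N f t = of_real (Re (fejer_mean N f t))" "0 \<le> Re (fejer_mean N f t)" by auto
  qed
  define F where "F z = a 0 + of_real \<epsilon> + 2 * (\<Sum>j<N. a (int (Suc j)) * z ^ Suc j)" for z
  have Fe: "F (fexp 1 t) = a 0 + of_real \<epsilon> + 2 * S t" for t
    unfolding F_def S_def fexp_power by simp
  have ReF: "of_real (Re (F (fexp 1 t))) = fejer_mean N f t + of_real \<epsilon>" for t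
    using a0 unfolding Fe sm by (simp add: complex_eq_iff)
  have F0: "F 0 = a 0 + of_real \<epsilon>" by (simp add: F_def)
  have "0 < Re (F 0)"
    and main: "Lpow p (\<lambda>t. F (fexp 1 t)) + ennreal (B * Re (F 0) powr p)
      \<le> ennreal A * Lpow p (\<lambda>t. of_real (Re (F (fexp 1 t))))"
  proof -
    have hol: "F holomorphic_on UNIV" unfolding F_def by (intro holomorphic_intros)
    have pos: "0 < Re (F (fexp 1 t))" for t
      using ReF[of t] mean_nn(2)[of t] \<epsilon> by (simp add: complex_eq_iff)
    have im: "Im (F 0) = 0" using a0 by (simp add: F0)
    show "0 < Re (F 0)"
      by (rule circle_powr_inequality(1)[OF AB hol pos im]) (use p in auto)
    show "Lpow p (\<lambda>t. F (fexp 1 t)) + ennreal (B * Re (F 0) powr p)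
      \<le> ennreal A * Lpow p (\<lambda>t. of_real (Re (F (fexp 1 t))))"
      by (rule circle_powr_inequality(2)[OF AB hol pos im]) (use p in auto)
  qed
  define b where "b = Re (a 0)"
  have ab: "a 0 = of_real b" using a0 by (simp add: b_def complex_eq_iff)
  have a0e: "0 < b + \<epsilon>" using \<open>0 < Re (F 0)\<close> by (simp add: F0 b_def)
  have b: "0 \<le> b"
  proof -
    have "b = Re (LINT t:{0..<1}|lborel. f t)"
      by (simp add: b_def a_def fejer_weight_def fourier_coeff_fexp)
    also have "(LINT t:{0..<1}|lborel. f t) = of_real (LINT t:{0..<1}|lborel. h t)"
      unfolding f_def by (rule set_integral_complex_of_real)
    also have "Re \<dots> \<ge> 0"
      unfolding set_lebesgue_integral_def by (auto intro!: integral_nonneg_AE simp: h)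
    finally show ?thesis .
  qed
  have [measurable]: "(\<lambda>t. F (fexp 1 t)) \<in> borel_measurable borel"
    unfolding Fe S_def by measurable
  have "Lpow p (fourier_mult (riesz_weight N) N f)
      \<le> ennreal (2 powr p) * (Lpow p (\<lambda>t. F (fexp 1 t)) + Lpow p (\<lambda>t. of_real (b + \<epsilon>)))"
  proof (rule Lpow_add_le)
    fix t :: real
    \<comment> \<open>Half of \<open>F\<close> carries \<open>S\<close> but only half of the
      constant term; the remaining constant is restored here.\<close>
    have "fourier_mult (riesz_weight N) N f t = (F (fexp 1 t) + of_real (b - \<epsilon>)) / 2"
      unfolding Pm Fe ab by simp
    then have "norm (fourier_mult (riesz_weight N) N f t) = norm (F (fexp 1 t) + of_real (b - \<epsilon>)) / 2"
      by (simp only: norm_divide) simp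
    also have "\<dots> \<le> (norm (F (fexp 1 t)) + \<bar>b - \<epsilon>\<bar>) / 2"
      using norm_triangle_ineq[of "F (fexp 1 t)" "of_real (b - \<epsilon>)"] by (simp del: of_real_diff)
    also have "\<dots> \<le> norm (F (fexp 1 t)) + norm (complex_of_real (b + \<epsilon>))"
      using b \<epsilon> norm_ge_zero[of "F (fexp 1 t)"] by (simp add: abs_if del: of_real_add)
    finally show "norm (fourier_mult (riesz_weight N) N f t) \<le> norm (F (fexp 1 t)) + norm (complex_of_real (b + \<epsilon>))" .
  qed (use p in auto)
  also have "\<dots> \<le> ennreal (2 powr p) * (ennreal A * Lpow p (\<lambda>t. of_real (Re (F (fexp 1 t)))))"
  proof (rule mult_left_mono)
    \<comment> \<open>The constant is paid for by the central value retained in the circle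
      inequality; \<open>B \<ge> 1\<close> is what makes this possible.\<close>
    have "Lpow p (\<lambda>t. of_real (b + \<epsilon>)) \<le> ennreal (B * Re (F 0) powr p)"
      using AB a0e b \<epsilon> mult_right_mono[of 1 B "(b + \<epsilon>) powr p"]
      by (auto simp: Lpow_const F0 ab simp del: of_real_add intro!: ennreal_leI)
    then show "Lpow p (\<lambda>t. F (fexp 1 t)) + Lpow p (\<lambda>t. of_real (b + \<epsilon>))
        \<le> ennreal A * Lpow p (\<lambda>t. of_real (Re (F (fexp 1 t))))"
      using main by (meson add_left_mono order_trans)
  qed auto
  also have "Lpow p (\<lambda>t. of_real (Re (F (fexp 1 t)))) \<le> ennreal (2 powr p) * (Lpow p (fejer_mean N f) + Lpow p (\<lambda>t. of_real \<epsilon>))"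
    unfolding ReF by (rule Lpow_add_le) (use p norm_triangle_ineq[of _ "complex_of_real \<epsilon>"] in auto)
  also have "Lpow p (\<lambda>t. of_real \<epsilon>) = ennreal (e / (4 powr p * A))"
    using \<epsilon> by (simp add: Lpow_const)
  also have "Lpow p (fejer_mean N f) \<le> Lpow p f"
    by (rule Lpow_fejer_mean) (use p fin in \<open>auto simp: f_eq\<close>)
  also have "ennreal (2 powr p) * (ennreal A * (ennreal (2 powr p) * (Lpow p f + ennreal (e / (4 powr p * A)))))
      = ennreal (4 powr p * A) * (Lpow p f + ennreal (e / (4 powr p * A)))"
  proof -
    have "(4::real) powr p = 2 powr p * 2 powr p" by (simp add: powr_mult[symmetric])
    then show ?thesis using AB by (simp add: ennreal_mult ac_simps)
  qed
  also have "\<dots> = ennreal (4 powr p * A) * Lpow p f + ennreal e"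
    using AB e by (simp add: distrib_left ennreal_mult[symmetric])
  finally show "Lpow p (fourier_mult (riesz_weight N) N (\<lambda>t. of_real (h t)))
    \<le> ennreal (4 powr p * A) * Lpow p (\<lambda>t. of_real (h t)) + ennreal e"
    unfolding f_eq by (simp add: mult_left_mono add_right_mono)
qed

section \<open>The partial sum operators for exponents up to 2\<close>

text \<open>The unimodular factor \<open>s\<close> covers both splittings used below: positive minus
  negative part (\<open>s = - 1\<close>) and real plus imaginary part (\<open>s = \<i>\<close>).
  Both pieces are measured against a common quantity \<open>L\<close>.\<close>

lemma Lpow_fourier_mult_combine:
  assumes [measurable]: "f \<in> borel_measurable borel" "g \<in> borel_measurable borel"
    and p: "1 \<le> p" and s: "norm s = 1" and C: "0 \<le> C"
    and f: "Lpow p (fourier_mult c N f) \<le> ennreal C * L" "Lpow p f < \<infinity>"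
    and g: "Lpow p (fourier_mult c N g) \<le> ennreal C * L" "Lpow p g < \<infinity>"
  shows "Lpow p (fourier_mult c N (\<lambda>t. f t + s * g t)) \<le> ennreal (2 powr p * 2 * C) * L"
proof -
  have int: "set_integrable lborel {0..<1} f" "set_integrable lborel {0..<1} g"
    using f g p by (auto intro!: set_integrable_of_Lpow)
  have "Lpow p (fourier_mult c N (\<lambda>t. f t + s * g t))
      \<le> ennreal (2 powr p) * (Lpow p (fourier_mult c N f) + Lpow p (fourier_mult c N g))"
  proof (rule Lpow_add_le)
    fix t
    have "fourier_mult c N (\<lambda>t. f t + s * g t) t = fourier_mult c N f t + s * fourier_mult c N g t"
      using int by (subst fourier_mult_add) (auto simp: fourier_mult_cmult intro: set_integrable_mult_right)
    then show "norm (fourier_mult c N (\<lambda>t. f t + s * g t) t)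
        \<le> norm (fourier_mult c N f t) + norm (fourier_mult c N g t)"
      using norm_triangle_ineq[of "fourier_mult c N f t" "s * fourier_mult c N g t"] s
      by (simp add: norm_mult)
  qed (use p in auto)
  also have "\<dots> \<le> ennreal (2 powr p) * (ennreal C * L + ennreal C * L)"
    by (intro mult_left_mono add_mono f g) auto
  also have "ennreal C * L + ennreal C * L = ennreal (2 * C) * L"
    using C by (simp add: distrib_right[symmetric] ennreal_plus[symmetric] del: ennreal_plus)
  also have "ennreal (2 powr p) * (ennreal (2 * C) * L) = ennreal (2 powr p * 2 * C) * L"
    using C by (simp add: ennreal_mult mult.assoc)
  finally show ?thesis .
qed

text \<open>Positivity is removed in two splittings, each costing the factor
  \<open>2 powr p * 2\<close>. Every piece is dominated pointwise by \<open>norm (f t)\<close>, so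
  \<open>Lpow p f\<close> serves as comparison throughout.\<close>

lemma Lpow_riesz:
  assumes p: "1 < p" "p \<le> 2"
  obtains C where "0 \<le> C"
    "\<And>N f. f \<in> borel_measurable borel \<Longrightarrow> Lpow p f < \<infinity>
      \<Longrightarrow> Lpow p (fourier_mult (riesz_weight N) N f) \<le> ennreal C * Lpow p f"
proof -
  obtain A B where AB: "0 < A" "1 \<le> B"
    "\<And>z. 0 < Re z \<Longrightarrow> norm z powr p \<le> A * (Re z) powr p - B * Re (z powr of_real p)"
    using sector_powr_inequality[OF p] by metis
  define C0 where "C0 = 4 powr p * A"
  define C1 where "C1 = 2 powr p * 2 * C0"
  define C2 where "C2 = 2 powr p * 2 * C1"
  have C: "0 \<le> C0" "0 \<le> C1" "0 \<le> C2" using AB by (auto simp: C0_def C1_def C2_def)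
  have "Lpow p (fourier_mult (riesz_weight N) N f) \<le> ennreal C2 * Lpow p f"
    if [measurable]: "f \<in> borel_measurable borel" and fin: "Lpow p f < \<infinity>" for N f
  proof -
    have nonneg: "Lpow p (\<lambda>t. of_real (h t)) < \<infinity>"
      "Lpow p (fourier_mult (riesz_weight N) N (\<lambda>t. of_real (h t))) \<le> ennreal C0 * Lpow p f"
      if [measurable]: "h \<in> borel_measurable borel" and h: "\<And>t. 0 \<le> h t" "\<And>t. h t \<le> norm (f t)" for h
    proof -
      have le: "Lpow p (\<lambda>t. of_real (h t)) \<le> Lpow p f"
        by (rule Lpow_mono) (use h p in auto)
      then show fin': "Lpow p (\<lambda>t. of_real (h t)) < \<infinity>" using fin by (rule le_less_trans)
      have "Lpow p (fourier_mult (riesz_weight N) N (\<lambda>t. of_real (h t))) \<le> ennreal C0 * Lpow p (\<lambda>t. of_real (h t))"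
        unfolding C0_def by (rule Lpow_riesz_nonneg[OF AB]) (use h p fin' in auto)
      also have "\<dots> \<le> ennreal C0 * Lpow p f" by (intro mult_left_mono le) auto
      finally show "Lpow p (fourier_mult (riesz_weight N) N (\<lambda>t. of_real (h t))) \<le> ennreal C0 * Lpow p f" .
    qed
    have real: "Lpow p (\<lambda>t. of_real (h t)) < \<infinity>"
      "Lpow p (fourier_mult (riesz_weight N) N (\<lambda>t. of_real (h t))) \<le> ennreal C1 * Lpow p f"
      if [measurable]: "h \<in> borel_measurable borel" and h: "\<And>t. \<bar>h t\<bar> \<le> norm (f t)" for h
    proof -
      have "Lpow p (\<lambda>t. of_real (h t)) \<le> Lpow p f"
        by (rule Lpow_mono) (use h p in auto)
      then show "Lpow p (\<lambda>t. of_real (h t)) < \<infinity>" using fin by (rule le_less_trans)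
      have "Lpow p (fourier_mult (riesz_weight N) N (\<lambda>t. of_real (max 0 (h t)) + (- 1) * of_real (max 0 (- h t))))
          \<le> ennreal C1 * Lpow p f"
        unfolding C1_def
      proof (rule Lpow_fourier_mult_combine)
        have *: "max 0 (h t) \<le> norm (f t)" "max 0 (- h t) \<le> norm (f t)" for t
          using h[of t] by auto
        show "Lpow p (\<lambda>t. of_real (max 0 (h t))) < \<infinity>"
          "Lpow p (fourier_mult (riesz_weight N) N (\<lambda>t. of_real (max 0 (h t)))) \<le> ennreal C0 * Lpow p f"
          by (rule nonneg; use * in simp)+
        show "Lpow p (\<lambda>t. of_real (max 0 (- h t))) < \<infinity>"
          "Lpow p (fourier_mult (riesz_weight N) N (\<lambda>t. of_real (max 0 (- h t)))) \<le> ennreal C0 * Lpow p f"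
          by (rule nonneg; use * in simp)+
      qed (use p C in auto)
      moreover have "(\<lambda>t. of_real (max 0 (h t)) + (- 1) * of_real (max 0 (- h t))) = (\<lambda>t. complex_of_real (h t))"
        by (auto simp: fun_eq_iff max_def)
      ultimately show "Lpow p (fourier_mult (riesz_weight N) N (\<lambda>t. of_real (h t))) \<le> ennreal C1 * Lpow p f"
        by simp
    qed
    have "Lpow p (fourier_mult (riesz_weight N) N (\<lambda>t. of_real (Re (f t)) + \<i> * of_real (Im (f t))))
        \<le> ennreal C2 * Lpow p f"
      unfolding C2_def
      by (rule Lpow_fourier_mult_combine; (rule real)?)
         (use p C in \<open>auto simp: abs_Re_le_cmod abs_Im_le_cmod\<close>)
    then show ?thesis by (simp flip: complex_eq)
  qed
  with C that show ?thesis by blast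
qed

text \<open>One-sided de la Vallee Poussin weights: a smooth multiplier that acts as the identity on
  the frequencies \<open>0..N\<close>. The guard cuts the smaller triangle off where its formula
  would become negative.\<close>

definition vp_weight :: "nat \<Rightarrow> int \<Rightarrow> complex" where
  "vp_weight N k = 2 * riesz_weight (2 * N + 1) k - (if \<bar>k\<bar> \<le> int N then riesz_weight N k else 0)"

lemma vp_weight_neg: "k < 0 \<Longrightarrow> vp_weight N k = 0"
  by (simp add: vp_weight_def riesz_weight_def)

lemma vp_weight_eq_1:
  assumes "0 \<le> k" "k \<le> int N"
  shows "vp_weight N k = 1"
proof -
  \<comment> \<open>The slopes cancel because \<open>2 * N + 1 + 1\<close> is twice
    \<open>N + 1\<close>; this fixes the degree \<open>2 * N + 1\<close> of the larger
    triangle.\<close>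
  have "2 * (1 - r / real (2 * N + 1 + 1)) - (1 - r / real (N + 1)) = 1" for r
    by (simp add: divide_simps) (simp add: algebra_simps)
  then have "complex_of_real (2 * (1 - \<bar>real_of_int k\<bar> / real (2 * N + 1 + 1)) - (1 - \<bar>real_of_int k\<bar> / real (N + 1))) = 1"
    by (simp only: of_real_1)
  then show ?thesis
    using assms unfolding vp_weight_def riesz_weight_def fejer_weight_def of_real_diff of_real_mult by simp
qed

lemma fourier_mult_vp_weight:
  "fourier_mult (vp_weight N) (2 * N + 1) f t
    = 2 * fourier_mult (riesz_weight (2 * N + 1)) (2 * N + 1) f t - fourier_mult (riesz_weight N) N f t"
proof -
  have "fourier_mult (riesz_weight N) N f t
     = (\<Sum>k\<in>{- int (2 * N + 1)..int (2 * N + 1)}. (if \<bar>k\<bar> \<le> int N then riesz_weight N k else 0) * fourier_coeff f k * fexp k t)"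
    unfolding fourier_mult_def by (rule sum.mono_neutral_cong_left) auto
  then show ?thesis
    unfolding fourier_mult_def[of "vp_weight N"] fourier_mult_def[of "riesz_weight (2 * N + 1)"]
    by (simp only: vp_weight_def left_diff_distrib sum_subtractf sum_distrib_left mult.assoc)
qed

lemma Lpow_vp:
  assumes p: "1 < p" "p \<le> 2"
  obtains C where "0 \<le> C"
    "\<And>N f. f \<in> borel_measurable borel \<Longrightarrow> Lpow p f < \<infinity>
      \<Longrightarrow> Lpow p (fourier_mult (vp_weight N) (2 * N + 1) f) \<le> ennreal C * Lpow p f"
proof -
  obtain C where C: "0 \<le> C" and bd: "\<And>N f. f \<in> borel_measurable borel \<Longrightarrow> Lpow p f < \<infinity>
      \<Longrightarrow> Lpow p (fourier_mult (riesz_weight N) N f) \<le> ennreal C * Lpow p f"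
    using Lpow_riesz[OF p] by metis
  define C' where "C' = 2 powr p * ((2 powr p + 1) * C)"
  have "Lpow p (fourier_mult (vp_weight N) (2 * N + 1) f) \<le> ennreal C' * Lpow p f"
    if [measurable]: "f \<in> borel_measurable borel" and fin: "Lpow p f < \<infinity>" for N f
  proof -
    let ?Q = "\<lambda>N. fourier_mult (riesz_weight N) N f"
    have "Lpow p (fourier_mult (vp_weight N) (2 * N + 1) f)
        \<le> ennreal (2 powr p) * (Lpow p (\<lambda>t. 2 * ?Q (2 * N + 1) t) + Lpow p (?Q N))"
      unfolding fourier_mult_vp_weight[abs_def]
      by (rule Lpow_add_le) (use p in \<open>auto intro!: order_trans[OF norm_triangle_ineq4] simp: norm_mult\<close>)
    also have "Lpow p (\<lambda>t. 2 * ?Q (2 * N + 1) t) = ennreal (2 powr p) * Lpow p (?Q (2 * N + 1))"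
      by (subst Lpow_cmult) auto
    also have "ennreal (2 powr p) * (ennreal (2 powr p) * Lpow p (?Q (2 * N + 1)) + Lpow p (?Q N))
       \<le> ennreal (2 powr p) * (ennreal (2 powr p) * (ennreal C * Lpow p f) + ennreal C * Lpow p f)"
      by (intro mult_left_mono add_mono bd) (use fin in auto)
    also have "\<dots> = ennreal C' * Lpow p f"
      unfolding C'_def using C by (simp add: ennreal_mult algebra_simps)
    finally show ?thesis .
  qed
  moreover have "0 \<le> C'" using C by (simp add: C'_def)
  ultimately show ?thesis using that by blast
qed

text \<open>A partial sum is cut out by two one-sided projections, one for each end of the
  frequency band, each brought to frequency \<open>0\<close> by a modulation.\<close>

lemma fourier_partial_eq_projections:
  defines "PV \<equiv> \<lambda>K. fourier_mult (vp_weight (2 * K)) (2 * (2 * K) + 1)"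
  shows "fourier_partial f K t
    = fexp (int K) t * cnj (PV K (\<lambda>t. fexp (2 * int K) t * cnj (PV K (\<lambda>t. fexp (int K) t * f t) t)) t)"
proof -
  define g1 where "g1 = PV K (\<lambda>t. fexp (int K) t * f t)"
  define g2 where "g2 t = fexp (2 * int K) t * cnj (g1 t)" for t
  define M where "M = 2 * (2 * K) + 1"
  have c1: "fourier_coeff g1 k = (if \<bar>k\<bar> \<le> int M then vp_weight (2 * K) k * fourier_coeff f (k - int K) else 0)" for k
    unfolding g1_def PV_def M_def fourier_coeff_fourier_mult fourier_coeff_modulate ..
  have c2: "fourier_coeff g2 k = cnj (fourier_coeff g1 (2 * int K - k))" for k
    unfolding g2_def fourier_coeff_modulate fourier_coeff_cnj by simp
  have "PV K g2 t = (\<Sum>k\<in>{- int M..int M}. vp_weight (2 * K) k * fourier_coeff g2 k * fexp k t)"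
    unfolding PV_def fourier_mult_def M_def ..
  \<comment> \<open>Conjugation followed by modulation reflects \<open>k\<close> to
    \<open>2 * K - k\<close>. The first projection thus removes one end of the band, the second the
    other end together with the smooth tail left by the first. On the remaining frequencies
    \<open>0..2 * K\<close> both weights equal 1, which is why the parameter is
    \<open>2 * K\<close>.\<close>
  also have "\<dots> = (\<Sum>k\<in>{0..2 * int K}. cnj (fourier_coeff f (int K - k)) * fexp k t)"
  proof (rule sum.mono_neutral_cong_right)
    show "\<forall>k\<in>{- int M..int M} - {0..2 * int K}. vp_weight (2 * K) k * fourier_coeff g2 k * fexp k t = 0"
      unfolding c2 c1 using vp_weight_neg by auto
    fix k assume "k \<in> {0..2 * int K}"
    then show "vp_weight (2 * K) k * fourier_coeff g2 k * fexp k t = cnj (fourier_coeff f (int K - k)) * fexp k t"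
      unfolding c2 c1 using vp_weight_eq_1[of k "2 * K"] vp_weight_eq_1[of "2 * int K - k" "2 * K"]
      by (auto simp: M_def)
  qed (auto simp: M_def)
  finally have "fexp (int K) t * cnj (PV K g2 t)
    = (\<Sum>k\<in>{0..2 * int K}. fourier_coeff f (int K - k) * (fexp (int K) t * fexp (- k) t))"
    by (simp add: sum_distrib_left fexp_minus ac_simps)
  also have "\<dots> = (\<Sum>k\<in>{0..2 * int K}. fourier_coeff f (int K - k) * fexp (int K - k) t)"
    by (simp flip: fexp_add)
  also have "\<dots> = (\<Sum>k\<in>{- int K..int K}. fourier_coeff f k * fexp k t)"
    by (rule sum.reindex_bij_witness[of _ "\<lambda>k. int K - k" "\<lambda>k. int K - k"]) auto
  also have "\<dots> = fourier_partial f K t"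
    unfolding fourier_partial_def fexp_def ..
  finally show ?thesis unfolding g2_def g1_def ..
qed

lemma Lpow_fourier_partial_le_2:
  assumes p: "1 < p" "p \<le> 2"
  obtains C where "0 \<le> C"
    "\<And>K f. f \<in> borel_measurable borel \<Longrightarrow> Lpow p f < \<infinity>
      \<Longrightarrow> Lpow p (fourier_partial f K) \<le> ennreal C * Lpow p f"
proof -
  obtain C where C: "0 \<le> C" and bd: "\<And>N f. f \<in> borel_measurable borel \<Longrightarrow> Lpow p f < \<infinity>
      \<Longrightarrow> Lpow p (fourier_mult (vp_weight N) (2 * N + 1) f) \<le> ennreal C * Lpow p f"
    using Lpow_vp[OF p] by metis
  have "Lpow p (fourier_partial f K) \<le> ennreal (C * C) * Lpow p f"
    if [measurable]: "f \<in> borel_measurable borel" and fin: "Lpow p f < \<infinity>" for K f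
  proof -
    define PV where "PV = fourier_mult (vp_weight (2 * K)) (2 * (2 * K) + 1)"
    define g0 where "g0 t = fexp (int K) t * f t" for t
    define g1 where "g1 = PV g0"
    define g2 where "g2 t = fexp (2 * int K) t * cnj (g1 t)" for t
    have [measurable]: "g0 \<in> borel_measurable borel" "g1 \<in> borel_measurable borel"
      unfolding g0_def g1_def PV_def by measurable
    have "cnj \<in> borel_measurable borel"
      by (intro borel_measurable_continuous_onI continuous_intros)
    then have [measurable]: "g2 \<in> borel_measurable borel" unfolding g2_def by measurable
    have L0: "Lpow p g0 = Lpow p f" by (rule Lpow_cong) (simp add: g0_def norm_mult)
    have L1: "Lpow p g1 \<le> ennreal C * Lpow p f"
      using bd[of g0 "2 * K"] fin by (simp add: L0 g1_def PV_def)
    have L2: "Lpow p g2 = Lpow p g1" by (rule Lpow_cong) (simp add: g2_def norm_mult)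
    have fin2: "Lpow p g2 < \<infinity>"
      unfolding L2 by (rule le_less_trans[OF L1]) (use fin in \<open>simp add: ennreal_mult_less_top\<close>)
    have "Lpow p (fourier_partial f K) = Lpow p (PV g2)"
      unfolding fourier_partial_eq_projections[of f K, abs_def]
      by (rule Lpow_cong) (simp add: norm_mult PV_def g2_def[abs_def] g1_def g0_def[abs_def])
    also have "\<dots> \<le> ennreal C * Lpow p g2"
      unfolding PV_def by (rule bd) (use fin2 in auto)
    also have "\<dots> \<le> ennreal C * (ennreal C * Lpow p f)"
      unfolding L2 by (intro mult_left_mono L1) auto
    also have "\<dots> = ennreal (C * C) * Lpow p f"
      using C by (simp add: ennreal_mult mult.assoc)
    finally show ?thesis .
  qed
  with C that[of "C * C"] show ?thesis by simp
qed

section \<open>Duality and the tail of the Fejer kernel\<close>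

text \<open>The partial sum operator is self-adjoint: both sides reduce to the same finite sum of
  products of coefficients, so integrability of \<open>f\<close> and \<open>g\<close>
  suffices.\<close>

lemma integral_fourier_partial_cnj:
  assumes f: "set_integrable lborel {0..<1} f" and g: "set_integrable lborel {0..<1} g"
  shows "(LINT t:{0..<1}|lborel. fourier_partial f K t * cnj (g t))
    = (LINT t:{0..<1}|lborel. f t * cnj (fourier_partial g K t))"
proof -
  have int: "set_integrable lborel {0..<1} (\<lambda>t. cnj (g t))"
    using g integrable_cnj[of lborel "\<lambda>t. indicator {0..<1} t *\<^sub>R g t"] by (simp add: set_integrable_def)
  have "(LINT t:{0..<1}|lborel. fourier_partial f K t * cnj (g t))
      = (LINT t:{0..<1}|lborel. (\<Sum>k\<in>{- int K..int K}. fourier_coeff f k * (cnj (g t) * fexp (- (- k)) t)))"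
    unfolding fourier_partial_def fexp_def[symmetric] sum_distrib_right by (simp add: ac_simps)
  also have "\<dots> = (\<Sum>k\<in>{- int K..int K}. fourier_coeff f k * cnj (fourier_coeff g k))"
    by (subst set_integral_sum)
       (auto intro!: set_integrable_mult_right set_integrable_mult_bounded[OF int, where B = 1]
         simp del: minus_minus simp: fourier_coeff_fexp[symmetric] fourier_coeff_cnj, simp)
  also have "\<dots> = (LINT t:{0..<1}|lborel. (\<Sum>k\<in>{- int K..int K}. cnj (fourier_coeff g k) * (f t * fexp (- k) t)))"
    by (subst set_integral_sum)
       (auto intro!: set_integrable_mult_right set_integrable_mult_bounded[OF f, where B = 1]
         simp: fourier_coeff_fexp[symmetric] mult.commute)
  also have "\<dots> = (LINT t:{0..<1}|lborel. f t * cnj (fourier_partial g K t))"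
    unfolding fourier_partial_def fexp_def[symmetric] cnj_sum sum_distrib_left
    by (simp add: fexp_minus ac_simps)
  finally show ?thesis .
qed

lemma borel_measurable_fourier_partial [measurable]: "fourier_partial f K \<in> borel_measurable borel"
  unfolding fourier_partial_eq_mult by measurable

lemma norm_fourier_partial_le:
  "norm (fourier_partial f K t) \<le> (\<Sum>k\<in>{- int K..int K}. norm (fourier_coeff f k))"
  unfolding fourier_partial_def by (rule order_trans[OF norm_sum]) (simp add: norm_mult)

text \<open>The a priori finiteness without which the duality argument could not absorb a multiple
  of the left side; it holds because a trigonometric polynomial is bounded.\<close>

lemma Lpow_fourier_partial_finite:
  assumes "0 \<le> p"
  shows "Lpow p (fourier_partial f K) < \<infinity>"
proof -
  define b where "b = (\<Sum>k\<in>{- int K..int K}. norm (fourier_coeff f k))"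
  have "Lpow p (fourier_partial f K) \<le> Lpow p (\<lambda>t. of_real b)"
    by (rule Lpow_mono)
       (use norm_fourier_partial_le[of f K] assms in \<open>auto simp: b_def sum_nonneg simp del: of_real_sum\<close>)
  also have "\<dots> < \<infinity>" by (simp add: Lpow_const)
  finally show ?thesis .
qed

text \<open>Here \<open>h\<close> is the extremal function for the norm of the partial sum; Young's inequality with a free
  parameter \<open>l\<close> allows the second summand to be absorbed in the left-hand side.\<close>

lemma nn_integral_fourier_partial_duality:
  fixes f :: "real \<Rightarrow> complex" and K :: nat and p q l :: real
  assumes p: "1 < p" and q: "1 / p + 1 / q = 1" and l: "0 < l"
    and [measurable]: "f \<in> borel_measurable borel" and fin: "Lpow p f < \<infinity>"
  defines "h \<equiv> \<lambda>t. fourier_partial f K t * of_real (norm (fourier_partial f K t) powr (p - 2))"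
  shows "Lpow q h = Lpow p (fourier_partial f K)"
    and "Lpow p (fourier_partial f K) \<le> ennreal (l powr p) * Lpow p f + ennreal ((1 / l) powr q) * Lpow q (fourier_partial h K)"
proof -
  let ?T = "fourier_partial f K"
  let ?G = "fourier_partial h K"
  have q1: "1 < q" "p = q * (p - 1)"
  proof -
    have "1 / q = 1 - 1 / p" using q by simp
    also have "\<dots> = (p - 1) / p" using p by (simp add: field_simps)
    finally have q_eq: "q = p / (p - 1)" by (metis inverse_divide inverse_eq_divide divide_inverse mult_1 inverse_inverse_eq)
    show "1 < q" "p = q * (p - 1)" using p by (auto simp: q_eq divide_simps)
  qed
  have [measurable]: "h \<in> borel_measurable borel" unfolding h_def by measurable
  \<comment> \<open>With \<open>q * (p - 1) = p\<close>, the \<open>q\<close>-th power of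
    \<open>h\<close> has the same integral as the \<open>p\<close>-th power of the partial
    sum.\<close>
  have norm_h: "norm (h t) = norm (?T t) powr (p - 1)" for t
    using powr_add[of "norm (?T t)" 1 "p - 2"] by (cases "?T t = 0") (auto simp: h_def norm_mult)
  show Lh: "Lpow q h = Lpow p ?T"
    unfolding Lpow_def norm_h powr_powr using q1(2) by (simp add: mult.commute)
  have fin_h: "Lpow q h < \<infinity>" unfolding Lh by (rule Lpow_fourier_partial_finite) (use p in auto)
  have int_f: "set_integrable lborel {0..<1} f" by (rule set_integrable_of_Lpow) (use p fin in auto)
  have int_h: "set_integrable lborel {0..<1} h" by (rule set_integrable_of_Lpow) (use q1 fin_h in auto)
  \<comment> \<open>Pairing with \<open>h\<close> reproduces the quantity to be bounded;
    self-adjointness then moves the operator onto \<open>h\<close>, where the exponent is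
    \<open>q\<close>.\<close>
  have Th: "?T t * cnj (h t) = of_real (norm (?T t) powr p)" for t
  proof (cases "?T t = 0")
    case False
    have "?T t * cnj (h t) = of_real ((norm (?T t))\<^sup>2 * norm (?T t) powr (p - 2))"
      unfolding h_def by (simp add: complex_norm_square del: of_real_power)
    also have "(norm (?T t))\<^sup>2 * norm (?T t) powr (p - 2) = norm (?T t) powr p"
      using False powr_add[of "norm (?T t)" 2 "p - 2"] by (simp add: powr_numeral)
    finally show ?thesis .
  qed (use p in auto)
  have "Lpow p ?T = ennreal (norm (LINT t:{0..<1}|lborel. ?T t * cnj (h t)))"
  proof -
    have int: "integrable lborel (\<lambda>t. indicator {0..<1} t *\<^sub>R (norm (?T t) powr p))"
    proof (rule integrableI_bounded)
      have "(\<integral>\<^sup>+t. ennreal (norm (indicator {0..<1} t *\<^sub>R (norm (?T t) powr p))) \<partial>lborel) = Lpow p ?T"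
        unfolding Lpow_def by (rule nn_integral_cong) (auto simp: indicator_def)
      also have "\<dots> < \<infinity>" by (rule Lpow_fourier_partial_finite) (use p in auto)
      finally show "(\<integral>\<^sup>+t. ennreal (norm (indicator {0..<1} t *\<^sub>R (norm (?T t) powr p))) \<partial>lborel) < \<infinity>" .
    qed measurable
    have "Lpow p ?T = (\<integral>\<^sup>+t. ennreal (indicator {0..<1} t *\<^sub>R (norm (?T t) powr p)) \<partial>lborel)"
      unfolding Lpow_def by (rule nn_integral_cong) (auto simp: indicator_def)
    also have "\<dots> = ennreal (LINT t:{0..<1}|lborel. norm (?T t) powr p)"
      unfolding set_lebesgue_integral_def by (rule nn_integral_eq_integral[OF int]) auto
    also have "(LINT t:{0..<1}|lborel. norm (?T t) powr p) = norm (LINT t:{0..<1}|lborel. ?T t * cnj (h t))"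
    proof -
      have "0 \<le> (LINT t:{0..<1}|lborel. norm (?T t) powr p)"
        unfolding set_lebesgue_integral_def by (intro integral_nonneg_AE) auto
      then show ?thesis unfolding Th set_integral_complex_of_real by simp
    qed
    finally show ?thesis .
  qed
  also have "\<dots> = ennreal (norm (LINT t:{0..<1}|lborel. f t * cnj (?G t)))"
    unfolding integral_fourier_partial_cnj[OF int_f int_h] ..
  also have "\<dots> \<le> (\<integral>\<^sup>+t. ennreal (norm (indicator {0..<1} t *\<^sub>R (f t * cnj (?G t)))) \<partial>lborel)"
  proof (cases "integrable lborel (\<lambda>t. indicator {0..<1} t *\<^sub>R (f t * cnj (?G t)))")
    case True
    show ?thesis
      unfolding set_lebesgue_integral_def
      by (subst nn_integral_eq_integral[OF integrable_norm[OF True]])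
         (auto intro!: ennreal_leI integral_norm_bound simp del: norm_scaleR)
  qed (simp add: set_lebesgue_integral_def not_integrable_integral_eq)
  also have "\<dots> \<le> (\<integral>\<^sup>+t. ennreal (l powr p) * (ennreal (norm (f t) powr p) * indicator {0..<1} t)
      + ennreal ((1 / l) powr q) * (ennreal (norm (?G t) powr q) * indicator {0..<1} t) \<partial>lborel)"
  proof (rule nn_integral_mono)
    fix t :: real
    have "norm (f t) * norm (?G t) = (l * norm (f t)) * ((1 / l) * norm (?G t))"
      using l by simp
    also have "\<dots> \<le> (l * norm (f t)) powr p / p + ((1 / l) * norm (?G t)) powr q / q"
      by (rule Youngs_inequality) (use p q q1 l in auto)
    \<comment> \<open>The factors \<open>1 / p\<close> and \<open>1 / q\<close> are below 1 and are
      given away.\<close>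
    also have "\<dots> \<le> (l * norm (f t)) powr p / 1 + ((1 / l) * norm (?G t)) powr q / 1"
      by (intro add_mono divide_left_mono) (use p q1 in auto)
    also have "\<dots> = l powr p * norm (f t) powr p + (1 / l) powr q * norm (?G t) powr q"
      unfolding powr_mult by simp
    finally show "ennreal (norm (indicator {0..<1} t *\<^sub>R (f t * cnj (?G t))))
      \<le> ennreal (l powr p) * (ennreal (norm (f t) powr p) * indicator {0..<1} t)
      + ennreal ((1 / l) powr q) * (ennreal (norm (?G t) powr q) * indicator {0..<1} t)"
      by (auto simp: indicator_def norm_mult ennreal_mult[symmetric] ennreal_plus[symmetric]
        simp del: ennreal_plus intro!: ennreal_leI)
  qed
  also have "\<dots> = ennreal (l powr p) * Lpow p f + ennreal ((1 / l) powr q) * Lpow q ?G"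
    unfolding Lpow_def by (subst nn_integral_add, measurable) (simp add: nn_integral_cmult)
  finally show "Lpow p ?T \<le> ennreal (l powr p) * Lpow p f + ennreal ((1 / l) powr q) * Lpow q ?G" .
qed

theorem Lpow_fourier_partial:
  assumes p: "1 < p"
  obtains C where "0 \<le> C"
    "\<And>K f. f \<in> borel_measurable borel \<Longrightarrow> Lpow p f < \<infinity>
      \<Longrightarrow> Lpow p (fourier_partial f K) \<le> ennreal C * Lpow p f"
proof (cases "p \<le> 2")
  case True
  then show ?thesis using Lpow_fourier_partial_le_2[OF p] that by metis
next
  case False
  define q where "q = p / (p - 1)"
  have q: "1 < q" "q \<le> 2" "1 / p + 1 / q = 1"
    using False by (auto simp: q_def field_simps)
  obtain C where C: "0 \<le> C" and bd: "\<And>K f. f \<in> borel_measurable borel \<Longrightarrow> Lpow q f < \<infinity>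
      \<Longrightarrow> Lpow q (fourier_partial f K) \<le> ennreal C * Lpow q f"
    using Lpow_fourier_partial_le_2[OF q(1,2)] by metis
  \<comment> \<open>Makes \<open>(1 / l) powr q * C\<close> at most one half, so that term can be
    absorbed; the added 1 keeps \<open>l\<close> positive when \<open>C = 0\<close>.\<close>
  define l where "l = (2 * C + 1) powr (1 / q)"
  have l: "0 < l" using C by (simp add: l_def)
  have lq: "(1 / l) powr q * C \<le> 1 / 2"
    using C q by (simp add: l_def powr_divide powr_powr field_simps)
  have "Lpow p (fourier_partial f K) \<le> ennreal (2 * l powr p) * Lpow p f"
    if [measurable]: "f \<in> borel_measurable borel" and fin: "Lpow p f < \<infinity>" for K f
  proof -
    define h where "h t = fourier_partial f K t * of_real (norm (fourier_partial f K t) powr (p - 2))" for t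
    have [measurable]: "h \<in> borel_measurable borel" unfolding h_def by measurable
    let ?X = "Lpow p (fourier_partial f K)"
    have Lh: "Lpow q h = ?X"
      unfolding h_def[abs_def] by (rule nn_integral_fourier_partial_duality(1)[OF p q(3) l]) (use fin in auto)
    have finX: "?X < \<infinity>" by (rule Lpow_fourier_partial_finite) (use p in auto)
    have "?X \<le> ennreal (l powr p) * Lpow p f + ennreal ((1 / l) powr q) * Lpow q (fourier_partial h K)"
      unfolding h_def[abs_def] by (rule nn_integral_fourier_partial_duality(2)[OF p q(3) l]) (use fin in auto)
    also have "\<dots> \<le> ennreal (l powr p) * Lpow p f + ennreal ((1 / l) powr q) * (ennreal C * ?X)"
      using bd[of h K] finX by (intro add_left_mono mult_left_mono) (auto simp: Lh)
    also have "ennreal ((1 / l) powr q) * (ennreal C * ?X) = ennreal ((1 / l) powr q * C) * ?X"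
      using C by (simp add: ennreal_mult mult.assoc)
    also have "ennreal (l powr p) * Lpow p f + ennreal ((1 / l) powr q * C) * ?X
        \<le> ennreal (l powr p) * Lpow p f + ennreal (1 / 2) * ?X"
      by (intro add_left_mono mult_right_mono ennreal_leI lq) auto
    finally have *: "?X \<le> ennreal (l powr p) * Lpow p f + ennreal (1 / 2) * ?X" .
    \<comment> \<open>Subtracting half of the left side is legitimate for finite values only, so the
      inequality is moved to the reals.\<close>
    obtain x y where xy: "?X = ennreal x" "0 \<le> x" "Lpow p f = ennreal y" "0 \<le> y"
      using finX fin by (metis ennreal_cases infinity_ennreal_def less_irrefl)
    have "ennreal (l powr p) * ennreal y = ennreal (l powr p * y)" "ennreal (1 / 2) * ennreal x = ennreal (1 / 2 * x)"
      by (rule ennreal_mult[symmetric]; use xy in simp)+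
    with * xy have "ennreal x \<le> ennreal (l powr p * y) + ennreal (1 / 2 * x)" by metis
    also have "\<dots> = ennreal (l powr p * y + 1 / 2 * x)" using xy by (intro ennreal_plus[symmetric]) auto
    finally have "x \<le> l powr p * y + 1 / 2 * x"
      using xy by (subst (asm) ennreal_le_iff) auto
    then have "x \<le> 2 * l powr p * y" by simp
    then show ?thesis unfolding xy by (subst ennreal_mult[symmetric]) (auto intro!: ennreal_leI simp: xy)
  qed
  with that[of "2 * l powr p"] show ?thesis by simp
qed

section \<open>The tail of the Fejer kernel\<close>

lemma borel_measurable_frac [measurable]: "frac \<in> borel_measurable (borel :: real measure)"
  unfolding frac_def[abs_def] using borel_measurable_real_floor by measurable

text \<open>The sum of characters is geometric with ratio \<open>z\<close>: its product with
  \<open>1 - z\<close> has modulus at most 2, and \<open>|1 - z| = 2 * sin (pi * t)\<close>.\<close>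

lemma fejer_kernel_tail_le:
  assumes "0 < t" "t < 1"
  shows "fejer_kernel N t \<le> 1 / (real (N + 1) * (sin (pi * t))\<^sup>2)"
proof -
  have s: "0 < sin (pi * t)" using assms by (intro sin_gt_zero) auto
  define z where "z = fexp 1 t"
  define D where "D = (\<Sum>j\<le>N. fexp (int j) t)"
  have D: "D = (\<Sum>j\<le>N. z ^ j)" unfolding D_def z_def fexp_power[of _ t] ..
  have "(1 - z) * D = 1 - z ^ Suc N" unfolding D by (rule sum_gp_basic)
  then have "norm (1 - z) * norm D = norm (1 - z ^ Suc N)" by (metis norm_mult)
  also have "\<dots> \<le> 2"
    using norm_triangle_ineq4[of 1 "z ^ Suc N"] by (simp add: z_def norm_power norm_mult)
  also have "norm (1 - z) = 2 * sin (pi * t)"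
    using dist_exp_i_1[of "2 * pi * t"] s by (simp add: z_def fexp_def cis_conv_exp norm_minus_commute)
  finally have "sin (pi * t) * norm D \<le> 1" by simp
  then have "(sin (pi * t) * norm D)\<^sup>2 \<le> 1\<^sup>2" using s by (intro power_mono) auto
  then have "(norm D)\<^sup>2 \<le> 1 / (sin (pi * t))\<^sup>2" using s by (simp add: power_mult_distrib field_simps)
  then have "(norm D)\<^sup>2 / real (N + 1) \<le> 1 / (sin (pi * t))\<^sup>2 / real (N + 1)" by (rule divide_right_mono) simp
  then show ?thesis unfolding fejer_kernel_def D_def by (simp add: mult.commute)
qed

text \<open>Used in the form \<open>cot x \<le> 1 / x\<close>. The difference of the two sides
  vanishes at 0 and has derivative \<open>y * sin y\<close>.\<close>

lemma mult_cos_le_sin: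
  fixes x :: real
  assumes "0 \<le> x" "x \<le> pi"
  shows "x * cos x \<le> sin x"
proof -
  have "sin 0 - 0 * cos 0 \<le> sin x - x * cos x"
  proof (rule DERIV_nonneg_imp_nondecreasing[OF assms(1)])
    fix y :: real assume y: "0 \<le> y" "y \<le> x"
    have "((\<lambda>x. sin x - x * cos x) has_real_derivative y * sin y) (at y)"
      by (auto intro!: derivative_eq_intros)
    moreover have "0 \<le> y * sin y" using y assms by (intro mult_nonneg_nonneg sin_ge_zero) auto
    ultimately show "\<exists>z. ((\<lambda>x. sin x - x * cos x) has_real_derivative z) (at y) \<and> 0 \<le> z" by blast
  qed
  then show ?thesis by simp
qed

text \<open>The pointwise bound by the inverse square of the sine has a cotangent as primitive. The
  resulting constant \<open>2 / (pi * pi)\<close> is rounded up to 1.\<close>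

lemma nn_integral_fejer_kernel_tail:
  assumes \<eta>: "0 < \<eta>" "\<eta> \<le> 1 / 2"
  shows "(\<integral>\<^sup>+t\<in>{\<eta>..1 - \<eta>}. ennreal (fejer_kernel N t) \<partial>lborel) \<le> ennreal (1 / (real (N + 1) * \<eta>))"
proof -
  let ?F = "\<lambda>t. - cot (pi * t) / (pi * real (N + 1))"
  have "(\<integral>\<^sup>+t\<in>{\<eta>..1 - \<eta>}. ennreal (fejer_kernel N t) \<partial>lborel)
      \<le> (\<integral>\<^sup>+t\<in>{\<eta>..1 - \<eta>}. ennreal (1 / (real (N + 1) * (sin (pi * t))\<^sup>2)) \<partial>lborel)"
    by (rule nn_integral_mono) (use \<eta> in \<open>auto simp: indicator_def intro!: ennreal_leI order_trans[OF fejer_kernel_tail_le]\<close>)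
  also have "\<dots> = ennreal (?F (1 - \<eta>) - ?F \<eta>)"
  proof (rule nn_integral_FTC_Icc)
    fix t assume "t \<in> {\<eta>..1 - \<eta>}"
    then have s: "0 < sin (pi * t)" using \<eta> by (intro sin_gt_zero) auto
    then have "((\<lambda>t. cot (pi * t)) has_real_derivative (- inverse ((sin (pi * t))\<^sup>2)) * pi) (at t)"
      by (intro DERIV_chain2[OF DERIV_cot]) (auto intro!: derivative_eq_intros)
    from DERIV_cdivide[OF DERIV_minus[OF this], of "pi * real (N + 1)"]
    have "(?F has_real_derivative (inverse ((sin (pi * t))\<^sup>2) * pi) / (pi * real (N + 1))) (at t)"
      by simp
    moreover have "(inverse ((sin (pi * t))\<^sup>2) * pi) / (pi * real (N + 1)) = 1 / (real (N + 1) * (sin (pi * t))\<^sup>2)"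
      using s by (simp add: divide_simps)
    ultimately show "(?F has_real_derivative 1 / (real (N + 1) * (sin (pi * t))\<^sup>2)) (at t)" by metis
  qed (use \<eta> in auto)
  also have "?F (1 - \<eta>) - ?F \<eta> = 2 * cot (pi * \<eta>) / (pi * real (N + 1))"
  proof -
    have "cot (pi * (1 - \<eta>)) = - cot (pi * \<eta>)"
      by (simp add: cot_def right_diff_distrib)
    then show ?thesis by (simp add: field_simps)
  qed
  also have "\<dots> \<le> 1 / (real (N + 1) * \<eta>)"
  proof -
    have "0 < sin (pi * \<eta>)" using \<eta> by (intro sin_gt_zero) auto
    moreover have "(pi * \<eta>) * cos (pi * \<eta>) \<le> sin (pi * \<eta>)" using \<eta> by (intro mult_cos_le_sin) auto
    ultimately have "cot (pi * \<eta>) \<le> 1 / (pi * \<eta>)" using \<eta> by (simp add: cot_def field_simps)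
    then have "2 * cot (pi * \<eta>) / (pi * real (N + 1)) \<le> 2 * (1 / (pi * \<eta>)) / (pi * real (N + 1))"
      by (intro divide_right_mono mult_left_mono) auto
    also have "\<dots> = (2 / (pi * pi)) * (1 / (real (N + 1) * \<eta>))" by (simp add: field_simps)
    also have "\<dots> \<le> 1 * (1 / (real (N + 1) * \<eta>))"
    proof (rule mult_right_mono)
      have "2 * 1 \<le> pi * pi" using pi_ge_two by (intro mult_mono) auto
      then show "2 / (pi * pi) \<le> 1" by (simp add: divide_simps)
    qed (use \<eta> in auto)
    finally show ?thesis by simp
  qed
  finally show ?thesis by (simp add: ennreal_leI)
qed

section \<open>Approximation by Fejer means\<close>

text \<open>The kernel is restricted to displacements in \<open>B\<close>, of mass at most
  \<open>m\<close>. Jensen's inequality yields \<open>m powr (p - 1)\<close>, and integrating over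
  the displacement after Tonelli yields one more \<open>m\<close>; hence the full power
  \<open>m powr p\<close>.\<close>

lemma Lpow_fejer_local:
  assumes [measurable]: "g \<in> borel_measurable borel" "B \<in> sets borel"
    and per: "\<And>x. g (frac x) = g x" and p: "1 \<le> p" and m: "0 < m"
    and mass: "(\<integral>\<^sup>+d\<in>{0..<1}. ennreal (fejer_kernel N d * indicator B d) \<partial>lborel) \<le> ennreal m"
    and A: "0 \<le> A" "\<And>d. 0 \<le> d \<Longrightarrow> d < 1 \<Longrightarrow> d \<in> B \<Longrightarrow> Lpow p (\<lambda>x. g x - g (x + d)) \<le> ennreal A"
  shows "Lpow p (\<lambda>x. LINT y:{0..<1}|lborel. of_real (fejer_kernel N (x - y) * indicator B (frac (y - x))) * (g x - g y))
    \<le> ennreal (m powr p * A)" (is "Lpow p ?I \<le> _")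
proof -
  have kernel_sym: "fejer_kernel N (x - y) = fejer_kernel N (y - x)" for x y
    using fejer_kernel_minus[of N "x - y"] by simp
  have "Lpow p ?I \<le> (\<integral>\<^sup>+x\<in>{0..<1}. ennreal (m powr (p - 1)) *
      (\<integral>\<^sup>+d\<in>{0..<1}. ennreal (fejer_kernel N d * indicator B d * norm (g x - g (x + d)) powr p) \<partial>lborel) \<partial>lborel)"
    unfolding Lpow_def
  proof (intro nn_integral_mono mult_right_mono)
    fix x :: real
    define H where "H d = fejer_kernel N d * indicator B (frac d) * norm (g x - g (x + d)) powr p" for d
    have [measurable]: "H \<in> borel_measurable borel" unfolding H_def by measurable
    have per_add: "g (x + frac d) = g (x + d)" for d
      using per[of "x + d"] per[of "x + frac d"] by (simp add: frac_def add_diff_eq)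
    have "ennreal (norm (?I x) powr p)
      = ennreal (norm (\<integral>y. of_real (fejer_kernel N (x - y) * indicator B (frac (y - x)) * indicator {0..<1} y) * (g x - g y) \<partial>lborel) powr p)"
      unfolding set_lebesgue_integral_def
      by (intro arg_cong[where f = ennreal] arg_cong2[where f = "(powr)"] arg_cong[where f = norm] Bochner_Integration.integral_cong)
         (auto simp: indicator_def)
    also have "\<dots> \<le> ennreal (m powr (p - 1)) *
      (\<integral>\<^sup>+y. ennreal (fejer_kernel N (x - y) * indicator B (frac (y - x)) * indicator {0..<1} y * norm (g x - g y) powr p) \<partial>lborel)"
    proof (rule weighted_powr_mean)
      have "(\<integral>\<^sup>+y. ennreal (fejer_kernel N (x - y) * indicator B (frac (y - x)) * indicator {0..<1} y) \<partial>lborel)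
        = (\<integral>\<^sup>+y\<in>{0..<1}. (\<lambda>d. ennreal (fejer_kernel N d * indicator B (frac d))) (y + (- x)) \<partial>lborel)"
        unfolding kernel_sym[of x] by (rule nn_integral_cong) (auto simp: indicator_def)
      also have "\<dots> = (\<integral>\<^sup>+d\<in>{0..<1}. ennreal (fejer_kernel N d * indicator B (frac d)) \<partial>lborel)"
        by (rule nn_integral_period_translate) auto
      also have "\<dots> = (\<integral>\<^sup>+d\<in>{0..<1}. ennreal (fejer_kernel N d * indicator B d) \<partial>lborel)"
        by (rule nn_integral_cong) (auto simp: indicator_def frac_eq)
      finally show "(\<integral>\<^sup>+y. ennreal (fejer_kernel N (x - y) * indicator B (frac (y - x)) * indicator {0..<1} y) \<partial>lborel) \<le> ennreal m"
        using mass by simp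
    qed (use m p in auto)
    also have "(\<integral>\<^sup>+y. ennreal (fejer_kernel N (x - y) * indicator B (frac (y - x)) * indicator {0..<1} y * norm (g x - g y) powr p) \<partial>lborel)
       = (\<integral>\<^sup>+y\<in>{0..<1}. ennreal (H (y + (- x))) \<partial>lborel)"
      unfolding kernel_sym[of x] by (rule nn_integral_cong) (auto simp: indicator_def H_def)
    also have "\<dots> = (\<integral>\<^sup>+d\<in>{0..<1}. ennreal (H d) \<partial>lborel)"
      by (rule nn_integral_period_translate) (auto simp: H_def per_add)
    also have "\<dots> = (\<integral>\<^sup>+d\<in>{0..<1}. ennreal (fejer_kernel N d * indicator B d * norm (g x - g (x + d)) powr p) \<partial>lborel)"
      by (rule nn_integral_cong) (auto simp: indicator_def H_def frac_eq)
    finally show "ennreal (norm (?I x) powr p) \<le> ennreal (m powr (p - 1)) * \<dots>" .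
  qed auto
  also have "\<dots> = ennreal (m powr (p - 1)) * (\<integral>\<^sup>+x\<in>{0..<1}.
      (\<integral>\<^sup>+d\<in>{0..<1}. ennreal (fejer_kernel N d * indicator B d * norm (g x - g (x + d)) powr p) \<partial>lborel) \<partial>lborel)"
    by (subst nn_integral_cmult[symmetric]) (auto simp: mult.assoc)
  also have "(\<integral>\<^sup>+x\<in>{0..<1}. (\<integral>\<^sup>+d\<in>{0..<1}. ennreal (fejer_kernel N d * indicator B d * norm (g x - g (x + d)) powr p) \<partial>lborel) \<partial>lborel)
    = (\<integral>\<^sup>+x. (\<integral>\<^sup>+d. ennreal (fejer_kernel N d * indicator B d * norm (g x - g (x + d)) powr p) * indicator {0..<1} d * indicator {0..<1} x \<partial>lborel) \<partial>lborel)"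
    by (subst nn_integral_multc) auto
  also have "\<dots> = (\<integral>\<^sup>+d. (\<integral>\<^sup>+x. ennreal (fejer_kernel N d * indicator B d * norm (g x - g (x + d)) powr p) * indicator {0..<1} d * indicator {0..<1} x \<partial>lborel) \<partial>lborel)"
    by (rule lborel_pair.Fubini') measurable
  also have "\<dots> = (\<integral>\<^sup>+d. (ennreal (fejer_kernel N d * indicator B d) * indicator {0..<1} d) * Lpow p (\<lambda>x. g x - g (x + d)) \<partial>lborel)"
    unfolding Lpow_def by (subst nn_integral_cmult[symmetric]) (auto simp: ennreal_mult ac_simps)
  also have "\<dots> \<le> (\<integral>\<^sup>+d. (ennreal (fejer_kernel N d * indicator B d) * indicator {0..<1} d) * ennreal A \<partial>lborel)"
    by (rule nn_integral_mono) (use A(2) in \<open>auto simp: indicator_def intro!: mult_left_mono\<close>)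
  also have "\<dots> = (\<integral>\<^sup>+d\<in>{0..<1}. ennreal (fejer_kernel N d * indicator B d) \<partial>lborel) * ennreal A"
    by (rule nn_integral_multc) measurable
  also have "\<dots> \<le> ennreal m * ennreal A" by (intro mult_right_mono mass) auto
  also have "ennreal (m powr (p - 1)) * (ennreal m * ennreal A) = ennreal (m powr p * A)"
  proof -
    have "m powr (p - 1) * m = m powr p" using powr_add[of m "p - 1" 1] m by simp
    then show ?thesis using m A(1) by (simp add: ennreal_mult[symmetric] mult.assoc[symmetric])
  qed
  finally show ?thesis by (simp add: mult_left_mono)
qed

lemma Lpow_translate_diff_le:
  assumes [measurable]: "g \<in> borel_measurable borel" and per: "\<And>x. g (frac x) = g x" and p: "0 \<le> p"
  shows "Lpow p (\<lambda>x. g x - g (x + d)) \<le> ennreal (2 powr p * 2) * Lpow p g"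
proof -
  have "Lpow p (\<lambda>x. g x - g (x + d)) \<le> ennreal (2 powr p) * (Lpow p g + Lpow p (\<lambda>x. g (x + d)))"
    by (rule Lpow_add_le) (use p in \<open>auto intro: norm_triangle_ineq4\<close>)
  also have "Lpow p (\<lambda>x. g (x + d)) = Lpow p g" by (rule Lpow_translate) (use per in auto)
  also have "Lpow p g + Lpow p g = 2 * Lpow p g" by (simp add: mult_2)
  finally show ?thesis by (simp add: ennreal_mult mult.assoc)
qed

text \<open>Splitting the kernel before applying Jensen's inequality makes the far part contribute the
  \<open>p\<close>-th power of its mass \<open>\<tau>\<close>; a single application would only give \<open>\<tau>\<close> itself, which is too
  large.\<close>

lemma Lpow_diff_fejer_mean:
  assumes [measurable]: "g \<in> borel_measurable borel" and per: "\<And>x. g (frac x) = g x"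
    and p: "1 \<le> p" and g1: "Lpow p g \<le> 1" and \<eta>: "0 < \<eta>"
    and mod: "\<And>d. \<bar>d\<bar> \<le> \<eta> \<Longrightarrow> Lpow p (\<lambda>x. g x - g (x + d)) \<le> ennreal (a powr p)"
    and N: "1 / (real (N + 1) * \<eta>) \<le> \<tau>"
  shows "Lpow p (\<lambda>x. g x - fejer_mean N g x) \<le> ennreal (2 powr p * (a powr p + \<tau> powr p * (2 powr p * 2)))"
proof -
  have \<tau>: "0 < \<tau>" by (rule less_le_trans[OF _ N]) (use \<eta> in auto)
  have int: "set_integrable lborel {0..<1} g"
    by (rule set_integrable_of_Lpow[where p = p]) (use p g1 in \<open>auto intro: le_less_trans\<close>)
  define w where "w B x y = complex_of_real (fejer_kernel N (x - y) * indicator B (frac (y - x)))" for B x y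
  define I where "I B x = (LINT y:{0..<1}|lborel. w B x y * (g x - g y))" for B x
  \<comment> \<open>Displacements are taken in the unit interval, so a small negative one appears
    close to 1.\<close>
  define near where "near = {..\<eta>} \<union> {1 - \<eta>..}"
  define far where "far = - near"
  have [measurable]: "near \<in> sets borel" "far \<in> sets borel" unfolding far_def near_def by measurable
  have [measurable]: "(\<lambda>x. w B (fst x) (snd x)) \<in> borel_measurable (borel \<Otimes>\<^sub>M borel)" if [measurable]: "B \<in> sets borel" for B
    unfolding w_def by measurable
  have I_int: "set_integrable lborel {0..<1} (\<lambda>y. w B x y * (g x - g y))" if [measurable]: "B \<in> sets borel" for B x
  proof -
    have "set_integrable lborel {0..<1} (\<lambda>y. (g x - g y) * w B x y)"
    proof (rule set_integrable_mult_bounded[where B = "real (N + 1)"])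
      show "set_integrable lborel {0..<1} (\<lambda>y. g x - g y)"
        by (intro set_integral_diff set_integrable_unit_const int)
      show "w B x \<in> borel_measurable borel" unfolding w_def by measurable
      show "norm (w B x t) \<le> real (N + 1)" for t
        using fejer_kernel_le[of N "x - t"] by (simp add: w_def indicator_def)
    qed
    then show ?thesis by (simp add: mult.commute)
  qed
  have split: "g x - fejer_mean N g x = I near x + I far x" for x
  proof -
    have "I near x + I far x = (LINT y:{0..<1}|lborel. w near x y * (g x - g y) + w far x y * (g x - g y))"
      unfolding I_def by (intro set_integral_add(2)[symmetric] I_int) auto
    also have "\<dots> = (LINT y:{0..<1}|lborel. of_real (fejer_kernel N (x - y)) * g x - of_real (fejer_kernel N (x - y)) * g y)"
      by (rule arg_cong[where f = "set_lebesgue_integral lborel {0..<1}"])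
         (auto simp: fun_eq_iff w_def far_def indicator_def algebra_simps)
    also have "\<dots> = (LINT y:{0..<1}|lborel. of_real (fejer_kernel N (x - y)) * g x) - (LINT y:{0..<1}|lborel. of_real (fejer_kernel N (x - y)) * g y)"
    proof (rule set_integral_diff)
      have *: "set_integrable lborel {0..<1} (\<lambda>y. h y * of_real (fejer_kernel N (x - y)))" if "set_integrable lborel {0..<1} h" for h :: "real \<Rightarrow> complex"
        by (rule set_integrable_mult_bounded[OF that, where B = "real (N + 1)"]) (use fejer_kernel_le in auto)
      show "set_integrable lborel {0..<1} (\<lambda>y. of_real (fejer_kernel N (x - y)) * g x)"
        using *[OF set_integrable_unit_const[of "g x"]] by (simp add: mult.commute)
      show "set_integrable lborel {0..<1} (\<lambda>y. of_real (fejer_kernel N (x - y)) * g y)"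
        using *[OF int] by (simp add: mult.commute)
    qed
    also have "(LINT y:{0..<1}|lborel. of_real (fejer_kernel N (x - y)) * g x) = g x"
    proof -
      have "(LINT y:{0..<1}|lborel. fejer_kernel N (x - y))
        = enn2real (\<integral>\<^sup>+y. ennreal (indicator {0..<1} y *\<^sub>R fejer_kernel N (x - y)) \<partial>lborel)"
        unfolding set_lebesgue_integral_def by (rule integral_eq_nn_integral) auto
      also have "(\<integral>\<^sup>+y. ennreal (indicator {0..<1} y *\<^sub>R fejer_kernel N (x - y)) \<partial>lborel)
        = (\<integral>\<^sup>+y\<in>{0..<1}. ennreal (fejer_kernel N (x - y)) \<partial>lborel)"
        by (rule nn_integral_cong) (auto simp: indicator_def)
      finally show ?thesis
        unfolding nn_integral_fejer_kernel_diff set_integral_mult_left set_integral_complex_of_real by simp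
    qed
    finally show ?thesis unfolding fejer_mean_eq[OF int] ..
  qed
  have [measurable]: "I near \<in> borel_measurable borel" "I far \<in> borel_measurable borel"
    unfolding I_def[abs_def] set_lebesgue_integral_def w_def by measurable
  have near: "Lpow p (I near) \<le> ennreal (1 powr p * (a powr p))"
    unfolding I_def[abs_def] w_def
  proof (rule Lpow_fejer_local)
    have "(\<integral>\<^sup>+d\<in>{0..<1}. ennreal (fejer_kernel N d * indicator near d) \<partial>lborel)
       \<le> (\<integral>\<^sup>+d\<in>{0..<1}. ennreal (fejer_kernel N d) \<partial>lborel)"
      by (rule nn_integral_mono) (auto simp: indicator_def)
    then show "(\<integral>\<^sup>+d\<in>{0..<1}. ennreal (fejer_kernel N d * indicator near d) \<partial>lborel) \<le> ennreal 1"
      by (simp add: nn_integral_fejer_kernel)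
    fix d :: real assume d: "0 \<le> d" "d < 1" "d \<in> near"
    show "Lpow p (\<lambda>x. g x - g (x + d)) \<le> ennreal (a powr p)"
    proof (cases "d \<le> \<eta>")
      case True
      then show ?thesis using d by (intro mod) auto
    next
      case False
      have "g (x + d) = g (x + (d - 1))" for x
        using per[of "x + d"] per[of "x + (d - 1)"] frac_1_eq[of "x + (d - 1)"] by (simp add: algebra_simps)
      moreover have "\<bar>d - 1\<bar> \<le> \<eta>" using False d by (auto simp: near_def)
      ultimately show ?thesis using mod[of "d - 1"] by simp
    qed
  qed (use p per in auto)
  have far: "Lpow p (I far) \<le> ennreal (\<tau> powr p * (2 powr p * 2))"
    unfolding I_def[abs_def] w_def
  proof (rule Lpow_fejer_local)
    show "(\<integral>\<^sup>+d\<in>{0..<1}. ennreal (fejer_kernel N d * indicator far d) \<partial>lborel) \<le> ennreal \<tau>"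
    proof (cases "\<eta> \<le> 1 / 2")
      case True
      have "(\<integral>\<^sup>+d\<in>{0..<1}. ennreal (fejer_kernel N d * indicator far d) \<partial>lborel)
        \<le> (\<integral>\<^sup>+d\<in>{\<eta>..1 - \<eta>}. ennreal (fejer_kernel N d) \<partial>lborel)"
        by (rule nn_integral_mono) (auto simp: indicator_def far_def near_def)
      also have "\<dots> \<le> ennreal (1 / (real (N + 1) * \<eta>))"
        by (rule nn_integral_fejer_kernel_tail) (use \<eta> True in auto)
      also have "\<dots> \<le> ennreal \<tau>" by (intro ennreal_leI N)
      finally show ?thesis .
    next
      case False
      \<comment> \<open>The tail estimate covers \<open>\<eta> \<le> 1 / 2\<close>; for larger
        \<open>\<eta>\<close> the neighbourhoods of 0 and 1 overlap.\<close>
      then have "far = {}" by (auto simp: far_def near_def)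
      then show ?thesis by simp
    qed
    fix d :: real
    have "Lpow p (\<lambda>x. g x - g (x + d)) \<le> ennreal (2 powr p * 2) * Lpow p g"
      by (rule Lpow_translate_diff_le) (use p per in auto)
    also have "\<dots> \<le> ennreal (2 powr p * 2) * 1" by (intro mult_left_mono g1) auto
    finally show "Lpow p (\<lambda>x. g x - g (x + d)) \<le> ennreal (2 powr p * 2)" by simp
  qed (use p per \<tau> in auto)
  have "Lpow p (\<lambda>x. g x - fejer_mean N g x) \<le> ennreal (2 powr p) * (Lpow p (I near) + Lpow p (I far))"
    unfolding split by (rule Lpow_add_le) (use p in \<open>auto intro: norm_triangle_ineq\<close>)
  also have "\<dots> \<le> ennreal (2 powr p) * (ennreal (1 powr p * a powr p) + ennreal (\<tau> powr p * (2 powr p * 2)))"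
    by (intro mult_left_mono add_mono near far) auto
  also have "\<dots> = ennreal (2 powr p * (a powr p + \<tau> powr p * (2 powr p * 2)))"
    by (subst ennreal_plus[symmetric]) (auto simp: ennreal_mult)
  finally show ?thesis .
qed

lemma fourier_partial_fejer_mean: "fourier_partial (fejer_mean N g) N t = fejer_mean N g t"
  unfolding fourier_partial_eq_mult fourier_mult_def[of "\<lambda>_. 1"] fourier_coeff_fourier_mult
  unfolding fourier_mult_def by (intro sum.cong) auto

text \<open>Lebesgue's argument: the partial sum fixes the Fejer mean of the same degree, so
  \<open>g\<close> and \<open>r = g - fejer_mean N g\<close> have the same error
  \<open>g - fourier_partial g N = r - fourier_partial r N\<close>. The uniform bound then costs
  only a constant.\<close>

lemma Lpow_diff_fourier_partial:
  assumes p: "1 < p"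
  obtains c where "0 < c"
    "\<And>g a \<eta> N. g \<in> borel_measurable borel \<Longrightarrow> (\<And>x. g (frac x) = g x) \<Longrightarrow> Lpow p g \<le> 1 \<Longrightarrow> 0 < \<eta> \<Longrightarrow>
      (\<And>d. \<bar>d\<bar> \<le> \<eta> \<Longrightarrow> Lpow p (\<lambda>x. g x - g (x + d)) \<le> ennreal (a powr p)) \<Longrightarrow>
      1 / (real (N + 1) * \<eta>) \<le> a \<Longrightarrow>
      Lpow p (\<lambda>x. g x - fourier_partial g N x) \<le> ennreal (c * a powr p)"
proof -
  obtain C where C: "0 \<le> C" and bd: "\<And>K f. f \<in> borel_measurable borel \<Longrightarrow> Lpow p f < \<infinity>
      \<Longrightarrow> Lpow p (fourier_partial f K) \<le> ennreal C * Lpow p f"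
    using Lpow_fourier_partial[OF p] by metis
  define c0 where "c0 = 2 powr p * (1 + (2 powr p * 2))"
  define c where "c = 2 powr p * ((1 + C) * c0)"
  have c0: "0 < c0" by (auto simp: c0_def intro!: mult_pos_pos add_pos_pos)
  then have c: "0 < c" using C by (auto simp: c_def intro!: mult_pos_pos add_pos_nonneg)
  have "Lpow p (\<lambda>x. g x - fourier_partial g N x) \<le> ennreal (c * a powr p)"
    if [measurable]: "g \<in> borel_measurable borel" and per: "\<And>x. g (frac x) = g x"
      and g1: "Lpow p g \<le> 1" and \<eta>: "0 < \<eta>"
      and mod: "\<And>d. \<bar>d\<bar> \<le> \<eta> \<Longrightarrow> Lpow p (\<lambda>x. g x - g (x + d)) \<le> ennreal (a powr p)"
      and N: "1 / (real (N + 1) * \<eta>) \<le> a" for g a \<eta> N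
  proof -
    define r where "r x = g x - fejer_mean N g x" for x
    have [measurable]: "r \<in> borel_measurable borel" unfolding r_def by measurable
    have int: "set_integrable lborel {0..<1} g"
      by (rule set_integrable_of_Lpow[where p = p]) (use p g1 in \<open>auto intro: le_less_trans\<close>)
    have finm: "Lpow p (fejer_mean N g) \<le> 1"
      by (rule order_trans[OF Lpow_fejer_mean g1]) (use p g1 in \<open>auto intro: le_less_trans\<close>)
    have intm: "set_integrable lborel {0..<1} (fejer_mean N g)"
      by (rule set_integrable_of_Lpow[where p = p]) (use p finm in \<open>auto intro: le_less_trans\<close>)
    have "Lpow p r \<le> ennreal (2 powr p * (a powr p + a powr p * (2 powr p * 2)))"
      unfolding r_def[abs_def] by (rule Lpow_diff_fejer_mean) (use p per g1 \<eta> mod N in auto)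
    also have "2 powr p * (a powr p + a powr p * (2 powr p * 2)) = c0 * a powr p"
      by (simp add: c0_def algebra_simps)
    finally have r: "Lpow p r \<le> ennreal (c0 * a powr p)" .
    then have finr: "Lpow p r < \<infinity>" by (rule le_less_trans) auto
    have Fr: "fourier_partial r N x = fourier_partial g N x - fejer_mean N g x" for x
    proof -
      have "fourier_partial r N x = fourier_mult (\<lambda>_. 1) N (\<lambda>t. g t + (- 1) * fejer_mean N g t) x"
        unfolding fourier_partial_eq_mult r_def[abs_def] by simp
      also have "\<dots> = fourier_mult (\<lambda>_. 1) N g x + fourier_mult (\<lambda>_. 1) N (\<lambda>t. (- 1) * fejer_mean N g t) x"
        by (rule fourier_mult_add[OF int]) (intro set_integrable_mult_right intm)
      also have "\<dots> = fourier_partial g N x + (- 1) * fourier_partial (fejer_mean N g) N x"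
        unfolding fourier_partial_eq_mult
        by (rule arg_cong2[where f = "(+)", OF refl fourier_mult_cmult])
      finally show ?thesis unfolding fourier_partial_fejer_mean by simp
    qed
    have "Lpow p (\<lambda>x. g x - fourier_partial g N x) \<le> ennreal (2 powr p) * (Lpow p r + Lpow p (fourier_partial r N))"
    proof (rule Lpow_add_le)
      fix x
      have "g x - fourier_partial g N x = r x - fourier_partial r N x" by (simp add: Fr r_def)
      then show "norm (g x - fourier_partial g N x) \<le> norm (r x) + norm (fourier_partial r N x)"
        by (simp add: norm_triangle_ineq4)
    qed (use p in auto)
    also have "\<dots> \<le> ennreal (2 powr p) * (Lpow p r + ennreal C * Lpow p r)"
      by (intro mult_left_mono add_left_mono bd) (use finr in auto)
    also have "Lpow p r + ennreal C * Lpow p r = ennreal (1 + C) * Lpow p r"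
      using C by (simp add: distrib_right)
    also have "ennreal (2 powr p) * (ennreal (1 + C) * Lpow p r) \<le> ennreal (2 powr p) * (ennreal (1 + C) * ennreal (c0 * a powr p))"
      by (intro mult_left_mono r) auto
    also have "\<dots> = ennreal (c * a powr p)"
    proof -
      have "ennreal (1 + C) * ennreal (c0 * a powr p) = ennreal ((1 + C) * (c0 * a powr p))"
        by (rule ennreal_mult[symmetric]) (use C c0 in auto)
      moreover have "ennreal (2 powr p) * ennreal ((1 + C) * (c0 * a powr p)) = ennreal (2 powr p * ((1 + C) * (c0 * a powr p)))"
        by (rule ennreal_mult[symmetric]) (use C c0 in auto)
      ultimately show ?thesis by (simp only: c_def mult.assoc)
    qed
    finally show ?thesis .
  qed
  with c show ?thesis using that by blast
qed

section \<open>Translations of trigonometric polynomials; interval averages\<close>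

text \<open>Transfers smoothness from an approximant \<open>T\<close> to \<open>g\<close>; it serves
  (b), (d) and the continuity of translations. The error \<open>g - T\<close> and its translate have
  equal norm by periodicity, hence the factor 2.\<close>

lemma Lpow_translate_diff_perturb:
  assumes [measurable]: "g \<in> borel_measurable borel" "T \<in> borel_measurable borel"
    and per: "\<And>x. g (frac x) = g x" "\<And>x. T (frac x) = T x" and p: "0 \<le> p"
  shows "Lpow p (\<lambda>x. g x - g (x + d))
    \<le> ennreal (4 powr p) * (2 * Lpow p (\<lambda>x. g x - T x) + Lpow p (\<lambda>x. T x - T (x + d)))"
proof -
  define r where "r x = g x - T x" for x
  have [measurable]: "r \<in> borel_measurable borel" unfolding r_def by measurable
  let ?L = "Lpow p r" and ?M = "Lpow p (\<lambda>x. T x - T (x + d))"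
  have "Lpow p (\<lambda>x. g x - g (x + d)) \<le> ennreal (2 powr p) * (Lpow p (\<lambda>x. r x - r (x + d)) + ?M)"
  proof (rule Lpow_add_le)
    fix x
    have "g x - g (x + d) = (r x - r (x + d)) + (T x - T (x + d))" by (simp add: r_def)
    then show "norm (g x - g (x + d)) \<le> norm (r x - r (x + d)) + norm (T x - T (x + d))"
      using norm_triangle_ineq[of "r x - r (x + d)" "T x - T (x + d)"] by simp
  qed (use p in auto)
  also have "Lpow p (\<lambda>x. r x - r (x + d)) \<le> ennreal (2 powr p * 2) * ?L"
    by (rule Lpow_translate_diff_le) (use per p in \<open>auto simp: r_def\<close>)
  also have "ennreal (2 powr p * 2) * ?L + ?M \<le> ennreal (2 powr p * 2) * ?L + ennreal (2 powr p) * ?M"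
  proof (rule add_left_mono)
    have "1 * ?M \<le> ennreal (2 powr p) * ?M"
      using p ge_one_powr_ge_zero[of 2 p] by (intro mult_right_mono) (auto simp flip: ennreal_1 intro!: ennreal_leI)
    then show "?M \<le> ennreal (2 powr p) * ?M" by simp
  qed
  also have "ennreal (2 powr p) * (ennreal (2 powr p * 2) * ?L + ennreal (2 powr p) * ?M)
     = ennreal (4 powr p) * (2 * ?L + ?M)"
  proof -
    have "(4::real) powr p = 2 powr p * 2 powr p" by (simp add: powr_mult[symmetric])
    then show ?thesis by (simp add: ennreal_mult algebra_simps)
  qed
  finally show ?thesis
    unfolding r_def by (simp add: mult_left_mono add_right_mono)
qed

text \<open>Jensen's inequality on the unit interval, whose mass is 1.\<close>

lemma norm_fourier_coeff_le_1:
  assumes [measurable]: "g \<in> borel_measurable borel" and p: "1 \<le> p" and g1: "Lpow p g \<le> 1"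
  shows "norm (fourier_coeff g k) \<le> 1"
proof -
  have "ennreal (norm (fourier_coeff g k) powr p)
    = ennreal (norm (\<integral>t. of_real (indicator {0..<1} t) * (g t * fexp (- k) t) \<partial>lborel) powr p)"
    unfolding fourier_coeff_fexp set_lebesgue_integral_def by (simp add: scaleR_conv_of_real)
  also have "\<dots> \<le> ennreal (1 powr (p - 1)) * (\<integral>\<^sup>+t. ennreal (indicator {0..<1} t * norm (g t * fexp (- k) t) powr p) \<partial>lborel)"
    by (rule weighted_powr_mean) (use p in \<open>auto simp: ennreal_indicator\<close>)
  also have "(\<integral>\<^sup>+t. ennreal (indicator {0..<1} t * norm (g t * fexp (- k) t) powr p) \<partial>lborel) = Lpow p g"
    unfolding Lpow_def by (rule nn_integral_cong) (auto simp: indicator_def norm_mult)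
  also have "ennreal (1 powr (p - 1)) * Lpow p g \<le> ennreal 1" using g1 by simp
  finally have "ennreal (norm (fourier_coeff g k) powr p) \<le> ennreal 1" .
  then have "norm (fourier_coeff g k) powr p \<le> 1" by (subst (asm) ennreal_le_iff) auto
  then have "(norm (fourier_coeff g k) powr p) powr (1 / p) \<le> 1 powr (1 / p)"
    using p by (intro powr_mono2) auto
  then show ?thesis using p by (simp add: powr_powr)
qed

text \<open>Each character moves by at most \<open>2 * pi * K * \<bar>d\<bar>\<close>, and there are
  \<open>2 * K + 1 \<le> 3 * K\<close> of them; rounding \<open>2 * pi\<close> to 8 gives 24. The
  square of \<open>K\<close> is the source of the factor 2 in (b).\<close>

lemma norm_fourier_partial_diff_le:
  assumes c: "\<And>k. norm (fourier_coeff g k) \<le> 1" and K: "1 \<le> K"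
  shows "norm (fourier_partial g K x - fourier_partial g K (x + d)) \<le> 24 * (real K)\<^sup>2 * \<bar>d\<bar>"
proof -
  have e: "norm (fexp k x - fexp k (x + d)) \<le> 8 * real K * \<bar>d\<bar>" if k: "\<bar>k\<bar> \<le> int K" for k
  proof -
    have "fexp k x - fexp k (x + d) = fexp k x * (1 - fexp k d)"
      by (simp add: fexp_add_right algebra_simps)
    then have "norm (fexp k x - fexp k (x + d)) = norm (fexp k d - 1)"
      by (simp add: norm_mult norm_minus_commute)
    also have "\<dots> = 2 * \<bar>sin (2 * pi * real_of_int k * d / 2)\<bar>"
      using dist_exp_i_1[of "2 * pi * real_of_int k * d"] by (simp add: fexp_def cis_conv_exp mult.assoc)
    also have "\<dots> \<le> 2 * \<bar>2 * pi * real_of_int k * d / 2\<bar>"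
      by (intro mult_left_mono abs_sin_x_le_abs_x) auto
    also have "\<dots> = (2 * pi) * (\<bar>real_of_int k\<bar> * \<bar>d\<bar>)" by (simp add: abs_mult)
    also have "\<dots> \<le> 8 * (real K * \<bar>d\<bar>)"
      using k pi_less_4 by (intro mult_mono) auto
    finally show ?thesis by simp
  qed
  have "norm (fourier_partial g K x - fourier_partial g K (x + d))
      = norm (\<Sum>k\<in>{- int K..int K}. fourier_coeff g k * (fexp k x - fexp k (x + d)))"
    unfolding fourier_partial_def fexp_def by (simp add: sum_subtractf[symmetric] right_diff_distrib)
  also have "\<dots> \<le> (\<Sum>k\<in>{- int K..int K}. 1 * (8 * real K * \<bar>d\<bar>))"
    by (rule order_trans[OF norm_sum], intro sum_mono, unfold norm_mult, rule mult_mono[OF c e]) auto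
  also have "\<dots> = (2 * real K + 1) * (8 * real K * \<bar>d\<bar>)" by simp
  also have "\<dots> \<le> (3 * real K) * (8 * real K * \<bar>d\<bar>)"
    using K by (intro mult_right_mono) auto
  finally show ?thesis by (simp add: power2_eq_square)
qed

lemma Lpow_translate_diff_of_fourier_partial:
  assumes [measurable]: "g \<in> borel_measurable borel" and per: "\<And>x. g (frac x) = g x"
    and p: "1 \<le> p" and g1: "Lpow p g \<le> 1" and K: "1 \<le> K" and a: "0 \<le> a"
    and app: "Lpow p (\<lambda>x. g x - fourier_partial g K x) \<le> ennreal (a powr p)"
    and d: "(real K)\<^sup>2 * \<bar>d\<bar> \<le> a"
  shows "Lpow p (\<lambda>x. g x - g (x + d)) \<le> ennreal (4 powr p * (2 + 24 powr p) * a powr p)"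
proof -
  let ?T = "fourier_partial g K"
  have "Lpow p (\<lambda>x. ?T x - ?T (x + d)) \<le> Lpow p (\<lambda>x. of_real (24 * a))"
  proof (rule Lpow_mono)
    fix x
    have "norm (?T x - ?T (x + d)) \<le> 24 * (real K)\<^sup>2 * \<bar>d\<bar>"
      by (intro norm_fourier_partial_diff_le norm_fourier_coeff_le_1[of g p] K p g1) auto
    also have "\<dots> \<le> norm (complex_of_real (24 * a))" using d a by (simp add: abs_mult)
    finally show "norm (?T x - ?T (x + d)) \<le> norm (complex_of_real (24 * a))" .
  qed (use p in auto)
  also have "\<dots> = ennreal (24 powr p * a powr p)"
    using a by (simp add: Lpow_const norm_mult powr_mult del: of_real_mult)
  finally have T: "Lpow p (\<lambda>x. ?T x - ?T (x + d)) \<le> ennreal (24 powr p * a powr p)" .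
  have "Lpow p (\<lambda>x. g x - g (x + d))
      \<le> ennreal (4 powr p) * (2 * Lpow p (\<lambda>x. g x - ?T x) + Lpow p (\<lambda>x. ?T x - ?T (x + d)))"
    by (rule Lpow_translate_diff_perturb) (use per p in \<open>auto simp: fourier_partial_eq_mult\<close>)
  also have "\<dots> \<le> ennreal (4 powr p) * (2 * ennreal (a powr p) + ennreal (24 powr p * a powr p))"
    by (intro mult_left_mono add_mono app T) auto
  also have "2 * ennreal (a powr p) + ennreal (24 powr p * a powr p) = ennreal ((2 + 24 powr p) * a powr p)"
    by (simp add: distrib_right ennreal_mult)
  also have "ennreal (4 powr p) * ennreal ((2 + 24 powr p) * a powr p) = ennreal (4 powr p * (2 + 24 powr p) * a powr p)"
    by (simp add: ennreal_mult[symmetric] mult.assoc)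
  finally show ?thesis .
qed

section \<open>Averaging over intervals of equal length\<close>

lemma measurable_floor_mult [measurable]: "(\<lambda>x::real. \<lfloor>c * x\<rfloor>) \<in> borel \<rightarrow>\<^sub>M count_space UNIV"
  by measurable

lemma floor_mult_eq_iff:
  assumes "0 < K"
  shows "\<lfloor>real K * y\<rfloor> = j \<longleftrightarrow> y \<in> {real_of_int j / real K..<real_of_int (j + 1) / real K}"
  using assms by (auto simp: floor_eq_iff field_simps)

text \<open>On each cell \<open>s\<close> is the mean of \<open>g\<close>, so Jensen's inequality
  bounds the error by mean differences \<open>g x - g y\<close> within a cell. After enlarging the
  cell to a window around \<open>x\<close>, Tonelli turns these into translation
  differences.\<close>

lemma step_average:
  assumes [measurable]: "g \<in> borel_measurable borel" and per: "\<And>x. g (frac x) = g x"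
    and int: "set_integrable lborel {0..<1} g"
    and p: "1 \<le> p" and K: "0 < K"
    and mod: "\<And>d. \<bar>d\<bar> \<le> 1 / real K \<Longrightarrow> Lpow p (\<lambda>x. g x - g (x + d)) \<le> ennreal (a powr p)"
  obtains s where "step_fun K s" "s \<in> borel_measurable borel"
    "Lpow p (\<lambda>x. g x - s x) \<le> ennreal (2 * a powr p)"
proof
  define w where "w j y = real K * (if \<lfloor>real K * y\<rfloor> = j then 1 else 0)" for j :: int and y
  have [measurable]: "(\<lambda>z. w \<lfloor>real K * fst z\<rfloor> (snd z)) \<in> borel_measurable (borel \<Otimes>\<^sub>M borel)"
    unfolding w_def by measurable
  have [measurable]: "w j \<in> borel_measurable borel" for j unfolding w_def by measurable
  define \<sigma> where "\<sigma> j = (LINT y:{0..<1}|lborel. of_real (w j y) * g y)" for j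
  define s where "s x = \<sigma> \<lfloor>real K * x\<rfloor>" for x
  show "s \<in> borel_measurable borel" unfolding s_def by measurable
  show "step_fun K s"
    unfolding step_fun_def
  proof (intro allI impI)
    fix k x t
    assume "x \<in> {real k / real K..<real (k + 1) / real K}" "t \<in> {real k / real K..<real (k + 1) / real K}"
    then have "\<lfloor>real K * x\<rfloor> = int k" "\<lfloor>real K * t\<rfloor> = int k"
      unfolding floor_mult_eq_iff[OF K] by (auto simp: add.commute)
    then show "s x = s t" by (simp add: s_def)
  qed
  have mass: "(\<integral>\<^sup>+y. ennreal (w j y) \<partial>lborel) = 1" for j
  proof -
    have "(\<integral>\<^sup>+y. ennreal (w j y) \<partial>lborel)
      = (\<integral>\<^sup>+y. ennreal (real K) * indicator {real_of_int j / real K..<real_of_int (j + 1) / real K} y \<partial>lborel)"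
      by (rule nn_integral_cong) (auto simp: w_def floor_mult_eq_iff[OF K] indicator_def)
    also have "\<dots> = ennreal (real K) * ennreal (real_of_int (j + 1) / real K - real_of_int j / real K)"
      using K by (subst nn_integral_cmult_indicator) (auto simp: divide_right_mono)
    also have "\<dots> = 1"
      using K by (subst ennreal_mult[symmetric]) (auto simp: field_simps)
    finally show ?thesis .
  qed
  \<comment> \<open>A cell meeting the unit interval lies inside it, so restricting the averages to
    the unit interval changes nothing.\<close>
  have cell: "y \<in> {0..<1}" if "x \<in> {0..<1}" "w \<lfloor>real K * x\<rfloor> y \<noteq> 0" for x y
  proof -
    have eq: "\<lfloor>real K * y\<rfloor> = \<lfloor>real K * x\<rfloor>" using that by (auto simp: w_def split: if_splits)
    have "0 \<le> real K * x" "real K * x < real K" using that K by (auto simp: mult_less_cancel_left2)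
    then have "0 \<le> \<lfloor>real K * x\<rfloor>" "\<lfloor>real K * x\<rfloor> < int K" by (auto simp: floor_less_iff)
    then have "0 \<le> real K * y" "real K * y < real K"
      unfolding eq[symmetric] by (auto simp: floor_less_iff)
    then show ?thesis using K by (auto simp: zero_le_mult_iff mult_less_cancel_left2)
  qed
  have diff: "g x - s x = (\<integral>y. of_real (w \<lfloor>real K * x\<rfloor> y) * (g x - g y) \<partial>lborel)" if x: "x \<in> {0..<1}" for x
  proof -
    let ?w = "w \<lfloor>real K * x\<rfloor>"
    have ind: "indicator {0..<1} y *\<^sub>R (of_real (?w y) * z) = of_real (?w y) * z" for y and z :: complex
      using cell[OF x, of y] by (auto simp: indicator_def)
    have sx: "s x = (\<integral>y. of_real (?w y) * g y \<partial>lborel)"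
      unfolding s_def \<sigma>_def set_lebesgue_integral_def ind ..
    have i1: "integrable lborel ?w"
      using mass by (intro integrableI_nonneg) (auto simp: w_def)
    have "(\<integral>y. ?w y \<partial>lborel) = 1"
    proof (subst integral_eq_nn_integral)
      show "AE y in lborel. 0 \<le> ?w y" by (simp add: w_def)
    qed (auto simp: mass)
    then have "(\<integral>y. complex_of_real (?w y) \<partial>lborel) = 1" by simp
    then have gx: "(\<integral>y. complex_of_real (?w y) * g x \<partial>lborel) = g x" by simp
    have "set_integrable lborel {0..<1} (\<lambda>y. g y * complex_of_real (?w y))"
      by (rule set_integrable_mult_bounded[OF int, where B = "real K"]) (auto simp: w_def)
    then have i2: "integrable lborel (\<lambda>y. complex_of_real (?w y) * g y)"
      unfolding set_integrable_def using ind by (simp add: mult.commute)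
    have i3: "integrable lborel (\<lambda>y. complex_of_real (?w y) * g x)"
      using i1 by (intro integrable_mult_left integrable_of_real)
    show ?thesis
      unfolding right_diff_distrib sx using i2 i3 gx by (subst Bochner_Integration.integral_diff) auto
  qed
  have "Lpow p (\<lambda>x. g x - s x) \<le> (\<integral>\<^sup>+x\<in>{0..<1}. (\<integral>\<^sup>+d. ennreal (real K * indicator {- 1 / real K..1 / real K} d * norm (g x - g (x + d)) powr p) \<partial>lborel) \<partial>lborel)"
    unfolding Lpow_def
  proof (rule nn_integral_mono)
    fix x :: real
    let ?w = "w \<lfloor>real K * x\<rfloor>"
    have "ennreal (norm (g x - s x) powr p)
      \<le> (\<integral>\<^sup>+d. ennreal (real K * indicator {- 1 / real K..1 / real K} d * norm (g x - g (x + d)) powr p) \<partial>lborel)" if x: "x \<in> {0..<1}"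
    proof -
      have "ennreal (norm (g x - s x) powr p) \<le> ennreal (1 powr (p - 1)) * (\<integral>\<^sup>+y. ennreal (?w y * norm (g x - g y) powr p) \<partial>lborel)"
        unfolding diff[OF x] by (rule weighted_powr_mean) (use p mass in \<open>auto simp: w_def\<close>)
      also have "\<dots> = (\<integral>\<^sup>+y. ennreal (?w y * norm (g x - g y) powr p) \<partial>lborel)" by simp
      \<comment> \<open>Two points of a cell are at most \<open>1 / K\<close> apart; the window
        depends only on \<open>y - x\<close>, not on the position of \<open>x\<close> in its
        cell.\<close>
      also have "\<dots> \<le> (\<integral>\<^sup>+y. ennreal (real K * indicator {- 1 / real K..1 / real K} (y + (- x)) * norm (g x - g y) powr p) \<partial>lborel)"
      proof (intro nn_integral_mono ennreal_leI mult_right_mono)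
        fix y
        have "\<bar>y - x\<bar> \<le> 1 / real K" if "\<lfloor>real K * y\<rfloor> = \<lfloor>real K * x\<rfloor>"
        proof -
          have "\<bar>real K * y - real K * x\<bar> \<le> 1" using that by linarith
          then show ?thesis using K by (simp add: field_simps abs_le_iff)
        qed
        then show "?w y \<le> real K * indicator {- 1 / real K..1 / real K} (y + (- x))"
          by (auto simp: w_def indicator_def abs_le_iff)
      qed auto
      also have "\<dots> = (\<integral>\<^sup>+d. ennreal (real K * indicator {- 1 / real K..1 / real K} d * norm (g x - g (x + d)) powr p) \<partial>lborel)"
        by (subst nn_integral_translate[of _ x, symmetric]) (auto simp: add.commute)
      finally show ?thesis .
    qed
    then show "ennreal (norm (g x - s x) powr p) * indicator {0..<1} x
      \<le> (\<integral>\<^sup>+d. ennreal (real K * indicator {- 1 / real K..1 / real K} d * norm (g x - g (x + d)) powr p) \<partial>lborel) * indicator {0..<1} x"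
      by (auto simp: indicator_def)
  qed
  also have "\<dots> = (\<integral>\<^sup>+x. (\<integral>\<^sup>+d. ennreal (real K * indicator {- 1 / real K..1 / real K} d * norm (g x - g (x + d)) powr p) * indicator {0..<1} x \<partial>lborel) \<partial>lborel)"
    by (subst nn_integral_multc) auto
  also have "\<dots> = (\<integral>\<^sup>+d. (\<integral>\<^sup>+x. ennreal (real K * indicator {- 1 / real K..1 / real K} d * norm (g x - g (x + d)) powr p) * indicator {0..<1} x \<partial>lborel) \<partial>lborel)"
    by (rule lborel_pair.Fubini') measurable
  also have "\<dots> = (\<integral>\<^sup>+d. ennreal (real K * indicator {- 1 / real K..1 / real K} d) * Lpow p (\<lambda>x. g x - g (x + d)) \<partial>lborel)"
    unfolding Lpow_def by (subst nn_integral_cmult[symmetric]) (auto simp: ennreal_mult ac_simps)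
  also have "\<dots> \<le> (\<integral>\<^sup>+d. ennreal (real K * a powr p) * indicator {- 1 / real K..1 / real K} d \<partial>lborel)"
  proof (rule nn_integral_mono)
    fix d :: real
    have "ennreal (real K) * Lpow p (\<lambda>x. g x - g (x + d)) \<le> ennreal (real K) * ennreal (a powr p)" if "d \<in> {- 1 / real K..1 / real K}"
      by (intro mult_left_mono mod) (use that in auto)
    then show "ennreal (real K * indicator {- 1 / real K..1 / real K} d) * Lpow p (\<lambda>x. g x - g (x + d))
      \<le> ennreal (real K * a powr p) * indicator {- 1 / real K..1 / real K} d"
      by (auto simp: indicator_def ennreal_mult)
  qed
  \<comment> \<open>Window length \<open>2 / K\<close> against density \<open>K\<close>: this is the
    factor 2.\<close>
  also have "\<dots> = ennreal (real K * a powr p) * ennreal (1 / real K - (- 1 / real K))"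
    using K by (subst nn_integral_cmult_indicator) auto
  also have "\<dots> = ennreal (2 * a powr p)"
    using K by (subst ennreal_mult[symmetric]) (auto simp: field_simps)
  finally show "Lpow p (\<lambda>x. g x - s x) \<le> ennreal (2 * a powr p)" .
qed

section \<open>Translations of step functions\<close>

lemma nn_integral_unit_cells:
  fixes h :: "real \<Rightarrow> ennreal"
  assumes [measurable]: "h \<in> borel_measurable borel" and K: "0 < K"
  shows "(\<integral>\<^sup>+x\<in>{0..<1}. h x \<partial>lborel)
    = (\<Sum>k<K. ennreal (1 / real K) * (\<integral>\<^sup>+y\<in>{0..<1}. h ((real k + y) / real K) \<partial>lborel))"
proof -
  let ?C = "\<lambda>k::nat. {real k / real K..<real (k + 1) / real K}"
  have ind: "indicator {0..<1} x = (\<Sum>k<K. indicator (?C k) x :: ennreal)" for x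
  proof -
    have cell: "indicator (?C k) x = (if \<lfloor>real K * x\<rfloor> = int k then 1 else 0 :: ennreal)" for k
      using floor_mult_eq_iff[OF K, of x "int k"] by (auto simp: indicator_def add.commute)
    show ?thesis
    proof (cases "x \<in> {0..<1}")
      case True
      define k where "k = nat \<lfloor>real K * x\<rfloor>"
      have "0 \<le> real K * x" "real K * x < real K" using True K by (auto simp: mult_less_cancel_left2)
      then have k: "\<lfloor>real K * x\<rfloor> = int k" "k < K" by (auto simp: k_def floor_less_iff nat_less_iff)
      have "(\<Sum>j<K. indicator (?C j) x :: ennreal) = (\<Sum>j<K. if j = k then 1 else 0)"
        unfolding cell k by (intro sum.cong) auto
      then show ?thesis using True k by simp
    next
      case False
      have "\<lfloor>real K * x\<rfloor> \<noteq> int k" if "k < K" for k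
      proof
        assume "\<lfloor>real K * x\<rfloor> = int k"
        then have "x \<in> ?C k" unfolding floor_mult_eq_iff[OF K] by (auto simp: add.commute)
        moreover have "real (k + 1) / real K \<le> 1" using that K by (simp add: field_simps)
        moreover have "0 \<le> real k / real K" by simp
        ultimately have "x \<in> {0..<1}" unfolding atLeastLessThan_iff by linarith
        with False show False by simp
      qed
      then have "(\<Sum>j<K. indicator (?C j) x :: ennreal) = 0" unfolding cell by simp
      then show ?thesis using False by simp
    qed
  qed
  have "(\<integral>\<^sup>+x\<in>{0..<1}. h x \<partial>lborel) = (\<Sum>k<K. \<integral>\<^sup>+x\<in>?C k. h x \<partial>lborel)"
    unfolding ind sum_distrib_left by (rule nn_integral_sum) measurable
  also have "\<dots> = (\<Sum>k<K. ennreal (1 / real K) * (\<integral>\<^sup>+y\<in>{0..<1}. h ((real k + y) / real K) \<partial>lborel))"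
  proof (rule sum.cong[OF refl])
    fix k
    have "(\<integral>\<^sup>+x\<in>?C k. h x \<partial>lborel) = ennreal \<bar>1 / real K\<bar> *
        (\<integral>\<^sup>+y. h (real k / real K + 1 / real K * y) * indicator (?C k) (real k / real K + 1 / real K * y) \<partial>lborel)"
      by (rule nn_integral_real_affine) (use K in auto)
    also have "(\<integral>\<^sup>+y. h (real k / real K + 1 / real K * y) * indicator (?C k) (real k / real K + 1 / real K * y) \<partial>lborel)
      = (\<integral>\<^sup>+y\<in>{0..<1}. h ((real k + y) / real K) \<partial>lborel)"
    proof (rule nn_integral_cong)
      fix y
      have "real k / real K + 1 / real K * y = (real k + y) / real K" by (simp add: add_divide_distrib)
      moreover have "(real k + y) / real K \<in> ?C k \<longleftrightarrow> y \<in> {0..<1}"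
        using K by (auto simp: divide_le_cancel divide_less_cancel)
      ultimately show "h (real k / real K + 1 / real K * y) * indicator (?C k) (real k / real K + 1 / real K * y)
        = h ((real k + y) / real K) * indicator {0..<1} y" by (simp add: indicator_def)
    qed
    finally show "(\<integral>\<^sup>+x\<in>?C k. h x \<partial>lborel) = ennreal (1 / real K) * (\<integral>\<^sup>+y\<in>{0..<1}. h ((real k + y) / real K) \<partial>lborel)"
      by simp
  qed
  finally show ?thesis .
qed

text \<open>For uniformly distributed \<open>x\<close>, the cell index and the relative position in
  the cell are independent, so the integral factorises.\<close>

lemma nn_integral_cell_fraction:
  fixes \<sigma> :: "int \<Rightarrow> complex"
  assumes [measurable]: "B \<in> sets borel" and K: "0 < K"
  shows "(\<integral>\<^sup>+x\<in>{0..<1}. ennreal (indicator B (frac (real K * x)) * norm (\<sigma> \<lfloor>real K * x\<rfloor>) powr p) \<partial>lborel)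
    = (\<integral>\<^sup>+y\<in>{0..<1}. indicator B y \<partial>lborel) * Lpow p (\<lambda>x. \<sigma> \<lfloor>real K * x\<rfloor>)"
proof -
  have cells: "(\<integral>\<^sup>+x\<in>{0..<1}. ennreal (indicator A (frac (real K * x)) * norm (\<sigma> \<lfloor>real K * x\<rfloor>) powr p) \<partial>lborel)
    = (\<integral>\<^sup>+y\<in>{0..<1}. indicator A y \<partial>lborel) * (\<Sum>k<K. ennreal (1 / real K) * ennreal (norm (\<sigma> (int k)) powr p))"
    if [measurable]: "A \<in> sets borel" for A
  proof -
    have "(\<integral>\<^sup>+x\<in>{0..<1}. ennreal (indicator A (frac (real K * x)) * norm (\<sigma> \<lfloor>real K * x\<rfloor>) powr p) \<partial>lborel)
      = (\<Sum>k<K. ennreal (1 / real K) * (\<integral>\<^sup>+y\<in>{0..<1}. ennreal (indicator A (frac (real K * ((real k + y) / real K)))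
          * norm (\<sigma> \<lfloor>real K * ((real k + y) / real K)\<rfloor>) powr p) \<partial>lborel))"
      by (rule nn_integral_unit_cells[OF _ K]) measurable
    also have "\<dots> = (\<Sum>k<K. ennreal (1 / real K) * (ennreal (norm (\<sigma> (int k)) powr p) * (\<integral>\<^sup>+y\<in>{0..<1}. indicator A y \<partial>lborel)))"
    proof (intro sum.cong refl arg_cong2[where f = "(*)"])
      fix k
      have "(\<integral>\<^sup>+y\<in>{0..<1}. ennreal (indicator A (frac (real K * ((real k + y) / real K))) * norm (\<sigma> \<lfloor>real K * ((real k + y) / real K)\<rfloor>) powr p) \<partial>lborel)
        = (\<integral>\<^sup>+y. ennreal (norm (\<sigma> (int k)) powr p) * (indicator A y * indicator {0..<1} y) \<partial>lborel)"
      proof (rule nn_integral_cong)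
        fix y :: real
        have "frac (real k + y) = y" "\<lfloor>real k + y\<rfloor> = int k" if "y \<in> {0..<1}"
          using that by (auto simp: frac_unique_iff floor_eq_iff)
        then show "ennreal (indicator A (frac (real K * ((real k + y) / real K))) * norm (\<sigma> \<lfloor>real K * ((real k + y) / real K)\<rfloor>) powr p) * indicator {0..<1} y
          = ennreal (norm (\<sigma> (int k)) powr p) * (indicator A y * indicator {0..<1} y)"
          using K by (auto simp: indicator_def)
      qed
      also have "\<dots> = ennreal (norm (\<sigma> (int k)) powr p) * (\<integral>\<^sup>+y\<in>{0..<1}. indicator A y \<partial>lborel)"
        by (rule nn_integral_cmult) measurable
      finally show "(\<integral>\<^sup>+y\<in>{0..<1}. ennreal (indicator A (frac (real K * ((real k + y) / real K))) * norm (\<sigma> \<lfloor>real K * ((real k + y) / real K)\<rfloor>) powr p) \<partial>lborel)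
        = ennreal (norm (\<sigma> (int k)) powr p) * (\<integral>\<^sup>+y\<in>{0..<1}. indicator A y \<partial>lborel)" .
    qed
    finally show ?thesis by (simp add: sum_distrib_left ac_simps)
  qed
  \<comment> \<open>Taking the whole line as the set identifies the sum over cells.\<close>
  have "Lpow p (\<lambda>x. \<sigma> \<lfloor>real K * x\<rfloor>) = (\<Sum>k<K. ennreal (1 / real K) * ennreal (norm (\<sigma> (int k)) powr p))"
    using cells[of UNIV] by (simp add: Lpow_def)
  with cells[of B] show ?thesis by simp
qed

text \<open>A shift by at most one cell changes the value only at points near the end of a cell, and
  their images lie near the start of the next. By independence each of these two sets carries the
  share \<open>K * \<bar>d\<bar>\<close> of the whole integral. The jumps themselves are not
  bounded, so both values enter separately.\<close>

lemma Lpow_translate_diff_of_step: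
  fixes \<sigma> :: "int \<Rightarrow> complex"
  assumes K: "0 < K" and per: "\<And>j. \<sigma> (j + int K) = \<sigma> j" and p: "0 \<le> p" and d: "real K * \<bar>d\<bar> \<le> 1"
  defines "T \<equiv> \<lambda>x. \<sigma> \<lfloor>real K * x\<rfloor>"
  shows "Lpow p (\<lambda>x. T x - T (x + d)) \<le> ennreal (2 powr p * 2 * (real K * \<bar>d\<bar>)) * Lpow p T"
proof -
  have [measurable]: "T \<in> borel_measurable borel" unfolding T_def by measurable
  have per_mult: "\<sigma> (j + int K * i) = \<sigma> j" for i j
  proof (induction i rule: int_induct[where k = 0])
    case (step1 i)
    then show ?case using per[of "j + int K * i"] by (simp add: algebra_simps)
  next
    case (step2 i)
    then show ?case using per[of "j + int K * (i - 1)"] by (simp add: algebra_simps)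
  qed simp
  have K_frac: "real K * frac x = real K * x + of_int (int K * - \<lfloor>x\<rfloor>)" for x
    by (simp add: frac_def algebra_simps)
  have per_T: "T (frac x) = T x" for x
    unfolding T_def K_frac using per_mult by (simp only: floor_add_int[symmetric] floor_of_int)
  have nonneg: "Lpow p (\<lambda>x. T x - T (x + e)) \<le> ennreal (2 powr p * 2 * (real K * e)) * Lpow p T"
    if e: "0 \<le> e" "real K * e \<le> 1" for e
  proof -
    \<comment> \<open>The final part of a cell, for the starting points; \<open>B'\<close> is the
      initial part, for their images.\<close>
    define B where "B = {1 - real K * e..}"
    define B' where "B' = {..<real K * e}"
    have [measurable]: "B \<in> sets borel" "B' \<in> sets borel" by (auto simp: B_def B'_def)
    define H where "H A x = ennreal (indicator A (frac (real K * x)) * norm (T x) powr p)" for A x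
    have [measurable]: "H A \<in> borel_measurable borel" if [measurable]: "A \<in> sets borel" for A
      unfolding H_def by measurable
    have IH: "(\<integral>\<^sup>+x\<in>{0..<1}. H A x \<partial>lborel) = (\<integral>\<^sup>+y\<in>{0..<1}. indicator A y \<partial>lborel) * Lpow p T"
      if "A \<in> sets borel" for A
      unfolding H_def T_def using nn_integral_cell_fraction[OF that K] .
    have "(\<integral>\<^sup>+y\<in>{0..<1}. indicator B y \<partial>lborel) = (\<integral>\<^sup>+y. indicator {1 - real K * e..<1} y \<partial>lborel)"
      using e by (intro nn_integral_cong) (auto simp: indicator_def B_def)
    then have B: "(\<integral>\<^sup>+y\<in>{0..<1}. indicator B y \<partial>lborel) = ennreal (real K * e)"
      using e by simp
    have "(\<integral>\<^sup>+y\<in>{0..<1}. indicator B' y \<partial>lborel) = (\<integral>\<^sup>+y. indicator {0..<real K * e} y \<partial>lborel)"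
      using e by (intro nn_integral_cong) (auto simp: indicator_def B'_def)
    then have B': "(\<integral>\<^sup>+y\<in>{0..<1}. indicator B' y \<partial>lborel) = ennreal (real K * e)"
      using e by simp
    have "Lpow p (\<lambda>x. T x - T (x + e))
      \<le> (\<integral>\<^sup>+x. ennreal (2 powr p) * (H B x * indicator {0..<1} x + H B' (x + e) * indicator {0..<1} x) \<partial>lborel)"
      unfolding Lpow_def
    proof (rule nn_integral_mono)
      fix x :: real
      define r where "r = frac (real K * x)"
      have r: "0 \<le> r" "r < 1" by (auto simp: r_def frac_lt_1)
      have Kx: "real K * x = of_int \<lfloor>real K * x\<rfloor> + r" by (simp add: r_def frac_def)
      have Kxe: "real K * (x + e) = of_int \<lfloor>real K * x\<rfloor> + r + real K * e"
        using Kx by (simp only: distrib_left)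
      have Ke: "0 \<le> real K * e" using e by simp
      have "ennreal (norm (T x - T (x + e)) powr p) \<le> ennreal (2 powr p) * (H B x + H B' (x + e))"
      proof (cases "r + real K * e < 1")
        case True
        have "\<lfloor>real K * (x + e)\<rfloor> = \<lfloor>real K * x\<rfloor>"
          by (rule floor_unique) (use Kxe True r Ke in linarith)+
        then show ?thesis by (simp add: T_def)
      next
        case False
        \<comment> \<open>Since \<open>real K * e \<le> 1\<close>, exactly one cell boundary is
          crossed.\<close>
        have fl: "\<lfloor>real K * (x + e)\<rfloor> = \<lfloor>real K * x\<rfloor> + 1"
          by (rule floor_unique; unfold of_int_add of_int_1; use Kxe False r e(2) in linarith)
        then have "frac (real K * (x + e)) = r + real K * e - 1"
          unfolding frac_def fl using Kxe by (simp only: of_int_add of_int_1)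
        then have ind: "indicator B r = (1::real)" "indicator B' (frac (real K * (x + e))) = (1::real)"
          using False r by (auto simp: B_def B'_def)
        have "norm (T x - T (x + e)) powr p \<le> (norm (T x) + norm (T (x + e))) powr p"
          using p by (intro powr_mono2 norm_triangle_ineq4) auto
        also have "\<dots> \<le> 2 powr p * (norm (T x) powr p + norm (T (x + e)) powr p)"
          by (rule powr_add_le) (use p in auto)
        finally have "ennreal (norm (T x - T (x + e)) powr p) \<le> ennreal (2 powr p * (norm (T x) powr p + norm (T (x + e)) powr p))"
          by (rule ennreal_leI)
        then show ?thesis by (simp add: H_def r_def[symmetric] ind ennreal_mult)
      qed
      then show "ennreal (norm (T x - T (x + e)) powr p) * indicator {0..<1} x
        \<le> ennreal (2 powr p) * (H B x * indicator {0..<1} x + H B' (x + e) * indicator {0..<1} x)"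
        by (auto simp: indicator_def)
    qed
    also have "\<dots> = ennreal (2 powr p) * ((\<integral>\<^sup>+x\<in>{0..<1}. H B x \<partial>lborel) + (\<integral>\<^sup>+x\<in>{0..<1}. H B' (x + e) \<partial>lborel))"
      by (subst nn_integral_cmult, measurable) (subst nn_integral_add, auto)
    also have "(\<integral>\<^sup>+x\<in>{0..<1}. H B' (x + e) \<partial>lborel) = (\<integral>\<^sup>+x\<in>{0..<1}. H B' x \<partial>lborel)"
    proof (rule nn_integral_period_translate)
      fix x
      have "frac (real K * frac x) = frac (real K * x)"
        unfolding K_frac by (simp add: frac_def del: of_int_mult of_int_minus)
      then show "H B' (frac x) = H B' x" by (simp add: H_def per_T)
    qed measurable
    also have "(\<integral>\<^sup>+x\<in>{0..<1}. H B x \<partial>lborel) + (\<integral>\<^sup>+x\<in>{0..<1}. H B' x \<partial>lborel) = ennreal (2 * (real K * e)) * Lpow p T"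
      using e by (simp add: IH B B' distrib_right[symmetric] ennreal_plus[symmetric] mult.assoc del: ennreal_plus)
    also have "ennreal (2 powr p) * (ennreal (2 * (real K * e)) * Lpow p T) = ennreal (2 powr p * 2 * (real K * e)) * Lpow p T"
      using e by (simp add: ennreal_mult mult.assoc)
    finally show ?thesis .
  qed
  show ?thesis
  proof (cases "0 \<le> d")
    case True
    then show ?thesis using nonneg[of d] \<open>real K * \<bar>d\<bar> \<le> 1\<close> by simp
  next
    case False
    have per_add: "T (frac x + e) = T (x + e)" for x e
    proof -
      have fr: "frac (y + of_int j) = frac y" for y :: real and j by (simp add: frac_def)
      have "frac x + e = (x + e) + of_int (- \<lfloor>x\<rfloor>)" by (simp add: frac_def)
      then show ?thesis using fr per_T by metis
    qed
    \<comment> \<open>Translating the difference by \<open>- d\<close> exchanges its two terms and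
      reduces to a positive shift.\<close>
    have "Lpow p (\<lambda>x. T x - T (x + d)) = Lpow p (\<lambda>x. (\<lambda>x. T x - T (x + d)) (x + (- d)))"
      by (rule Lpow_translate[symmetric]) (auto simp: per_T per_add)
    also have "\<dots> = Lpow p (\<lambda>x. T x - T (x + (- d)))"
      by (rule Lpow_cong) (simp add: norm_minus_commute)
    finally show ?thesis using nonneg[of "- d"] \<open>real K * \<bar>d\<bar> \<le> 1\<close> False by simp
  qed
qed

text \<open>Values at left endpoints represent \<open>s\<close> by a sequence of cell values;
  \<open>mod\<close> makes the representation periodic, and measurable on the whole line.\<close>

lemma step_fun_eq_floor:
  assumes step: "step_fun K s" and K: "0 < K" and x: "0 \<le> x" "x < 1"
  shows "s x = s (real_of_int (\<lfloor>real K * x\<rfloor> mod int K) / real K)"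
proof -
  define k where "k = nat \<lfloor>real K * x\<rfloor>"
  have "0 \<le> real K * x" "real K * x < real K" using x K by (auto simp: mult_less_cancel_left2)
  then have k: "\<lfloor>real K * x\<rfloor> = int k" "k < K" by (auto simp: k_def floor_less_iff nat_less_iff)
  from k(1) have "x \<in> {real k / real K..<real (k + 1) / real K}"
    unfolding floor_mult_eq_iff[OF K] by (auto simp: add.commute)
  moreover have "real k / real K \<in> {real k / real K..<real (k + 1) / real K}"
    using K by (auto simp: divide_less_cancel)
  ultimately have "s x = s (real k / real K)"
    using step k(2) unfolding step_fun_def by metis
  then show ?thesis using k by simp
qed

text \<open>The translation bound is proportional to the size of the step function;
  \<open>a \<le> 1\<close> and the unit bound on \<open>g\<close> keep that size below a
  constant.\<close>

lemma Lpow_translate_diff_of_step_approx: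
  assumes [measurable]: "g \<in> borel_measurable borel" and per: "\<And>x. g (frac x) = g x"
    and p: "1 \<le> p" and g1: "Lpow p g \<le> 1" and K: "0 < K" and step: "step_fun K s"
    and a: "0 \<le> a" "a \<le> 1"
    and app: "Lpow p (\<lambda>x. g x - s x) \<le> ennreal (a powr p)"
    and d: "real K * \<bar>d\<bar> \<le> a powr p"
  shows "Lpow p (\<lambda>x. g x - g (x + d)) \<le> ennreal (4 powr p * (2 + 4 * 4 powr p) * a powr p)"
proof -
  have ap1: "a powr p \<le> 1" using a p by (intro powr_le1) auto
  define \<sigma> where "\<sigma> j = s (real_of_int (j mod int K) / real K)" for j
  define T where "T x = \<sigma> \<lfloor>real K * x\<rfloor>" for x
  have [measurable]: "T \<in> borel_measurable borel" unfolding T_def by measurable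
  have per_T: "T (frac x) = T x" for x
  proof -
    have "real K * frac x = real K * x + of_int (int K * - \<lfloor>x\<rfloor>)" by (simp add: frac_def algebra_simps)
    then have "\<lfloor>real K * frac x\<rfloor> = \<lfloor>real K * x\<rfloor> + int K * - \<lfloor>x\<rfloor>" by (simp only: floor_add_int)
    then show ?thesis unfolding T_def \<sigma>_def by (metis mod_mult_self2)
  qed
  have sT: "s x = T x" if "0 \<le> x" "x < 1" for x
    unfolding T_def \<sigma>_def by (rule step_fun_eq_floor[OF step K that])
  have appT: "Lpow p (\<lambda>x. g x - T x) \<le> ennreal (a powr p)"
    using app Lpow_cong[of "\<lambda>x. g x - s x" "\<lambda>x. g x - T x" p] sT by simp
  have "Lpow p T \<le> ennreal (2 powr p) * (Lpow p g + Lpow p (\<lambda>x. g x - T x))"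
    by (rule Lpow_add_le) (use p norm_triangle_sub[of "T _" "g _"] in \<open>auto simp: norm_minus_commute\<close>)
  also have "\<dots> \<le> ennreal (2 powr p) * (1 + 1)"
    using order_trans[OF appT] ap1 by (intro mult_left_mono add_mono g1) (auto simp: ennreal_le_1)
  also have "\<dots> = ennreal (2 powr p * 2)" by (simp add: ennreal_mult)
  finally have T: "Lpow p T \<le> ennreal (2 powr p * 2)" .
  have "Lpow p (\<lambda>x. T x - T (x + d)) \<le> ennreal (2 powr p * 2 * (real K * \<bar>d\<bar>)) * Lpow p T"
    unfolding T_def[abs_def]
    by (rule Lpow_translate_diff_of_step) (use p d ap1 K in \<open>auto simp: \<sigma>_def\<close>)
  also have "\<dots> \<le> ennreal (2 powr p * 2 * a powr p) * ennreal (2 powr p * 2)"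
    by (intro mult_mono T ennreal_leI mult_left_mono d) auto
  also have "\<dots> = ennreal (4 * 4 powr p * a powr p)"
  proof -
    have "(4::real) powr p = 2 powr p * 2 powr p" by (simp add: powr_mult[symmetric])
    then show ?thesis by (subst ennreal_mult[symmetric]) (auto simp: algebra_simps)
  qed
  finally have dT: "Lpow p (\<lambda>x. T x - T (x + d)) \<le> ennreal (4 * 4 powr p * a powr p)" .
  have "Lpow p (\<lambda>x. g x - g (x + d))
      \<le> ennreal (4 powr p) * (2 * Lpow p (\<lambda>x. g x - T x) + Lpow p (\<lambda>x. T x - T (x + d)))"
    by (rule Lpow_translate_diff_perturb) (use per per_T p in auto)
  also have "\<dots> \<le> ennreal (4 powr p) * (2 * ennreal (a powr p) + ennreal (4 * 4 powr p * a powr p))"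
    by (intro mult_left_mono add_mono appT dT) auto
  also have "2 * ennreal (a powr p) + ennreal (4 * 4 powr p * a powr p) = ennreal ((2 + 4 * 4 powr p) * a powr p)"
    by (simp add: distrib_right ennreal_mult)
  also have "ennreal (4 powr p) * ennreal ((2 + 4 * 4 powr p) * a powr p) = ennreal (4 powr p * (2 + 4 * 4 powr p) * a powr p)"
    by (simp add: ennreal_mult[symmetric] mult.assoc)
  finally show ?thesis .
qed

section \<open>Continuity of translations\<close>

lemma Lpow_tendsto_zero:
  assumes [measurable]: "\<And>i. u i \<in> borel_measurable borel" "w \<in> borel_measurable borel"
    and w: "Lpow p w < \<infinity>" and le: "\<And>i x. norm (u i x) \<le> norm (w x)" and p: "0 < p"
    and lim: "AE x in lborel. x \<in> {0..<1} \<longrightarrow> (\<lambda>i. u i x) \<longlonglongrightarrow> 0"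
  shows "(\<lambda>i. Lpow p (u i)) \<longlonglongrightarrow> 0"
proof -
  have "(\<lambda>i. \<integral>\<^sup>+x\<in>{0..<1}. ennreal (norm (u i x) powr p) \<partial>lborel) \<longlonglongrightarrow> (\<integral>\<^sup>+x. 0 \<partial>(lborel :: real measure))"
  proof (rule nn_integral_dominated_convergence[where w = "\<lambda>x. ennreal (norm (w x) powr p) * indicator {0..<1} x"])
    show "AE x in lborel. ennreal (norm (u i x) powr p) * indicator {0..<1} x \<le> ennreal (norm (w x) powr p) * indicator {0..<1} x" for i
      using le p by (intro AE_I2 mult_right_mono ennreal_leI powr_mono2) auto
    show "(\<integral>\<^sup>+x\<in>{0..<1}. ennreal (norm (w x) powr p) \<partial>lborel) < \<infinity>" using w by (simp add: Lpow_def)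
    show "AE x in lborel. (\<lambda>i. ennreal (norm (u i x) powr p) * indicator {0..<1} x) \<longlonglongrightarrow> 0"
      using lim
    proof eventually_elim
      case (elim x)
      show ?case
      proof (cases "x \<in> {0..<1}")
        case True
        with elim have "(\<lambda>i. norm (u i x)) \<longlonglongrightarrow> 0" by (auto intro: tendsto_norm_zero)
        then have "(\<lambda>i. norm (u i x) powr p) \<longlonglongrightarrow> 0"
          using tendsto_zero_powrI[of "\<lambda>i. norm (u i x)" sequentially "\<lambda>_. p" p] p by simp
        then have "(\<lambda>i. ennreal (norm (u i x) powr p)) \<longlonglongrightarrow> ennreal 0" by (rule tendsto_ennrealI)
        then show ?thesis using True by simp
      qed simp
    qed
  qed auto
  then show ?thesis by (simp add: Lpow_def)
qed

text \<open>Serves to show that the modulus is a minimum over a nonempty set. It is proved for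
  bounded continuous functions, then bounded measurable ones, then in general, each time by
  dominated convergence.\<close>

definition Lp_translation_continuous :: "real \<Rightarrow> (real \<Rightarrow> complex) \<Rightarrow> bool" where
  "Lp_translation_continuous p g \<longleftrightarrow>
     (\<forall>\<epsilon>>0. \<exists>\<eta>>0. \<forall>d. \<bar>d\<bar> \<le> \<eta> \<longrightarrow> Lpow p (\<lambda>x. g x - g (x + d)) \<le> ennreal \<epsilon>)"

lemma Lp_translation_continuous_approx:
  assumes [measurable]: "g \<in> borel_measurable borel" "\<And>i::nat. T i \<in> borel_measurable borel"
    and per: "\<And>x. g (frac x) = g x" "\<And>i x. T i (frac x) = T i x" and p: "0 \<le> p"
    and lim: "(\<lambda>i. Lpow p (\<lambda>x. g x - T i x)) \<longlonglongrightarrow> 0"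
    and T: "\<And>i. Lp_translation_continuous p (T i)"
  shows "Lp_translation_continuous p g"
  unfolding Lp_translation_continuous_def
proof (intro allI impI)
  fix \<epsilon> :: real assume \<epsilon>: "0 < \<epsilon>"
  \<comment> \<open>Three errors of size \<open>e\<close>, two from \<open>g - T i\<close> and one
    from \<open>T i\<close>, are multiplied by \<open>4 powr p\<close>.\<close>
  define e where "e = \<epsilon> / (4 powr p * 3)"
  have e: "0 < e" using \<epsilon> by (simp add: e_def)
  have "eventually (\<lambda>i. Lpow p (\<lambda>x. g x - T i x) < ennreal e) sequentially"
    using order_tendstoD(2)[OF lim, of "ennreal e"] e by simp
  then obtain i where i: "Lpow p (\<lambda>x. g x - T i x) < ennreal e"
    by (auto simp: eventually_sequentially)
  obtain \<eta> where \<eta>: "0 < \<eta>" "\<And>d. \<bar>d\<bar> \<le> \<eta> \<Longrightarrow> Lpow p (\<lambda>x. T i x - T i (x + d)) \<le> ennreal e"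
    using T[of i] e unfolding Lp_translation_continuous_def by blast
  have "Lpow p (\<lambda>x. g x - g (x + d)) \<le> ennreal \<epsilon>" if "\<bar>d\<bar> \<le> \<eta>" for d
  proof -
    have "Lpow p (\<lambda>x. g x - g (x + d))
        \<le> ennreal (4 powr p) * (2 * Lpow p (\<lambda>x. g x - T i x) + Lpow p (\<lambda>x. T i x - T i (x + d)))"
      by (rule Lpow_translate_diff_perturb) (use per p in auto)
    also have "\<dots> \<le> ennreal (4 powr p) * (2 * ennreal e + ennreal e)"
      using i by (intro mult_left_mono add_mono \<eta> that) auto
    also have "2 * ennreal e + ennreal e = ennreal (3 * e)"
      using e ennreal_plus[of "2 * e" e] by (simp add: ennreal_mult)
    also have "ennreal (4 powr p) * ennreal (3 * e) = ennreal \<epsilon>"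
      using e by (subst ennreal_mult[symmetric]) (auto simp: e_def)
    finally show ?thesis .
  qed
  with \<eta>(1) show "\<exists>\<eta>>0. \<forall>d. \<bar>d\<bar> \<le> \<eta> \<longrightarrow> Lpow p (\<lambda>x. g x - g (x + d)) \<le> ennreal \<epsilon>" by blast
qed

lemma Lp_translation_continuous_bounded_continuous:
  assumes h: "continuous_on UNIV h" and M: "\<And>x. norm (h x) \<le> M" and p: "0 < p"
  shows "Lp_translation_continuous p (\<lambda>x. h (frac x))"
proof (rule ccontr)
  have [measurable]: "h \<in> borel_measurable borel" by (intro borel_measurable_continuous_onI h)
  define g where "g x = h (frac x)" for x
  have [measurable]: "g \<in> borel_measurable borel" unfolding g_def by measurable
  assume "\<not> Lp_translation_continuous p (\<lambda>x. h (frac x))"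
  then obtain \<epsilon> where \<epsilon>: "0 < \<epsilon>"
    and "\<And>\<eta>. 0 < \<eta> \<Longrightarrow> \<exists>d. \<bar>d\<bar> \<le> \<eta> \<and> \<not> Lpow p (\<lambda>x. g x - g (x + d)) \<le> ennreal \<epsilon>"
    unfolding Lp_translation_continuous_def g_def by blast
  then have "\<forall>i. \<exists>d. \<bar>d\<bar> \<le> 1 / real (Suc i) \<and> \<not> Lpow p (\<lambda>x. g x - g (x + d)) \<le> ennreal \<epsilon>" by simp
  then obtain d where d: "\<And>i. \<bar>d i\<bar> \<le> 1 / real (Suc i)"
    and big: "\<And>i. \<not> Lpow p (\<lambda>x. g x - g (x + d i)) \<le> ennreal \<epsilon>" by metis
  have d0: "d \<longlonglongrightarrow> 0"
    by (rule Lim_null_comparison[OF _ LIMSEQ_inverse_real_of_nat])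
       (use d in \<open>auto simp: inverse_eq_divide intro!: always_eventually\<close>)
  have "(\<lambda>i. Lpow p (\<lambda>x. g x - g (x + d i))) \<longlonglongrightarrow> 0"
  proof (rule Lpow_tendsto_zero[where w = "\<lambda>x. of_real (2 * M)"])
    have "0 \<le> M" using M[of 0] norm_ge_zero order_trans by blast
    show "norm (g x - g (x + d i)) \<le> norm (complex_of_real (2 * M))" for i x
      using norm_triangle_ineq4[of "g x" "g (x + d i)"] M[of "frac x"] M[of "frac (x + d i)"] \<open>0 \<le> M\<close>
      by (simp add: g_def norm_mult)
    show "AE x in lborel. x \<in> {0..<1} \<longrightarrow> (\<lambda>i. g x - g (x + d i)) \<longlonglongrightarrow> 0"
      using AE_lborel_singleton[of "0::real"]
    proof eventually_elim
      case (elim x)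
      show ?case
      proof
        assume "x \<in> {0..<1}"
        with elim have x: "0 < x" "x < 1" by auto
        have lim: "(\<lambda>i. x + d i) \<longlonglongrightarrow> x" using tendsto_add[OF tendsto_const d0] by simp
        have "eventually (\<lambda>i. x + d i \<in> {0<..<1}) sequentially"
          using topological_tendstoD[OF lim, of "{0<..<1}"] x by simp
        then have "eventually (\<lambda>i. h (x + d i) = g (x + d i)) sequentially"
          by eventually_elim (auto simp: g_def frac_eq)
        moreover have "(\<lambda>i. h (x + d i)) \<longlonglongrightarrow> h x"
          using continuous_on_tendsto_compose[OF h lim] by simp
        ultimately have "(\<lambda>i. g (x + d i)) \<longlonglongrightarrow> h x"
          by (rule Lim_transform_eventually[rotated])
        moreover have "h x = g x" using x by (simp add: g_def frac_eq)
        ultimately show "(\<lambda>i. g x - g (x + d i)) \<longlonglongrightarrow> 0"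
          using tendsto_diff[OF tendsto_const, of "\<lambda>i. g (x + d i)" "g x" sequentially "g x"] by simp
      qed
    qed
  qed (use p in \<open>auto simp: Lpow_const simp del: of_real_mult\<close>)
  from order_tendstoD(2)[OF this, of "ennreal \<epsilon>"] \<epsilon>
  have "eventually (\<lambda>i. Lpow p (\<lambda>x. g x - g (x + d i)) < ennreal \<epsilon>) sequentially" by simp
  then show False using big by (auto simp: eventually_sequentially dest: less_imp_le)
qed

lemma Lp_translation_continuous_bounded:
  assumes [measurable]: "g \<in> borel_measurable borel" and per: "\<And>x. g (frac x) = g x"
    and M: "\<And>x. norm (g x) \<le> M" and p: "0 < p"
  shows "Lp_translation_continuous p g"
proof -
  have M0: "0 \<le> M" using M[of 0] norm_ge_zero order_trans by blast
  have "g \<in> borel_measurable lebesgue" by (rule measurable_completion) measurable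
  then have "g measurable_on UNIV" by (intro lebesgue_measurable_imp_measurable_on) auto
  then obtain N h where N: "negligible N" and h: "\<And>n::nat. continuous_on UNIV (h n)"
    and lim: "\<And>x. x \<notin> N \<Longrightarrow> (\<lambda>n. h n x) \<longlonglongrightarrow> g x"
    unfolding measurable_on_def by auto
  \<comment> \<open>A measurable function is an a.e. limit of continuous ones; projecting these to
    the ball of radius \<open>M\<close> keeps them continuous and provides the domination.\<close>
  define k where "k n x = closest_point (cball 0 M) (h n x)" for n x
  have cp: "continuous_on UNIV (closest_point (cball (0::complex) M))"
    using M0 by (intro continuous_on_closest_point) auto
  have k: "continuous_on UNIV (k n)" for n
    unfolding k_def by (rule continuous_on_compose2[OF cp h]) auto
  then have [measurable]: "k n \<in> borel_measurable borel" for n by (rule borel_measurable_continuous_onI)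
  have kM: "norm (k n x) \<le> M" for n x
    using closest_point_in_set[of "cball 0 M" "h n x"] M0 by (simp add: k_def)
  have klim: "(\<lambda>n. k n x) \<longlonglongrightarrow> g x" if "x \<notin> N" for x
  proof -
    have "(\<lambda>n. k n x) \<longlonglongrightarrow> closest_point (cball 0 M) (g x)"
      unfolding k_def using continuous_on_tendsto_compose[OF cp lim[OF that]] by simp
    then show ?thesis using M[of x] by (simp add: closest_point_self)
  qed
  have AE: "AE x in lborel. x \<notin> N"
    using N AE_not_in[of N lebesgue] by (simp add: negligible_iff_null_sets AE_completion_iff)
  show ?thesis
  proof (rule Lp_translation_continuous_approx)
    show "Lp_translation_continuous p (\<lambda>x. k i (frac x))" for i
      by (rule Lp_translation_continuous_bounded_continuous[OF k kM p])
    show "(\<lambda>i. Lpow p (\<lambda>x. g x - k i (frac x))) \<longlonglongrightarrow> 0"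
    proof (rule Lpow_tendsto_zero[where w = "\<lambda>x. of_real (2 * M)"])
      show "norm (g x - k i (frac x)) \<le> norm (complex_of_real (2 * M))" for i x
        using norm_triangle_ineq4[of "g x" "k i (frac x)"] M[of x] kM[of i "frac x"] M0
        by (simp add: norm_mult)
      show "AE x in lborel. x \<in> {0..<1} \<longrightarrow> (\<lambda>i. g x - k i (frac x)) \<longlonglongrightarrow> 0"
        using AE
      proof eventually_elim
        case (elim x)
        then show ?case
          using tendsto_diff[OF tendsto_const klim[OF elim], of "g x"] by (auto simp: frac_eq)
      qed
    qed (use p in \<open>auto simp: Lpow_const simp del: of_real_mult\<close>)
  qed (use per p in auto)
qed

text \<open>Truncation at height \<open>i\<close> agrees with \<open>g\<close> at each point from
  some \<open>i\<close> on, with \<open>g\<close> itself as dominating function.\<close>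

theorem Lp_translation_continuous:
  assumes [measurable]: "g \<in> borel_measurable borel" and per: "\<And>x. g (frac x) = g x"
    and fin: "Lpow p g < \<infinity>" and p: "0 < p"
  shows "Lp_translation_continuous p g"
proof (rule Lp_translation_continuous_approx)
  define T where "T i x = (if norm (g x) \<le> real i then g x else 0)" for i :: nat and x
  show T_meas [measurable]: "T i \<in> borel_measurable borel" for i unfolding T_def by measurable
  show "T i (frac x) = T i x" for i x by (simp add: T_def per)
  then show "Lp_translation_continuous p (T i)" for i
    by (intro Lp_translation_continuous_bounded[where M = "real i"] p) (auto simp: T_def)
  show "(\<lambda>i. Lpow p (\<lambda>x. g x - T i x)) \<longlonglongrightarrow> 0"
  proof (rule Lpow_tendsto_zero[where w = g])
    show "AE x in lborel. x \<in> {0..<1} \<longrightarrow> (\<lambda>i. g x - T i x) \<longlonglongrightarrow> 0"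
    proof (intro AE_I2 impI tendsto_eventually)
      fix x
      show "eventually (\<lambda>i. g x - T i x = 0) sequentially"
        using eventually_ge_at_top[of "nat \<lceil>norm (g x)\<rceil>"]
        by eventually_elim (auto simp: T_def ceiling_le_iff)
    qed
  qed (use fin p in \<open>auto simp: T_def\<close>)
qed (use per p in auto)

section \<open>Comparison of the rates\<close>

text \<open>Finiteness is essential: \<^const>\<open>lp_norm\<close> is \<open>0\<close> when the integral diverges.\<close>

lemma lp_norm_le_iff:
  assumes [measurable]: "h' \<in> borel_measurable borel" and fin: "Lpow p h' < \<infinity>"
    and eq: "\<And>t. 0 \<le> t \<Longrightarrow> t < 1 \<Longrightarrow> h t = h' t" and p: "0 < p" and a: "0 \<le> a"
  shows "lp_norm p h \<le> a \<longleftrightarrow> Lpow p h' \<le> ennreal (a powr p)"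
proof -
  obtain x where x: "Lpow p h' = ennreal x" "0 \<le> x"
    using fin by (metis ennreal_cases infinity_ennreal_def less_irrefl)
  have "(LINT t:{0..<1}|lborel. norm (h t) powr p) = (LINT t:{0..<1}|lborel. norm (h' t) powr p)"
    by (rule set_lebesgue_integral_cong) (auto simp: eq)
  also have "\<dots> = enn2real (\<integral>\<^sup>+t. ennreal (indicator {0..<1} t *\<^sub>R norm (h' t) powr p) \<partial>lborel)"
    unfolding set_lebesgue_integral_def by (rule integral_eq_nn_integral) auto
  also have "(\<integral>\<^sup>+t. ennreal (indicator {0..<1} t *\<^sub>R norm (h' t) powr p) \<partial>lborel) = Lpow p h'"
    unfolding Lpow_def by (rule nn_integral_cong) (auto simp: indicator_def)
  finally have norm: "lp_norm p h = x powr (1 / p)" using x by (simp add: lp_norm_def)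
  have "x powr (1 / p) \<le> a \<longleftrightarrow> x \<le> a powr p"
  proof
    assume "x powr (1 / p) \<le> a"
    then have "(x powr (1 / p)) powr p \<le> a powr p" using p by (intro powr_mono2) auto
    then show "x \<le> a powr p" using p x by (simp add: powr_powr)
  next
    assume "x \<le> a powr p"
    then have "x powr (1 / p) \<le> (a powr p) powr (1 / p)" using p x by (intro powr_mono2) auto
    then show "x powr (1 / p) \<le> a" using p a by (simp add: powr_powr)
  qed
  then show ?thesis unfolding norm x by (simp add: ennreal_le_iff)
qed

definition Lp_approx_rate :: "real \<Rightarrow> nat \<Rightarrow> (real \<Rightarrow> complex) \<Rightarrow> bool" where
  "Lp_approx_rate p n h \<longleftrightarrow> Lpow p h \<le> ennreal (inverse (2 ^ n) powr p)"

definition Lp_modulus_bound :: "real \<Rightarrow> (real \<Rightarrow> complex) \<Rightarrow> nat \<Rightarrow> nat \<Rightarrow> bool" where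
  "Lp_modulus_bound p g n m \<longleftrightarrow>
     (\<forall>d. \<bar>d\<bar> \<le> inverse (2 ^ m) \<longrightarrow> Lp_approx_rate p n (\<lambda>x. g x - g (x + d)))"

text \<open>Periodic Borel representatives on the whole line turn translation on the circle into
  plain addition.\<close>

definition torus_unit_ball :: "real \<Rightarrow> (real \<Rightarrow> complex) set" where
  "torus_unit_ball p = {g \<in> borel_measurable borel. (\<forall>x. g (frac x) = g x) \<and> Lpow p g \<le> 1}"

lemma torus_unit_ballD:
  assumes "g \<in> torus_unit_ball p"
  shows "g \<in> borel_measurable borel" "\<And>x. g (frac x) = g x" "Lpow p g \<le> 1" "Lpow p g < \<infinity>"
  using assms by (auto simp: torus_unit_ball_def intro: le_less_trans)

lemma periodization_in_unit_ball:
  assumes p: "1 < p" and f: "in_Lp p f" "lp_norm p f \<le> 1"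
  shows "(\<lambda>x. f (frac x)) \<in> torus_unit_ball p"
proof -
  define g where "g x = f (frac x)" for x
  have [measurable]: "(\<lambda>x. indicator {0..<1} x *\<^sub>R f x) \<in> borel_measurable borel"
    using f(1) unfolding in_Lp_def set_borel_measurable_def by simp
  \<comment> \<open>Measurability of \<open>f\<close> is known only after restriction to the unit
    interval, where \<open>frac\<close> takes its values.\<close>
  have "g = (\<lambda>x. indicator {0..<1} (frac x) *\<^sub>R f (frac x))"
    by (auto simp: g_def fun_eq_iff indicator_def frac_lt_1)
  moreover have "(\<lambda>x. indicator {0..<1} (frac x) *\<^sub>R f (frac x)) \<in> borel_measurable borel"
    by (rule measurable_compose[of frac borel borel "\<lambda>x. indicator {0..<1} x *\<^sub>R f x"]) measurable
  ultimately have [measurable]: "g \<in> borel_measurable borel" by simp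
  have fg: "f t = g t" if "0 \<le> t" "t < 1" for t using that by (simp add: g_def frac_eq)
  have "Lpow p g < \<infinity>"
  proof -
    have "integrable lborel (\<lambda>t. indicator {0..<1} t *\<^sub>R (norm (f t) powr p))"
      using f(1) unfolding in_Lp_def set_integrable_def by simp
    then have "(\<integral>\<^sup>+t. ennreal (norm (indicator {0..<1} t *\<^sub>R (norm (f t) powr p))) \<partial>lborel) < \<infinity>"
      unfolding integrable_iff_bounded by (rule conjunct2)
    also have "(\<integral>\<^sup>+t. ennreal (norm (indicator {0..<1} t *\<^sub>R (norm (f t) powr p))) \<partial>lborel) = Lpow p g"
      unfolding Lpow_def by (rule nn_integral_cong) (auto simp: indicator_def fg)
    finally show ?thesis .
  qed
  then have "Lpow p g \<le> 1"
    using lp_norm_le_iff[of g p f 1] f(2) fg p by simp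
  then show ?thesis by (auto simp: torus_unit_ball_def g_def[abs_def, symmetric]) (simp_all add: g_def)
qed

text \<open>A step function is unconstrained outside the unit interval and may fail to be measurable
  there. The representative also supplies the finiteness needed to interpret
  \<open>lp_norm\<close>.\<close>

lemma step_fun_borel_representative:
  assumes "step_fun K s" "0 < K"
  obtains T where "T \<in> borel_measurable borel" "\<And>x. 0 \<le> x \<Longrightarrow> x < 1 \<Longrightarrow> s x = T x" "Lpow p T < \<infinity>"
proof
  define \<sigma> where "\<sigma> j = s (real_of_int (j mod int K) / real K)" for j
  let ?T = "\<lambda>x. \<sigma> \<lfloor>real K * x\<rfloor>"
  show "?T \<in> borel_measurable borel" by measurable
  show "s x = ?T x" if "0 \<le> x" "x < 1" for x
    unfolding \<sigma>_def by (rule step_fun_eq_floor[OF assms that])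
  have "(\<integral>\<^sup>+x\<in>{0..<1}. ennreal (norm (?T x) powr p) \<partial>lborel)
    \<le> (\<integral>\<^sup>+x\<in>{0..<1::real}. ennreal (\<Sum>i<K. norm (s (real i / real K)) powr p) \<partial>lborel)"
  proof (intro nn_integral_mono mult_right_mono ennreal_leI)
    fix x :: real
    define i where "i = nat (\<lfloor>real K * x\<rfloor> mod int K)"
    have "\<lfloor>real K * x\<rfloor> mod int K = int i" "i < K"
      using assms(2) by (auto simp: i_def nat_less_iff)
    then show "norm (?T x) powr p \<le> (\<Sum>i<K. norm (s (real i / real K)) powr p)"
      using member_le_sum[of i "{..<K}" "\<lambda>i. norm (s (real i / real K)) powr p"] by (simp add: \<sigma>_def)
  qed auto
  also have "\<dots> < \<infinity>" by (simp add: nn_integral_cmult_indicator)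
  finally show "Lpow p ?T < \<infinity>" by (simp add: Lpow_def)
qed

lemma Lp_rates_periodization:
  assumes p: "1 < p" and f: "in_Lp p f" "lp_norm p f \<le> 1" and g_def: "g = (\<lambda>x. f (frac x))"
  shows "Lp_modulus p f n = (LEAST m. Lp_modulus_bound p g n m)"
    "Lp_step_rate p f n = (LEAST k. \<exists>s. step_fun (2 ^ k) s \<and> Lp_approx_rate p n (\<lambda>x. g x - s x))"
    "Lp_fourier_rate p f n = (LEAST m. Lp_approx_rate p n (\<lambda>x. g x - fourier_partial g (2 ^ m) x))"
proof -
  note g = torus_unit_ballD[OF periodization_in_unit_ball[OF p f, folded g_def]]
  note [measurable] = g(1)
  have fg: "f t = g t" if "0 \<le> t" "t < 1" for t using that by (simp add: g_def frac_eq)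
  have fin_sub: "Lpow p (\<lambda>x. g x - T x) < \<infinity>" if [measurable]: "T \<in> borel_measurable borel" and "Lpow p T < \<infinity>" for T
  proof -
    have "Lpow p (\<lambda>x. g x - T x) \<le> ennreal (2 powr p) * (Lpow p g + Lpow p T)"
      by (rule Lpow_add_le) (use p in \<open>auto intro: norm_triangle_ineq4\<close>)
    also have "\<dots> < \<infinity>" using g(4) that by (simp add: ennreal_mult_less_top)
    finally show ?thesis .
  qed
  have iff: "lp_norm p (\<lambda>t. f t - S t) \<le> inverse (2 ^ n) \<longleftrightarrow> Lp_approx_rate p n (\<lambda>t. g t - T t)"
    if [measurable]: "T \<in> borel_measurable borel" and "Lpow p T < \<infinity>"
      and "\<And>t. 0 \<le> t \<Longrightarrow> t < 1 \<Longrightarrow> S t = T t" for S T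
    unfolding Lp_approx_rate_def
  proof (rule lp_norm_le_iff)
    show "(\<lambda>t. g t - T t) \<in> borel_measurable borel" by measurable
    show "Lpow p (\<lambda>t. g t - T t) < \<infinity>" by (rule fin_sub) (use that in auto)
    show "f t - S t = g t - T t" if "0 \<le> t" "t < 1" for t
      using fg[OF that] \<open>\<And>t. 0 \<le> t \<Longrightarrow> t < 1 \<Longrightarrow> S t = T t\<close>[OF that] by simp
  qed (use p in auto)
  have "lp_norm p (\<lambda>t. f t - torus_shift d f t) \<le> inverse (2 ^ n) \<longleftrightarrow> Lp_approx_rate p n (\<lambda>t. g t - g (t + d))" for d
  proof (rule iff)
    show "Lpow p (\<lambda>t. g (t + d)) < \<infinity>"
      using Lpow_translate[OF g(1,2), of p d] g(4) by simp
    show "(\<lambda>t. g (t + d)) \<in> borel_measurable borel" by measurable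
    show "torus_shift d f t = g (t + d)" for t by (simp add: torus_shift_def g_def)
  qed
  then show "Lp_modulus p f n = (LEAST m. Lp_modulus_bound p g n m)"
    unfolding Lp_modulus_def Lp_modulus_bound_def by simp
  have "lp_norm p (\<lambda>t. f t - s t) \<le> inverse (2 ^ n) \<longleftrightarrow> Lp_approx_rate p n (\<lambda>x. g x - s x)"
    if step: "step_fun (2 ^ k) s" for k s
  proof -
    obtain T where T: "T \<in> borel_measurable borel" "\<And>x. 0 \<le> x \<Longrightarrow> x < 1 \<Longrightarrow> s x = T x" "Lpow p T < \<infinity>"
      using step_fun_borel_representative[OF step, of p] by (metis zero_less_power zero_less_numeral)
    have "Lpow p (\<lambda>x. g x - s x) = Lpow p (\<lambda>x. g x - T x)"
      by (rule Lpow_cong) (simp add: T)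
    then show ?thesis using iff[of T s] T by (simp add: Lp_approx_rate_def)
  qed
  then have "(\<exists>s. step_fun (2 ^ k) s \<and> lp_norm p (\<lambda>t. f t - s t) \<le> inverse (2 ^ n))
    \<longleftrightarrow> (\<exists>s. step_fun (2 ^ k) s \<and> Lp_approx_rate p n (\<lambda>x. g x - s x))" for k
    by blast
  then show "Lp_step_rate p f n = (LEAST k. \<exists>s. step_fun (2 ^ k) s \<and> Lp_approx_rate p n (\<lambda>x. g x - s x))"
    unfolding Lp_step_rate_def by simp
  have "fourier_coeff f k = fourier_coeff g k" for k
    unfolding fourier_coeff_def by (rule set_lebesgue_integral_cong) (auto simp: fg)
  then have "fourier_partial f K = fourier_partial g K" for K
    by (simp add: fourier_partial_def fun_eq_iff)
  moreover have "lp_norm p (\<lambda>t. f t - fourier_partial g K t) \<le> inverse (2 ^ n)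
      \<longleftrightarrow> Lp_approx_rate p n (\<lambda>x. g x - fourier_partial g K x)" for K
    by (rule iff) (use p Lpow_fourier_partial_finite[of p g K] in auto)
  ultimately show "Lp_fourier_rate p f n = (LEAST m. Lp_approx_rate p n (\<lambda>x. g x - fourier_partial g (2 ^ m) x))"
    unfolding Lp_fourier_rate_def by simp
qed

section \<open>Absorbing constants, and the four comparisons\<close>

lemma rate_absorb_const:
  assumes p: "1 \<le> p" and c: "0 < c" "c \<le> 2 ^ C"
  shows "ennreal (c * inverse (2 ^ (n + C)) powr p) \<le> ennreal (inverse (2 ^ n) powr p)"
proof (rule ennreal_leI)
  have "inverse (2 ^ C) powr p \<le> inverse (2 ^ C) powr (1::real)"
    using p by (intro powr_mono') (auto simp: inverse_le_1_iff)
  then have "c * inverse (2 ^ C) powr p \<le> 2 ^ C * inverse (2 ^ C)"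
    using c by (intro mult_mono) auto
  then have "inverse (2 ^ n) powr p * (c * inverse (2 ^ C) powr p) \<le> inverse (2 ^ n) powr p * 1"
    by (intro mult_left_mono) auto
  then show "c * inverse (2 ^ (n + C)) powr p \<le> inverse (2 ^ n) powr p"
    by (simp add: power_add powr_mult ac_simps)
qed

lemma const_le_power2:
  fixes c :: real
  obtains C0 :: nat where "\<And>C. C0 \<le> C \<Longrightarrow> c \<le> 2 ^ C"
proof -
  obtain C0 :: nat where C0: "c < 2 ^ C0" using real_arch_pow[of 2 c] by auto
  have "c \<le> 2 ^ C" if "C0 \<le> C" for C
    by (rule less_imp_le[OF less_le_trans[OF C0 power_increasing[OF that]]]) simp
  with that show ?thesis by blast
qed

text \<open>Holds for every \<open>C \<ge> C0\<close> because \<open>C\<close> occurs both in the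
  accuracy and in the bound, while the final constant is a maximum of several.\<close>

lemma fourier_approx_of_modulus:
  assumes p: "1 < p"
  obtains C0 where "\<And>C g n m. C0 \<le> C \<Longrightarrow> g \<in> torus_unit_ball p \<Longrightarrow> Lp_modulus_bound p g (n + C) m
    \<Longrightarrow> Lp_approx_rate p n (\<lambda>x. g x - fourier_partial g (2 ^ (m + n + C)) x)"
proof -
  obtain c where c: "0 < c" and bd: "\<And>g a \<eta> N. g \<in> borel_measurable borel \<Longrightarrow> (\<And>x. g (frac x) = g x) \<Longrightarrow> Lpow p g \<le> 1 \<Longrightarrow> 0 < \<eta> \<Longrightarrow>
      (\<And>d. \<bar>d\<bar> \<le> \<eta> \<Longrightarrow> Lpow p (\<lambda>x. g x - g (x + d)) \<le> ennreal (a powr p)) \<Longrightarrow>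
      1 / (real (N + 1) * \<eta>) \<le> a \<Longrightarrow>
      Lpow p (\<lambda>x. g x - fourier_partial g N x) \<le> ennreal (c * a powr p)"
    by (rule Lpow_diff_fourier_partial[OF p]) blast
  obtain C0 :: nat where C0: "\<And>C. C0 \<le> C \<Longrightarrow> c \<le> 2 ^ C" using const_le_power2 by blast
  have "Lp_approx_rate p n (\<lambda>x. g x - fourier_partial g (2 ^ (m + n + C)) x)"
    if C: "C0 \<le> C" and g: "g \<in> torus_unit_ball p" and mod: "Lp_modulus_bound p g (n + C) m" for C g n m
  proof -
    have "Lpow p (\<lambda>x. g x - fourier_partial g (2 ^ (m + n + C)) x) \<le> ennreal (c * inverse (2 ^ (n + C)) powr p)"
    proof (rule bd)
      show "0 < inverse (2 ^ m :: real)" by simp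
      show "Lpow p (\<lambda>x. g x - g (x + d)) \<le> ennreal (inverse (2 ^ (n + C)) powr p)" if "\<bar>d\<bar> \<le> inverse (2 ^ m)" for d
        using mod that unfolding Lp_modulus_bound_def Lp_approx_rate_def by blast
      \<comment> \<open>The degree must beat the window \<open>\<eta> = 2^-m\<close> by the accuracy
        \<open>2^-(n + C)\<close>; this is where the exponents add up.\<close>
      have "1 / (real (2 ^ (m + n + C) + 1) * inverse (2 ^ m)) \<le> 1 / (real (2 ^ (m + n + C)) * inverse (2 ^ m))"
        by (intro divide_left_mono mult_right_mono mult_pos_pos) (auto simp: add_pos_nonneg)
      also have "\<dots> = inverse (2 ^ (n + C))" by (simp add: power_add field_simps)
      finally show "1 / (real (2 ^ (m + n + C) + 1) * inverse (2 ^ m)) \<le> inverse (2 ^ (n + C))" .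
    qed (use torus_unit_ballD[OF g] in auto)
    also have "\<dots> \<le> ennreal (inverse (2 ^ n) powr p)"
      by (rule rate_absorb_const) (use p c C0[OF C] in auto)
    finally show ?thesis by (simp add: Lp_approx_rate_def)
  qed
  then show ?thesis using that by blast
qed

text \<open>With \<open>K = 2^k\<close>, the shift bound makes \<open>K^2 * \<bar>d\<bar>\<close> at
  most the accuracy \<open>2^-(n + C)\<close>.\<close>

lemma modulus_of_fourier_approx:
  assumes p: "1 < p"
  obtains C0 where "\<And>C g n k. C0 \<le> C \<Longrightarrow> g \<in> torus_unit_ball p
    \<Longrightarrow> Lp_approx_rate p (n + C) (\<lambda>x. g x - fourier_partial g (2 ^ k) x)
    \<Longrightarrow> Lp_modulus_bound p g n (2 * k + n + C)"
proof -
  define c where "c = 4 powr p * (2 + 24 powr p)"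
  have c: "0 < c" unfolding c_def by (intro mult_pos_pos add_pos_nonneg) auto
  obtain C0 :: nat where C0: "\<And>C. C0 \<le> C \<Longrightarrow> c \<le> 2 ^ C" using const_le_power2 by blast
  have "Lp_modulus_bound p g n (2 * k + n + C)"
    if C: "C0 \<le> C" and g: "g \<in> torus_unit_ball p"
      and app: "Lp_approx_rate p (n + C) (\<lambda>x. g x - fourier_partial g (2 ^ k) x)" for C g n k
    unfolding Lp_modulus_bound_def
  proof (intro allI impI)
    fix d :: real assume d: "\<bar>d\<bar> \<le> inverse (2 ^ (2 * k + n + C))"
    have "Lpow p (\<lambda>x. g x - g (x + d)) \<le> ennreal (4 powr p * (2 + 24 powr p) * inverse (2 ^ (n + C)) powr p)"
    proof (rule Lpow_translate_diff_of_fourier_partial)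
      show "Lpow p (\<lambda>x. g x - fourier_partial g (2 ^ k) x) \<le> ennreal (inverse (2 ^ (n + C)) powr p)"
        using app by (simp add: Lp_approx_rate_def)
      have "(real (2 ^ k))\<^sup>2 * \<bar>d\<bar> \<le> (real (2 ^ k))\<^sup>2 * inverse (2 ^ (2 * k + n + C))"
        by (intro mult_left_mono d) auto
      also have "(real (2 ^ k))\<^sup>2 * inverse (2 ^ (2 * k + n + C)) = inverse (2 ^ (n + C))"
      proof -
        have "(real (2 ^ k))\<^sup>2 = 2 ^ (2 * k)" by (simp add: power_even_eq)
        then show ?thesis by (simp add: power_add)
      qed
      finally show "(real (2 ^ k))\<^sup>2 * \<bar>d\<bar> \<le> inverse (2 ^ (n + C))" .
    qed (use p torus_unit_ballD[OF g] in auto)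
    also have "\<dots> \<le> ennreal (inverse (2 ^ n) powr p)"
      unfolding c_def[symmetric] by (rule rate_absorb_const) (use p c C0[OF C] in auto)
    finally show "Lp_approx_rate p n (\<lambda>x. g x - g (x + d))" by (simp add: Lp_approx_rate_def)
  qed
  then show ?thesis using that by blast
qed

text \<open>Averaging loses only the factor 2, so \<open>C = 1\<close> already absorbs it.\<close>

lemma step_approx_of_modulus:
  assumes p: "1 < p" and C: "1 \<le> C" and g: "g \<in> torus_unit_ball p"
    and mod: "Lp_modulus_bound p g (n + C) m"
  obtains s where "step_fun (2 ^ m) s" "Lp_approx_rate p n (\<lambda>x. g x - s x)"
proof -
  note g = torus_unit_ballD[OF g]
  have int: "set_integrable lborel {0..<1} g"
    by (rule set_integrable_of_Lpow[where p = p]) (use p g in auto)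
  obtain s where s: "step_fun (2 ^ m) s"
    "Lpow p (\<lambda>x. g x - s x) \<le> ennreal (2 * inverse (2 ^ (n + C)) powr p)"
  proof (rule step_average[OF g(1,2) int])
    show "Lpow p (\<lambda>x. g x - g (x + d)) \<le> ennreal (inverse (2 ^ (n + C)) powr p)" if "\<bar>d\<bar> \<le> 1 / real (2 ^ m)" for d
      using mod that unfolding Lp_modulus_bound_def Lp_approx_rate_def by (simp add: inverse_eq_divide)
  qed (use p in auto)
  note s(2)
  also have "ennreal (2 * inverse (2 ^ (n + C)) powr p) \<le> ennreal (inverse (2 ^ n) powr p)"
    by (rule rate_absorb_const) (use p C power_increasing[of 1 C "2::real"] in auto)
  finally show ?thesis using that s(1) by (simp add: Lp_approx_rate_def)
qed

text \<open>Here the accuracy is increased by a fixed \<open>C0\<close>: its cost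
  \<open>p * C0\<close> exceeds \<open>C0\<close> because \<open>p > 1\<close>, so it must be
  absorbed by a larger constant chosen afterwards.\<close>

lemma modulus_of_step_approx:
  assumes p: "1 < p"
  obtains C0 where "\<And>g n k s. g \<in> torus_unit_ball p \<Longrightarrow> step_fun (2 ^ k) s
    \<Longrightarrow> Lp_approx_rate p (n + C0) (\<lambda>x. g x - s x)
    \<Longrightarrow> Lp_modulus_bound p g n (nat \<lceil>real k + p * real (n + C0)\<rceil>)"
proof -
  define c where "c = 4 powr p * (2 + 4 * 4 powr p)"
  have c: "0 < c" unfolding c_def by (intro mult_pos_pos add_pos_nonneg) auto
  obtain C0 :: nat where C0: "\<And>C. C0 \<le> C \<Longrightarrow> c \<le> 2 ^ C" using const_le_power2 by blast
  have "Lp_modulus_bound p g n (nat \<lceil>real k + p * real (n + C0)\<rceil>)"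
    if g: "g \<in> torus_unit_ball p" and step: "step_fun (2 ^ k) s"
      and app: "Lp_approx_rate p (n + C0) (\<lambda>x. g x - s x)" for g n k s
    unfolding Lp_modulus_bound_def
  proof (intro allI impI)
    define m where "m = nat \<lceil>real k + p * real (n + C0)\<rceil>"
    fix d :: real assume d: "\<bar>d\<bar> \<le> inverse (2 ^ nat \<lceil>real k + p * real (n + C0)\<rceil>)"
    have m: "real k + p * real (n + C0) \<le> real m" unfolding m_def by (rule real_nat_ceiling_ge)
    have "Lpow p (\<lambda>x. g x - g (x + d)) \<le> ennreal (4 powr p * (2 + 4 * 4 powr p) * inverse (2 ^ (n + C0)) powr p)"
    proof (rule Lpow_translate_diff_of_step_approx)
      show "Lpow p (\<lambda>x. g x - s x) \<le> ennreal (inverse (2 ^ (n + C0)) powr p)"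
        using app by (simp add: Lp_approx_rate_def)
      show "step_fun (2 ^ k) s" by (rule step)
      have "real (2 ^ k) * \<bar>d\<bar> \<le> 2 powr real k * inverse (2 powr real m)"
        using d by (simp add: powr_realpow m_def)
      also have "\<dots> = 2 powr (real k - real m)" by (simp add: powr_diff divide_inverse)
      also have "\<dots> \<le> 2 powr (- (real (n + C0)) * p)"
        using m by (intro powr_mono) (auto simp: algebra_simps)
      also have "\<dots> = (2 powr (- real (n + C0))) powr p" by (simp add: powr_powr)
      also have "2 powr (- real (n + C0)) = inverse (2 ^ (n + C0) :: real)"
        by (simp only: powr_minus powr_realpow zero_less_numeral)
      finally show "real (2 ^ k) * \<bar>d\<bar> \<le> inverse (2 ^ (n + C0)) powr p" .
      show "inverse (2 ^ (n + C0)) \<le> (1::real)" by (simp add: inverse_le_1_iff)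
    qed (use p torus_unit_ballD[OF g] in auto)
    also have "\<dots> \<le> ennreal (inverse (2 ^ n) powr p)"
      unfolding c_def[symmetric] by (rule rate_absorb_const) (use p c C0 in auto)
    finally show "Lp_approx_rate p n (\<lambda>x. g x - g (x + d))" by (simp add: Lp_approx_rate_def)
  qed
  then show ?thesis using that by blast
qed

lemma Lp_modulus_bound_exists:
  assumes p: "1 < p" and g: "g \<in> torus_unit_ball p"
  shows "\<exists>m. Lp_modulus_bound p g n m"
proof -
  have "Lp_translation_continuous p g"
    by (rule Lp_translation_continuous) (use torus_unit_ballD[OF g] p in auto)
  then obtain \<eta> where \<eta>: "0 < \<eta>"
    "\<And>d. \<bar>d\<bar> \<le> \<eta> \<Longrightarrow> Lpow p (\<lambda>x. g x - g (x + d)) \<le> ennreal (inverse (2 ^ n) powr p)"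
    unfolding Lp_translation_continuous_def
    by (metis powr_gt_zero positive_imp_inverse_positive zero_less_power zero_less_numeral less_irrefl)
  obtain m :: nat where "(1 / 2) ^ m < \<eta>" using real_arch_pow_inv[OF \<eta>(1), of "1 / 2"] by auto
  then have "inverse (2 ^ m) \<le> \<eta>" by (simp add: power_one_over inverse_eq_divide)
  then have "Lp_modulus_bound p g n m"
    unfolding Lp_modulus_bound_def Lp_approx_rate_def using \<eta>(2) by (meson order_trans)
  then show ?thesis ..
qed

theorem theorem2p5:
  fixes p :: real
  assumes "1 < p"
  shows "\<exists>C::nat. \<forall>(f :: real \<Rightarrow> complex) (n::nat).
     in_Lp p f \<and> lp_norm p f \<le> 1 \<longrightarrow>
       Lp_fourier_rate p f n \<le> Lp_modulus p f (n + C) + n + C \<and>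
       Lp_modulus p f n \<le> 2 * Lp_fourier_rate p f (n + C) + n + C \<and>
       Lp_step_rate p f n \<le> Lp_modulus p f (n + C) \<and>
       real (Lp_modulus p f n) \<le> real (Lp_step_rate p f (n + C)) + p * real n + real C"
proof -
  note p = \<open>1 < p\<close>
  obtain Ca where a: "\<And>C g n m. Ca \<le> C \<Longrightarrow> g \<in> torus_unit_ball p \<Longrightarrow> Lp_modulus_bound p g (n + C) m
    \<Longrightarrow> Lp_approx_rate p n (\<lambda>x. g x - fourier_partial g (2 ^ (m + n + C)) x)"
    by (rule fourier_approx_of_modulus[OF p]) blast
  obtain Cb where b: "\<And>C g n k. Cb \<le> C \<Longrightarrow> g \<in> torus_unit_ball p
    \<Longrightarrow> Lp_approx_rate p (n + C) (\<lambda>x. g x - fourier_partial g (2 ^ k) x)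
    \<Longrightarrow> Lp_modulus_bound p g n (2 * k + n + C)"
    by (rule modulus_of_fourier_approx[OF p]) blast
  obtain Cd where d: "\<And>g n k s. g \<in> torus_unit_ball p \<Longrightarrow> step_fun (2 ^ k) s
    \<Longrightarrow> Lp_approx_rate p (n + Cd) (\<lambda>x. g x - s x)
    \<Longrightarrow> Lp_modulus_bound p g n (nat \<lceil>real k + p * real (n + Cd)\<rceil>)"
    by (rule modulus_of_step_approx[OF p]) blast
  \<comment> \<open>The last entry covers the cost \<open>p * Cd\<close> and the 1 lost to rounding
    up in (d).\<close>
  define C where "C = max (max Ca Cb) (max (max 1 Cd) (nat \<lceil>p * real Cd + 1\<rceil>))"
  have C: "Ca \<le> C" "Cb \<le> C" "1 \<le> C" "Cd \<le> C" by (auto simp: C_def)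
  have Cp: "p * real Cd + 1 \<le> real C"
    using real_nat_ceiling_ge[of "p * real Cd + 1"] by (auto simp: C_def le_max_iff_disj)
  show ?thesis
  proof (intro exI[of _ C] allI impI)
    fix f :: "real \<Rightarrow> complex" and n :: nat
    assume "in_Lp p f \<and> lp_norm p f \<le> 1"
    then have f: "in_Lp p f" "lp_norm p f \<le> 1" by auto
    define g where "g = (\<lambda>x. f (frac x))"
    have g: "g \<in> torus_unit_ball p"
      unfolding g_def by (rule periodization_in_unit_ball[OF p f])
    let ?M = "Lp_modulus_bound p g"
    let ?S = "\<lambda>n k. \<exists>s. step_fun (2 ^ k) s \<and> Lp_approx_rate p n (\<lambda>x. g x - s x)"
    let ?F = "\<lambda>n m. Lp_approx_rate p n (\<lambda>x. g x - fourier_partial g (2 ^ m) x)"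
    note rates = Lp_rates_periodization[OF p f g_def]
    have M: "?M i (Lp_modulus p f i)" for i
      unfolding rates by (rule LeastI_ex[OF Lp_modulus_bound_exists[OF p g]])
    \<comment> \<open>The estimate behind (a), applied to an attained modulus, is also the witness
      that the Fourier rate exists; likewise (c) for the step rate.\<close>
    have F_ex: "?F i (Lp_modulus p f (i + C) + i + C)" for i
      by (rule a[OF C(1) g M])
    have S_ex: "?S i (Lp_modulus p f (i + C))" for i
      using step_approx_of_modulus[OF p C(3) g M] by metis
    have F: "?F i (Lp_fourier_rate p f i)" for i
      unfolding rates by (rule LeastI[of "?F i", OF F_ex])
    have S: "?S i (Lp_step_rate p f i)" for i
      unfolding rates(2) by (rule LeastI[of "?S i", OF S_ex])
    have "Lp_fourier_rate p f n \<le> Lp_modulus p f (n + C) + n + C"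
      unfolding rates(3) by (rule Least_le[of "?F n", OF F_ex])
    moreover have "Lp_modulus p f n \<le> 2 * Lp_fourier_rate p f (n + C) + n + C"
      unfolding rates(1)[of n] by (rule Least_le, rule b[OF C(2) g F])
    moreover have "Lp_step_rate p f n \<le> Lp_modulus p f (n + C)"
      unfolding rates(2) by (rule Least_le[of "?S n", OF S_ex])
    moreover have "real (Lp_modulus p f n) \<le> real (Lp_step_rate p f (n + C)) + p * real n + real C"
    proof -
      define k where "k = Lp_step_rate p f (n + C)"
      define r where "r = real k + p * real (n + Cd)"
      obtain s where s: "step_fun (2 ^ k) s" "Lp_approx_rate p (n + C) (\<lambda>x. g x - s x)"
        using S[of "n + C"] by (auto simp: k_def)
      note s(2)[unfolded Lp_approx_rate_def]
      \<comment> \<open>Accuracy \<open>n + C\<close> is weakened to \<open>n + Cd\<close>, so that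
        only \<open>p * Cd\<close> enters the exponent.\<close>
      also have "ennreal (inverse (2 ^ (n + C)) powr p) \<le> ennreal (inverse (2 ^ (n + Cd)) powr p)"
        using C(4) p by (intro ennreal_leI powr_mono2 le_imp_inverse_le power_increasing) auto
      finally have "Lp_approx_rate p (n + Cd) (\<lambda>x. g x - s x)" by (simp add: Lp_approx_rate_def)
      from d[OF g s(1) this] have "Lp_modulus p f n \<le> nat \<lceil>r\<rceil>"
        unfolding rates(1) r_def by (rule Least_le)
      moreover have "0 \<le> r" using p by (simp add: r_def)
      ultimately have "real (Lp_modulus p f n) \<le> r + 1" by linarith
      also have "\<dots> \<le> real k + p * real n + real C"
        using Cp by (simp add: r_def distrib_left)
      finally show ?thesis by (simp add: k_def)
    qed
    ultimately show "Lp_fourier_rate p f n \<le> Lp_modulus p f (n + C) + n + C \<and>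
       Lp_modulus p f n \<le> 2 * Lp_fourier_rate p f (n + C) + n + C \<and>
       Lp_step_rate p f n \<le> Lp_modulus p f (n + C) \<and>
       real (Lp_modulus p f n) \<le> real (Lp_step_rate p f (n + C)) + p * real n + real C"
      by blast
  qed
qed

end
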